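(* Let $q\in(1,\infty)$ and $c\in(0,\infty)$. Let $X_1:=\sqrt{c}\,\alpha+\gamma$ and $X_2:=-q^{-1}\sqrt{c}\,\gamma+\alpha^{*}$, linear operators on $\ell^2(\mathbb{Z}_{\ge})$. Then there is an isomorphism of $C^*$-algebras $$C\big(\mathbb{C}P^1_{q,c}\big)\cong C^*\big(\{X_1^*X_2,\;X_1^*X_1\}\big),$$ and $C\big(\mathbb{C}P^1_{q,c}\big)$ is isomorphic to the pullback $$\mathcal{T}\oplus_{C(\mathbb{T})}\mathcal{T}:=\{(T,S)\in\mathcal{T}\oplus\mathcal{T}:\ \sigma(T)=\sigma(S)\}$$ of two copies of the standard Toeplitz $C^*$-algebra $\mathcal{T}$ along the symbol map $\sigma:\mathcal{T}\to C(\mathbb{T})$.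
   Context: $\mathbb{Z}_{\ge}=\{0,1,2,\dots\}$, and $\{e_n\}_{n\ge 0}$ is the canonical orthonormal basis of $\ell^2(\mathbb{Z}_{\ge})$. The bounded operators $\alpha,\gamma$ on $\ell^2(\mathbb{Z}_{\ge})$ are given by $\alpha e_0=0$, $\alpha e_n=\sqrt{1-q^{-2n}}\,e_{n-1}$ for $n\ge 1$, and $\gamma e_n=q^{-n}e_n$ for $n\ge 0$. $C^*(F)$ denotes the $C^*$-algebra generated by a set $F$. The nonstandard quantum projective line: elements of $C(\mathrm{SU}_q(2))$ are identified, via a known faithful representation, with norm-continuous $\mathbb{T}$-families of operators on $\ell^2(\mathbb{Z}_{\ge})$, parametrized by $t_1\in\mathbb{T}$ with $t_2:=\overline{t_1}$; the standard generators $u_{ij}$ become $u_{11}=t_1\alpha$, $u_{12}=-q^{-1}t_1\gamma$, $u_{21}=t_2\gamma$, $u_{22}=t_2\alpha^*$. Put $x_i=\sqrt{c}\,u_{1i}+u_{2i}$, i.e. $x_1=\sqrt{c}\,t_1\alpha+t_2\gamma$ and $x_2=-q^{-1}\sqrt{c}\,t_1\gamma+t_2\alpha^*$ (as elements of $C(\mathbb{T},\mathcal{B}(\ell^2(\mathbb{Z}_{\ge})))$). Then $C(\mathbb{C}P^1_{q,c}):=C^*(\{x_i^*x_j: 1\le i,j\le 2\})$, a $C^*$-subalgebra of $C(\mathbb{T},\mathcal{B}(\ell^2(\mathbb{Z}_{\ge})))$. $\mathcal{T}$ is the $C^*$-algebra generated by the forward unilateral shift $\mathcal{S}$ on $\ell^2(\mathbb{Z}_{\ge})$,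 and $\sigma:\mathcal{T}\to C(\mathbb{T})$ is the standard symbol map, the unital surjective $*$-homomorphism with $\sigma(\mathcal{S})=\mathrm{id}_{\mathbb{T}}$ and kernel the ideal of compact operators. *)

theory Defs
  imports "HOL-Analysis.Analysis"
begin

section \<open>Complex star-algebras and C*-algebras\<close>

class complex_vector = ab_group_add +
  fixes scaleC :: "complex \<Rightarrow> 'a \<Rightarrow> 'a" (infixr "*\<^sub>C" 75)
  assumes scaleC_add_right: "a *\<^sub>C (x + y) = a *\<^sub>C x + a *\<^sub>C y"
    and scaleC_add_left: "(a + b) *\<^sub>C x = a *\<^sub>C x + b *\<^sub>C x"
    and scaleC_scaleC: "a *\<^sub>C (b *\<^sub>C x) = (a * b) *\<^sub>C x"
    and scaleC_one: "1 *\<^sub>C x = x"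

class star_algebra = ring + complex_vector +
  fixes star :: "'a \<Rightarrow> 'a"
  assumes mult_scaleC_left: "(a *\<^sub>C x) * y = a *\<^sub>C (x * y)"
    and mult_scaleC_right: "x * (a *\<^sub>C y) = a *\<^sub>C (x * y)"
    and star_star: "star (star x) = x"
    and star_add: "star (x + y) = star x + star y"
    and star_scaleC: "star (a *\<^sub>C x) = cnj a *\<^sub>C star x"
    and star_mult: "star (x * y) = star y * star x"

class cstar_algebra = star_algebra + real_normed_algebra + banach +
  assumes scaleR_scaleC: "r *\<^sub>R x = complex_of_real r *\<^sub>C x"
    and cstar_identity: "norm (star x * x) = (norm x)\<^sup>2"

context complex_vector
begin

lemma scaleC_zero_left [simp]: "0 *\<^sub>C x = 0"
  using scaleC_add_left[of 0 0 x] by simp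

lemma scaleC_zero_right [simp]: "a *\<^sub>C 0 = 0"
  using scaleC_add_right[of a 0 0] by simp

end

lemma star_zero [simp]: "star (0 :: 'a::star_algebra) = 0"
  using star_add[of "0::'a" 0] by simp

lemma star_minus: "star (- x) = - star (x :: 'a::star_algebra)"
  using star_add[of x "- x"] by (simp add: eq_neg_iff_add_eq_0 add.commute)

lemma star_diff: "star (x - y) = star x - star (y :: 'a::star_algebra)"
  using star_add[of x "- y"] by (simp add: star_minus)

lemma norm_star [simp]: "norm (star x) = norm (x :: 'a::cstar_algebra)"
proof -
  have le: "norm y \<le> norm (star y)" for y :: 'a
  proof (cases "norm y = 0")
    case False
    have "norm y * norm y \<le> norm (star y) * norm y"
      using norm_mult_ineq[of "star y" y] by (simp add: cstar_identity power2_eq_square)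
    with False show ?thesis by (simp add: mult_le_cancel_right)
  qed simp
  show ?thesis using le[of x] le[of "star x"] by (simp add: star_star)
qed

lemma norm_scaleC [simp]: "norm (a *\<^sub>C x) = cmod a * norm (x :: 'a::cstar_algebra)"
proof -
  have "star (a *\<^sub>C x) * (a *\<^sub>C x) = complex_of_real ((cmod a)\<^sup>2) *\<^sub>C (star x * x)"
    by (simp add: star_scaleC mult_scaleC_left mult_scaleC_right scaleC_scaleC
        mult.commute[of "cnj a"] complex_norm_square del: of_real_power)
  also have "\<dots> = (cmod a)\<^sup>2 *\<^sub>R (star x * x)"
    by (simp only: scaleR_scaleC)
  finally have "(norm (a *\<^sub>C x))\<^sup>2 = (cmod a * norm x)\<^sup>2"
    by (metis abs_power2 cstar_identity norm_scaleR power_mult_distrib)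
  then show ?thesis
    by (simp add: power2_eq_iff_nonneg)
qed

instantiation complex :: cstar_algebra
begin
definition "scaleC_complex (a::complex) x = a * x"
definition "star_complex = cnj"
instance
  by standard
    (simp_all add: scaleC_complex_def star_complex_def algebra_simps scaleR_conv_of_real
      norm_mult power2_eq_square)
end

text \<open>Direct sums are used only as star-algebras: the library norm on pairs is Euclidean and hence
  not the C*-norm of the direct sum.\<close>

instantiation prod :: (star_algebra, star_algebra) star_algebra
begin
definition "times_prod x y = (fst x * fst y, snd x * snd y)"
definition "scaleC_prod a x = (a *\<^sub>C fst x, a *\<^sub>C snd x)"
definition "star_prod x = (star (fst x), star (snd x))"
instance
  by standard
    (simp_all add: times_prod_def scaleC_prod_def star_prod_def prod_eq_iff algebra_simps
      scaleC_add_right scaleC_add_left scaleC_scaleC scaleC_one mult_scaleC_left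
      mult_scaleC_right star_star star_add star_scaleC star_mult)
end

text \<open>Subalgebras are not required to contain a unit.\<close>

definition cstar_subalgebra :: "'a::cstar_algebra set \<Rightarrow> bool" where
  "cstar_subalgebra A \<longleftrightarrow>
     0 \<in> A \<and> (\<forall>x\<in>A. \<forall>y\<in>A. x + y \<in> A) \<and> (\<forall>a. \<forall>x\<in>A. a *\<^sub>C x \<in> A) \<and>
     (\<forall>x\<in>A. \<forall>y\<in>A. x * y \<in> A) \<and> (\<forall>x\<in>A. star x \<in> A) \<and> closed A"

definition cstar_generated :: "'a::cstar_algebra set \<Rightarrow> 'a set" where
  "cstar_generated F = \<Inter>{A. cstar_subalgebra A \<and> F \<subseteq> A}"

definition star_hom_on :: "'a::star_algebra set \<Rightarrow> ('a \<Rightarrow> 'b::star_algebra) \<Rightarrow> bool" where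
  "star_hom_on A \<phi> \<longleftrightarrow>
     (\<forall>x\<in>A. \<forall>y\<in>A. \<phi> (x + y) = \<phi> x + \<phi> y) \<and> (\<forall>a. \<forall>x\<in>A. \<phi> (a *\<^sub>C x) = a *\<^sub>C \<phi> x) \<and>
     (\<forall>x\<in>A. \<forall>y\<in>A. \<phi> (x * y) = \<phi> x * \<phi> y) \<and> (\<forall>x\<in>A. \<phi> (star x) = star (\<phi> x))"

text \<open>No norm condition is needed: a bijective star-homomorphism between C*-algebras is
  isometric.\<close>

definition cstar_isomorphic :: "'a::star_algebra set \<Rightarrow> 'b::star_algebra set \<Rightarrow> bool"
    (infix "\<cong>\<^sub>*" 50) where
  "A \<cong>\<^sub>* B \<longleftrightarrow> (\<exists>\<phi>. star_hom_on A \<phi> \<and> bij_betw \<phi> A B)"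

lemma cstar_subalgebra_generated: "cstar_subalgebra (cstar_generated F)"
  unfolding cstar_subalgebra_def cstar_generated_def by (auto intro!: closed_Inter)


section \<open>The Hilbert space of square-summable sequences\<close>

typedef ell2 = "{f :: nat \<Rightarrow> complex. summable (\<lambda>n. (cmod (f n))\<^sup>2)}"
  morphisms ell2_nth Abs_ell2
  by (rule exI[of _ "\<lambda>_. 0"]) simp

setup_lifting type_definition_ell2

lemma summable_ell2_nth: "summable (\<lambda>n. (cmod (ell2_nth x n))\<^sup>2)"
  using ell2_nth[of x] by simp

lemma ell2_eqI: "(\<And>n. ell2_nth x n = ell2_nth y n) \<Longrightarrow> x = y"
  by (simp add: ell2_nth_inject[symmetric] fun_eq_iff)

lemma ell2_summable_add:
  assumes "summable (\<lambda>n. (cmod (f n))\<^sup>2)" "summable (\<lambda>n. (cmod (g n))\<^sup>2)"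
  shows "summable (\<lambda>n. (cmod (f n + g n))\<^sup>2)"
proof (rule summable_comparison_test)
  show "\<exists>N. \<forall>n\<ge>N. norm ((cmod (f n + g n))\<^sup>2) \<le> 2 * (cmod (f n))\<^sup>2 + 2 * (cmod (g n))\<^sup>2"
  proof (intro exI allI impI)
    fix n
    have "(cmod (f n + g n))\<^sup>2 \<le> (cmod (f n) + cmod (g n))\<^sup>2"
      by (intro power_mono norm_triangle_ineq) simp
    also have "\<dots> \<le> 2 * (cmod (f n))\<^sup>2 + 2 * (cmod (g n))\<^sup>2"
      using sum_squares_bound[of "cmod (f n)" "cmod (g n)"] by (simp add: power2_sum)
    finally show "norm ((cmod (f n + g n))\<^sup>2) \<le> 2 * (cmod (f n))\<^sup>2 + 2 * (cmod (g n))\<^sup>2"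
      by simp
  qed
  show "summable (\<lambda>n. 2 * (cmod (f n))\<^sup>2 + 2 * (cmod (g n))\<^sup>2)"
    by (intro summable_add summable_mult assms)
qed

lemma ell2_summable_scale:
  assumes "summable (\<lambda>n. (cmod (f n))\<^sup>2)"
  shows "summable (\<lambda>n. (cmod (a * f n))\<^sup>2)"
  using summable_mult[OF assms, of "(cmod a)\<^sup>2"] by (simp add: norm_mult power_mult_distrib)

lemma ell2_summable_prod:
  "summable (\<lambda>n. cnj (ell2_nth x n) * ell2_nth y n)"
proof (rule summable_comparison_test)
  show "\<exists>N. \<forall>n\<ge>N. norm (cnj (ell2_nth x n) * ell2_nth y n)
      \<le> (cmod (ell2_nth x n))\<^sup>2 + (cmod (ell2_nth y n))\<^sup>2"
  proof (intro exI allI impI)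
    fix n
    have "0 \<le> cmod (ell2_nth x n) * cmod (ell2_nth y n)" by simp
    then show "norm (cnj (ell2_nth x n) * ell2_nth y n)
      \<le> (cmod (ell2_nth x n))\<^sup>2 + (cmod (ell2_nth y n))\<^sup>2"
      unfolding norm_mult complex_mod_cnj
      using sum_squares_bound[of "cmod (ell2_nth x n)" "cmod (ell2_nth y n)"] by linarith
  qed
  show "summable (\<lambda>n. (cmod (ell2_nth x n))\<^sup>2 + (cmod (ell2_nth y n))\<^sup>2)"
    by (intro summable_add summable_ell2_nth)
qed

instantiation ell2 :: complex_vector
begin

lift_definition zero_ell2 :: ell2 is "\<lambda>_. 0" by simp
lift_definition plus_ell2 :: "ell2 \<Rightarrow> ell2 \<Rightarrow> ell2" is "\<lambda>f g n. f n + g n"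
  by (rule ell2_summable_add)
lift_definition uminus_ell2 :: "ell2 \<Rightarrow> ell2" is "\<lambda>f n. - f n" by simp
lift_definition minus_ell2 :: "ell2 \<Rightarrow> ell2 \<Rightarrow> ell2" is "\<lambda>f g n. f n - g n"
  subgoal for f g using ell2_summable_add[of f "\<lambda>n. - g n"] by simp
  done
lift_definition scaleC_ell2 :: "complex \<Rightarrow> ell2 \<Rightarrow> ell2" is "\<lambda>a f n. a * f n"
  by (rule ell2_summable_scale)

instance
  by standard (transfer, simp add: fun_eq_iff algebra_simps)+

end

lemmas ell2_nth_simps [simp] =
  zero_ell2.rep_eq plus_ell2.rep_eq uminus_ell2.rep_eq minus_ell2.rep_eq scaleC_ell2.rep_eq

definition cinner :: "ell2 \<Rightarrow> ell2 \<Rightarrow> complex" where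
  "cinner x y = (\<Sum>n. cnj (ell2_nth x n) * ell2_nth y n)"

lemma cinner_sums: "(\<lambda>n. cnj (ell2_nth x n) * ell2_nth y n) sums cinner x y"
  unfolding cinner_def by (intro summable_sums ell2_summable_prod)

lemma cinner_add_left: "cinner (x + y) z = cinner x z + cinner y z"
  using sums_add[OF cinner_sums[of x z] cinner_sums[of y z]] cinner_sums[of "x + y" z]
  by (simp add: distrib_right sums_unique2)

lemma cinner_scaleC_left: "cinner (a *\<^sub>C x) y = cnj a * cinner x y"
  using sums_mult[OF cinner_sums[of x y], of "cnj a"] cinner_sums[of "a *\<^sub>C x" y]
  by (simp add: mult.assoc sums_unique2)

lemma cinner_commute: "cinner x y = cnj (cinner y x)"
  using sums_cnj[THEN iffD2, OF cinner_sums[of y x]] cinner_sums[of x y]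
  by (simp add: mult.commute sums_unique2)

lemma cinner_self: "cinner x x = complex_of_real (\<Sum>n. (cmod (ell2_nth x n))\<^sup>2)"
proof -
  have "(\<lambda>n. complex_of_real ((cmod (ell2_nth x n))\<^sup>2)) sums
      complex_of_real (\<Sum>n. (cmod (ell2_nth x n))\<^sup>2)"
    using summable_sums[OF summable_ell2_nth[of x]] by (rule sums_of_real)
  moreover have "(\<lambda>n. complex_of_real ((cmod (ell2_nth x n))\<^sup>2)) sums cinner x x"
    using cinner_sums[of x x] by (simp only: complex_norm_square mult.commute)
  ultimately show ?thesis by (metis sums_unique2)
qed

instantiation ell2 :: real_vector
begin

definition "scaleR_ell2 r (x::ell2) = complex_of_real r *\<^sub>C x"

instance
  by standard
    (simp_all add: scaleR_ell2_def scaleC_add_right scaleC_add_left scaleC_scaleC scaleC_one)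

end

text \<open>The real inner product of the underlying real Hilbert space, which induces the norm.\<close>

instantiation ell2 :: real_inner
begin

definition "inner_ell2 x y = Re (cinner x y)"
definition "norm_ell2 (x::ell2) = sqrt (\<Sum>n. (cmod (ell2_nth x n))\<^sup>2)"
definition "dist_ell2 (x::ell2) y = norm (x - y)"
definition "sgn_ell2 (x::ell2) = x /\<^sub>R norm x"
definition "(uniformity :: (ell2 \<times> ell2) filter) = (INF e\<in>{0 <..}. principal {(x, y). dist x y < e})"
definition "open_ell2 (S :: ell2 set) =
  (\<forall>x\<in>S. \<forall>\<^sub>F (x', y) in uniformity. x' = x \<longrightarrow> y \<in> S)"

instance
proof
  fix x y z :: ell2 and r :: real
  show "inner x y = inner y x"
    unfolding inner_ell2_def by (subst cinner_commute) simp
  show "inner (x + y) z = inner x z + inner y z"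
    by (simp add: inner_ell2_def cinner_add_left)
  show "inner (r *\<^sub>R x) y = r * inner x y"
    by (simp add: inner_ell2_def scaleR_ell2_def cinner_scaleC_left)
  show "0 \<le> inner x x"
    by (simp add: inner_ell2_def cinner_self suminf_nonneg summable_ell2_nth)
  show "inner x x = 0 \<longleftrightarrow> x = 0"
    by (auto simp: inner_ell2_def cinner_self suminf_eq_zero_iff summable_ell2_nth intro!: ell2_eqI)
  show "norm x = sqrt (inner x x)"
    by (simp add: norm_ell2_def inner_ell2_def cinner_self)
qed (rule dist_ell2_def sgn_ell2_def uniformity_ell2_def open_ell2_def)+

end

lemma norm_ell2_sq: "(norm x)\<^sup>2 = (\<Sum>n. (cmod (ell2_nth x n))\<^sup>2)"
  unfolding norm_ell2_def by (simp add: suminf_nonneg summable_ell2_nth)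

lemma cinner_norm: "cinner x x = complex_of_real ((norm x)\<^sup>2)"
  by (simp add: cinner_self norm_ell2_sq)

lemma norm_scaleC_ell2 [simp]: "norm (a *\<^sub>C (x::ell2)) = cmod a * norm x"
proof -
  have "complex_of_real ((norm (a *\<^sub>C x))\<^sup>2) = complex_of_real ((cmod a * norm x)\<^sup>2)"
    unfolding cinner_norm[symmetric]
    by (subst cinner_scaleC_left, subst cinner_commute, subst cinner_scaleC_left)
      (simp add: cinner_norm power_mult_distrib complex_norm_square mult.commute[of "cnj a"]
        del: of_real_power)
  then show ?thesis
    by (metis of_real_eq_iff mult_nonneg_nonneg norm_ge_zero power2_eq_iff_nonneg)
qed

lemma sum_le_norm_ell2:
  "(\<Sum>n<N. (cmod (ell2_nth x n))\<^sup>2) \<le> (norm x)\<^sup>2"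
  unfolding norm_ell2_sq by (intro sum_le_suminf summable_ell2_nth) auto

lemma norm_ell2_nth_le: "cmod (ell2_nth x n) \<le> norm x"
proof -
  have "(cmod (ell2_nth x n))\<^sup>2 \<le> (\<Sum>k<Suc n. (cmod (ell2_nth x k))\<^sup>2)"
    by (simp add: sum_nonneg)
  also have "\<dots> \<le> (norm x)\<^sup>2" by (rule sum_le_norm_ell2)
  finally show ?thesis by (simp add: power2_le_iff_abs_le)
qed

lemma norm_ell2_bound:
  assumes "\<And>N. (\<Sum>n<N. (cmod (ell2_nth x n))\<^sup>2) \<le> B\<^sup>2" "0 \<le> B"
  shows "norm x \<le> B"
proof -
  have "(norm x)\<^sup>2 \<le> B\<^sup>2"
    unfolding norm_ell2_sq by (intro suminf_le_const summable_ell2_nth assms)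
  with assms(2) show ?thesis by (simp add: power2_le_iff_abs_le)
qed

lemma ell2_bounded_sums:
  assumes "\<And>N. (\<Sum>n<N. (cmod (f n))\<^sup>2) \<le> B"
  shows "summable (\<lambda>n. (cmod (f n))\<^sup>2)"
  using assms by (intro summableI_nonneg_bounded[of _ B]) auto

instance ell2 :: banach
proof
  fix X :: "nat \<Rightarrow> ell2"
  assume X: "Cauchy X"
  have nth: "convergent (\<lambda>m. ell2_nth (X m) n)" for n
    unfolding Cauchy_convergent_iff[symmetric]
  proof (rule CauchyI)
    fix e :: real assume "0 < e"
    with CauchyD[OF X] obtain M where "\<And>m k. m \<ge> M \<Longrightarrow> k \<ge> M \<Longrightarrow> norm (X m - X k) < e" by blast
    then show "\<exists>M. \<forall>m\<ge>M. \<forall>k\<ge>M. norm (ell2_nth (X m) n - ell2_nth (X k) n) < e"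
      using norm_ell2_nth_le[of "X _ - X _" n] by (metis le_less_trans minus_ell2.rep_eq)
  qed
  define v where "v n = lim (\<lambda>m. ell2_nth (X m) n)" for n
  have v: "(\<lambda>m. ell2_nth (X m) n) \<longlonglongrightarrow> v n" for n
    using nth unfolding v_def by (simp add: convergent_LIMSEQ_iff)
  have close: "(\<Sum>n<N. (cmod (ell2_nth (X m) n - v n))\<^sup>2) \<le> e\<^sup>2"
    if "\<And>k. k \<ge> M \<Longrightarrow> norm (X m - X k) < e" for m M N e
  proof (rule tendsto_upperbound)
    show "(\<lambda>k. \<Sum>n<N. (cmod (ell2_nth (X m) n - ell2_nth (X k) n))\<^sup>2) \<longlonglongrightarrow>
        (\<Sum>n<N. (cmod (ell2_nth (X m) n - v n))\<^sup>2)"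
      by (intro tendsto_intros v)
    show "\<forall>\<^sub>F k in sequentially. (\<Sum>n<N. (cmod (ell2_nth (X m) n - ell2_nth (X k) n))\<^sup>2) \<le> e\<^sup>2"
      unfolding eventually_sequentially
    proof (intro exI allI impI)
      fix k assume "M \<le> k"
      have "(\<Sum>n<N. (cmod (ell2_nth (X m) n - ell2_nth (X k) n))\<^sup>2) \<le> (norm (X m - X k))\<^sup>2"
        using sum_le_norm_ell2[of "X m - X k" N] by simp
      also have "\<dots> \<le> e\<^sup>2"
        using that[OF \<open>M \<le> k\<close>] by (intro power_mono) auto
      finally show "(\<Sum>n<N. (cmod (ell2_nth (X m) n - ell2_nth (X k) n))\<^sup>2) \<le> e\<^sup>2" .
    qed
  qed simp
  obtain M where M: "\<And>m k. m \<ge> M \<Longrightarrow> k \<ge> M \<Longrightarrow> norm (X m - X k) < 1"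
    using CauchyD[OF X zero_less_one] by blast
  have "summable (\<lambda>n. (cmod (ell2_nth (X M) n - v n))\<^sup>2)"
    using close[of M M 1] M by (intro ell2_bounded_sums[where B = "1\<^sup>2"]) auto
  then have "summable (\<lambda>n. (cmod (ell2_nth (X M) n + (- 1) * (ell2_nth (X M) n - v n)))\<^sup>2)"
    by (intro ell2_summable_add ell2_summable_scale summable_ell2_nth)
  then have sv: "summable (\<lambda>n. (cmod (v n))\<^sup>2)" by simp
  define V where "V = Abs_ell2 v"
  have V: "ell2_nth V = v" unfolding V_def using sv by (simp add: Abs_ell2_inverse)
  have "X \<longlonglongrightarrow> V"
  proof (rule LIMSEQ_I)
    fix e :: real assume e: "0 < e"
    then obtain M where M: "\<And>m k. m \<ge> M \<Longrightarrow> k \<ge> M \<Longrightarrow> norm (X m - X k) < e / 2"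
      using CauchyD[OF X, of "e / 2"] by auto
    have "norm (X m - V) < e" if "m \<ge> M" for m
    proof -
      have "norm (X m - V) \<le> e / 2"
        using close[of M m "e / 2"] M that e by (intro norm_ell2_bound) (simp_all add: V)
      with e show ?thesis by simp
    qed
    then show "\<exists>M. \<forall>m\<ge>M. norm (X m - V) < e" by blast
  qed
  then show "convergent X" by (rule convergentI)
qed

lift_definition ell2_basis :: "nat \<Rightarrow> ell2" is "\<lambda>n k. if k = n then 1 else 0"
proof -
  fix n :: nat
  show "summable (\<lambda>k. (cmod (if k = n then 1 else 0))\<^sup>2)"
    by (rule summable_finite[of "{n}"]) auto
qed

lemma cinner_basis [simp]: "cinner (ell2_basis n) x = ell2_nth x n"
proof -
  have "(\<lambda>k. cnj (ell2_nth (ell2_basis n) k) * ell2_nth x k) =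
      (\<lambda>k. if k = n then ell2_nth x k else 0)"
    by (auto simp: ell2_basis.rep_eq)
  then show ?thesis
    using cinner_sums[of "ell2_basis n" x] sums_single[of n "ell2_nth x"]
    by (simp add: sums_unique2)
qed

lemma norm_basis [simp]: "norm (ell2_basis n) = 1"
proof -
  have "complex_of_real ((norm (ell2_basis n))\<^sup>2) = 1"
    unfolding cinner_norm[symmetric] by (simp add: ell2_basis.rep_eq)
  then have "(norm (ell2_basis n))\<^sup>2 = 1"
    by (simp only: of_real_eq_1_iff)
  then show ?thesis by (simp add: power2_eq_1_iff) (smt (verit) norm_ge_zero)
qed

lemma cinner_add_right: "cinner x (y + z) = cinner x y + cinner x z"
  by (metis cinner_add_left cinner_commute complex_cnj_add)

lemma cinner_scaleC_right: "cinner x (a *\<^sub>C y) = a * cinner x y"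
  by (metis cinner_scaleC_left cinner_commute complex_cnj_mult complex_cnj_cnj)

lemma cinner_zero [simp]: "cinner 0 x = 0" "cinner x 0 = 0"
  by (simp_all add: cinner_def)

lemma cinner_sum_left: "cinner (\<Sum>i\<in>I. f i) y = (\<Sum>i\<in>I. cinner (f i) y)"
  by (induction I rule: infinite_finite_induct) (simp_all add: cinner_add_left)

lemma ell2_nth_sum: "ell2_nth (\<Sum>i\<in>I. f i) n = (\<Sum>i\<in>I. ell2_nth (f i) n)"
  by (induction I rule: infinite_finite_induct) simp_all

lemma cinner_le_norm: "cmod (cinner x y) \<le> norm x * norm y"
proof (cases "cinner x y = 0")
  case False
  define u where "u = cnj (cinner x y) / cmod (cinner x y)"
  have u: "cmod u = 1" "u * cinner x y = cmod (cinner x y)"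
    using False by (simp_all add: u_def norm_divide complex_norm_square[symmetric]
        mult.commute power2_eq_square del: of_real_mult flip: of_real_mult of_real_divide)
  have "cmod (cinner x y) = inner x (u *\<^sub>C y)"
    by (simp add: inner_ell2_def cinner_scaleC_right u(2))
  also have "\<dots> \<le> norm x * norm (u *\<^sub>C y)" by (rule norm_cauchy_schwarz)
  finally show ?thesis by (simp add: u(1))
qed simp

lemma bounded_bilinear_cinner: "bounded_bilinear cinner"
proof
  show "\<exists>K. \<forall>a b. norm (cinner a b) \<le> norm a * norm b * K"
    by (intro exI[of _ 1]) (simp add: cinner_le_norm)
qed (simp_all add: cinner_add_left cinner_add_right cinner_scaleC_left cinner_scaleC_right
    scaleR_ell2_def scaleR_conv_of_real)

lemmas cinner_tendsto = bounded_bilinear.tendsto[OF bounded_bilinear_cinner]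

lemma cinner_eqI: "(\<And>z. cinner x z = cinner y z) \<Longrightarrow> x = y"
  by (metis cinner_basis cinner_commute ell2_eqI)

definition ell2_trunc :: "nat \<Rightarrow> ell2 \<Rightarrow> ell2" where
  "ell2_trunc N x = (\<Sum>n<N. ell2_nth x n *\<^sub>C ell2_basis n)"

lemma ell2_nth_trunc: "ell2_nth (ell2_trunc N x) n = (if n < N then ell2_nth x n else 0)"
  by (simp add: ell2_trunc_def ell2_nth_sum ell2_basis.rep_eq if_distrib cong: if_cong)

lemma tendsto_trunc: "(\<lambda>N. ell2_trunc N x) \<longlonglongrightarrow> x"
proof -
  have eq: "(norm (ell2_trunc N x - x))\<^sup>2 = (norm x)\<^sup>2 - (\<Sum>n<N. (cmod (ell2_nth x n))\<^sup>2)" for N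
  proof -
    have "(\<lambda>n. (cmod (ell2_nth x n))\<^sup>2 - (if n < N then (cmod (ell2_nth x n))\<^sup>2 else 0)) sums
        ((norm x)\<^sup>2 - (\<Sum>n<N. (cmod (ell2_nth x n))\<^sup>2))"
      unfolding norm_ell2_sq
      using sums_If_finite_set[of "{..<N}" "\<lambda>n. (cmod (ell2_nth x n))\<^sup>2"]
      by (intro sums_diff summable_sums summable_ell2_nth) simp
    moreover have "(\<lambda>n. (cmod (ell2_nth x n))\<^sup>2 - (if n < N then (cmod (ell2_nth x n))\<^sup>2 else 0)) =
        (\<lambda>n. (cmod (ell2_nth (ell2_trunc N x - x) n))\<^sup>2)"
      by (auto simp: ell2_nth_trunc)
    ultimately show ?thesis unfolding norm_ell2_sq[of "ell2_trunc N x - x"] by (simp add: sums_iff)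
  qed
  have "(\<lambda>N. (norm x)\<^sup>2 - (\<Sum>n<N. (cmod (ell2_nth x n))\<^sup>2)) \<longlonglongrightarrow> (norm x)\<^sup>2 - (norm x)\<^sup>2"
    unfolding norm_ell2_sq[of x] by (intro tendsto_intros summable_LIMSEQ summable_ell2_nth)
  then have "(\<lambda>N. sqrt ((norm (ell2_trunc N x - x))\<^sup>2)) \<longlonglongrightarrow> sqrt 0"
    unfolding eq by (intro tendsto_real_sqrt) simp
  then show ?thesis
    by (simp add: tendsto_norm_zero_iff LIM_zero_iff)
qed


section \<open>Bounded complex-linear operators\<close>

text \<open>The norm is the operator norm inherited from the type of bounded real-linear maps.\<close>

typedef ell2_op = "{T :: ell2 \<Rightarrow>\<^sub>L ell2. \<forall>a x. T (a *\<^sub>C x) = a *\<^sub>C T x}"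
  morphisms op_blinfun Abs_op
  by (rule exI[of _ 0]) simp

setup_lifting type_definition_ell2_op

abbreviation op_apply :: "ell2_op \<Rightarrow> ell2 \<Rightarrow> ell2" (infixr "\<bullet>\<^sub>o" 75) where
  "T \<bullet>\<^sub>o x \<equiv> blinfun_apply (op_blinfun T) x"

lemma op_scaleC [simp]: "T \<bullet>\<^sub>o (a *\<^sub>C x) = a *\<^sub>C (T \<bullet>\<^sub>o x)"
  using op_blinfun[of T] by simp

lemma op_eqI: "(\<And>x. S \<bullet>\<^sub>o x = T \<bullet>\<^sub>o x) \<Longrightarrow> S = T"
  by (simp add: op_blinfun_inject[symmetric] blinfun_eqI)

lemma op_exI:
  assumes "\<And>x y. f (x + y) = f x + f y" "\<And>a x. f (a *\<^sub>C x) = a *\<^sub>C f x"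
    and "\<And>x. norm (f x) \<le> B * norm x"
  obtains T where "\<And>x. T \<bullet>\<^sub>o x = f x"
proof -
  have "bounded_linear f"
    using assms by (intro bounded_linear_intro[of _ B]) (simp_all add: scaleR_ell2_def mult.commute)
  then have "Blinfun f \<in> {T. \<forall>a x. blinfun_apply T (a *\<^sub>C x) = a *\<^sub>C blinfun_apply T x}"
    and "blinfun_apply (Blinfun f) = f"
    by (simp_all add: bounded_linear_Blinfun_apply assms)
  then have "Abs_op (Blinfun f) \<bullet>\<^sub>o x = f x" for x
    by (simp add: Abs_op_inverse)
  then show ?thesis by (rule that)
qed

instantiation ell2_op :: real_vector
begin

lift_definition zero_ell2_op :: ell2_op is 0 by simp
lift_definition plus_ell2_op :: "ell2_op \<Rightarrow> ell2_op \<Rightarrow> ell2_op" is "(+)"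
  by (simp add: blinfun.bilinear_simps scaleC_add_right)
lift_definition minus_ell2_op :: "ell2_op \<Rightarrow> ell2_op \<Rightarrow> ell2_op" is "(-)"
  by (simp add: blinfun.bilinear_simps) (metis add_diff_cancel diff_add_cancel scaleC_add_right)
lift_definition uminus_ell2_op :: "ell2_op \<Rightarrow> ell2_op" is uminus
  by (simp add: blinfun.bilinear_simps) (metis add.right_inverse add_eq_0_iff scaleC_add_right scaleC_zero_right)
lift_definition scaleR_ell2_op :: "real \<Rightarrow> ell2_op \<Rightarrow> ell2_op" is "(*\<^sub>R)"
  by (simp add: blinfun.bilinear_simps scaleR_ell2_def scaleC_scaleC mult.commute)

instance
  by standard (transfer, simp add: algebra_simps)+

end

instantiation ell2_op :: real_normed_vector
begin

lift_definition norm_ell2_op :: "ell2_op \<Rightarrow> real" is norm .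
definition "dist_ell2_op (S::ell2_op) T = norm (S - T)"
definition "sgn_ell2_op (T::ell2_op) = T /\<^sub>R norm T"
definition "(uniformity :: (ell2_op \<times> ell2_op) filter) =
  (INF e\<in>{0 <..}. principal {(S, T). dist S T < e})"
definition "open_ell2_op (A :: ell2_op set) =
  (\<forall>x\<in>A. \<forall>\<^sub>F (x', y) in uniformity. x' = x \<longrightarrow> y \<in> A)"

instance
proof
  fix S T :: ell2_op and r :: real
  show "norm T = 0 \<longleftrightarrow> T = 0" by transfer simp
  show "norm (S + T) \<le> norm S + norm T" by transfer (rule norm_triangle_ineq)
  show "norm (r *\<^sub>R T) = \<bar>r\<bar> * norm T" by transfer simp
qed (rule dist_ell2_op_def sgn_ell2_op_def uniformity_ell2_op_def open_ell2_op_def)+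

end

instance ell2_op :: banach
proof
  fix X :: "nat \<Rightarrow> ell2_op"
  assume X: "Cauchy X"
  have norm_diff: "norm (op_blinfun S - op_blinfun T) = norm (S - T)" for S T
    by (simp add: minus_ell2_op.rep_eq norm_ell2_op.rep_eq)
  have "Cauchy (\<lambda>n. op_blinfun (X n))"
    using X by (simp add: Cauchy_iff norm_diff)
  then obtain L where L: "(\<lambda>n. op_blinfun (X n)) \<longlonglongrightarrow> L"
    by (auto simp: Cauchy_convergent_iff convergent_def)
  have "L (a *\<^sub>C x) = a *\<^sub>C L x" for a x
  proof -
    have lin: "bounded_linear (\<lambda>x::ell2. a *\<^sub>C x)"
      by (rule bounded_linear_intro[of _ "cmod a"])
        (simp_all add: scaleC_add_right scaleR_ell2_def scaleC_scaleC mult.commute)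
    have lim: "(\<lambda>n. X n \<bullet>\<^sub>o y) \<longlonglongrightarrow> L y" for y
      using L by (intro tendsto_intros)
    have "(\<lambda>n. X n \<bullet>\<^sub>o (a *\<^sub>C x)) \<longlonglongrightarrow> a *\<^sub>C L x"
      unfolding op_scaleC by (rule bounded_linear.tendsto[OF lin lim])
    with lim show ?thesis by (rule LIMSEQ_unique)
  qed
  then have "op_blinfun (Abs_op L) = L" by (simp add: Abs_op_inverse)
  then have "X \<longlonglongrightarrow> Abs_op L"
    using L by (simp add: LIMSEQ_iff norm_diff[symmetric])
  then show "convergent X" by (rule convergentI)
qed

instantiation ell2_op :: ring_1
begin

lift_definition times_ell2_op :: "ell2_op \<Rightarrow> ell2_op \<Rightarrow> ell2_op" is "(o\<^sub>L)" by simp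
lift_definition one_ell2_op :: ell2_op is id_blinfun by simp

instance
proof
  fix S T U :: ell2_op
  show "S * T * U = S * (T * U)" by transfer (rule blinfun_eqI, simp)
  show "(S + T) * U = S * U + T * U"
    by transfer (rule blinfun_eqI, simp add: blinfun.bilinear_simps)
  show "S * (T + U) = S * T + S * U"
    by transfer (rule blinfun_eqI, simp add: blinfun.bilinear_simps)
  show "1 * T = T" "T * 1 = T" by (transfer, rule blinfun_eqI, simp)+
  have "(1::ell2_op) \<bullet>\<^sub>o ell2_basis 0 = ell2_basis 0" by (simp add: one_ell2_op.rep_eq)
  moreover have "ell2_basis 0 \<noteq> 0" using norm_basis[of 0] by force
  ultimately show "(0::ell2_op) \<noteq> 1" by (metis blinfun.zero_left zero_ell2_op.rep_eq)
qed

end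

lemma norm_op: "norm (T \<bullet>\<^sub>o x) \<le> norm T * norm x"
  by (simp add: norm_ell2_op.rep_eq norm_blinfun)

lemma norm_op_bound: "0 \<le> b \<Longrightarrow> (\<And>x. norm (T \<bullet>\<^sub>o x) \<le> b * norm x) \<Longrightarrow> norm T \<le> b"
  by (simp add: norm_ell2_op.rep_eq norm_blinfun_bound)

instance ell2_op :: real_normed_algebra
proof
  fix S T :: ell2_op and r :: real
  show "r *\<^sub>R S * T = r *\<^sub>R (S * T)" "S * r *\<^sub>R T = r *\<^sub>R (S * T)"
    by (transfer, rule blinfun_eqI, simp add: blinfun.bilinear_simps)+
  show "norm (S * T) \<le> norm S * norm T" by transfer (rule norm_blinfun_compose)
qed

lemma adjoint_ex:
  obtains S where "\<And>x y. cinner (S \<bullet>\<^sub>o x) y = cinner x (T \<bullet>\<^sub>o y)"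
proof -
  define g where "g y n = cinner (T \<bullet>\<^sub>o ell2_basis n) y" for y n
  have bound: "(\<Sum>n<N. (cmod (g y n))\<^sup>2) \<le> (norm T * norm y)\<^sup>2" for y N
  proof -
    define w where "w = (\<Sum>n<N. g y n *\<^sub>C ell2_basis n)"
    define s where "s = (\<Sum>n<N. (cmod (g y n))\<^sup>2)"
    have s0: "0 \<le> s" by (simp add: s_def sum_nonneg)
    have w: "ell2_nth w n = (if n < N then g y n else 0)" for n
      by (simp add: w_def ell2_nth_sum ell2_basis.rep_eq if_distrib cong: if_cong)
    have cs: "complex_of_real s = (\<Sum>n<N. cnj (g y n) * g y n)"
      by (simp only: s_def of_real_sum complex_norm_square mult.commute)
    have "complex_of_real ((norm w)\<^sup>2) = complex_of_real s"
      unfolding cinner_norm[symmetric] cs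
      by (subst (1) w_def) (simp add: cinner_sum_left cinner_scaleC_left w)
    then have nw: "norm w = sqrt s"
      by (metis norm_ge_zero of_real_eq_iff real_sqrt_unique)
    have "cinner (T \<bullet>\<^sub>o w) y = complex_of_real s"
      unfolding cs
      by (simp add: w_def blinfun.sum_right cinner_sum_left cinner_scaleC_left flip: g_def)
    then have "s = cmod (cinner (T \<bullet>\<^sub>o w) y)" using s0 by simp
    also have "\<dots> \<le> norm (T \<bullet>\<^sub>o w) * norm y" by (rule cinner_le_norm)
    also have "\<dots> \<le> norm T * norm w * norm y" by (intro mult_right_mono norm_op) simp
    finally have le: "sqrt s * sqrt s \<le> (norm T * norm y) * sqrt s"
      using s0 by (simp add: nw mult_ac)
    have "sqrt s \<le> norm T * norm y"
    proof (cases "s = 0")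
      case False
      with s0 have "0 < sqrt s" by simp
      with le show ?thesis by (rule mult_right_le_imp_le)
    qed simp
    then have "(sqrt s)\<^sup>2 \<le> (norm T * norm y)\<^sup>2"
      using s0 by (intro power_mono) auto
    then show ?thesis using s0 by (simp add: s_def)
  qed
  define f where "f y = Abs_ell2 (g y)" for y
  have f: "ell2_nth (f y) = g y" for y
    unfolding f_def using ell2_bounded_sums[OF bound[of y]] by (simp add: Abs_ell2_inverse)
  obtain S where S: "\<And>x. S \<bullet>\<^sub>o x = f x"
  proof (rule op_exI)
    show "f (x + y) = f x + f y" for x y
      by (rule ell2_eqI) (simp add: f, simp add: g_def cinner_add_right)
    show "f (a *\<^sub>C x) = a *\<^sub>C f x" for a x
      by (rule ell2_eqI) (simp add: f, simp add: g_def cinner_scaleC_right)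
    show "norm (f x) \<le> norm T * norm x" for x
      by (rule norm_ell2_bound) (simp_all add: f bound)
  qed blast
  have main: "cinner y (S \<bullet>\<^sub>o x) = cinner (T \<bullet>\<^sub>o y) x" for x y
  proof (rule LIMSEQ_unique)
    show "(\<lambda>N. cinner (ell2_trunc N y) (S \<bullet>\<^sub>o x)) \<longlonglongrightarrow> cinner y (S \<bullet>\<^sub>o x)"
      by (intro cinner_tendsto tendsto_trunc tendsto_const)
    have "cinner (ell2_trunc N y) (S \<bullet>\<^sub>o x) = cinner (T \<bullet>\<^sub>o ell2_trunc N y) x" for N
      by (simp add: ell2_trunc_def blinfun.sum_right cinner_sum_left cinner_scaleC_left S f g_def)
    moreover have "(\<lambda>N. cinner (T \<bullet>\<^sub>o ell2_trunc N y) x) \<longlonglongrightarrow> cinner (T \<bullet>\<^sub>o y) x"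
      by (intro cinner_tendsto blinfun.tendsto tendsto_trunc tendsto_const)
    ultimately show "(\<lambda>N. cinner (ell2_trunc N y) (S \<bullet>\<^sub>o x)) \<longlonglongrightarrow> cinner (T \<bullet>\<^sub>o y) x"
      by simp
  qed
  show ?thesis
    by (rule that[of S]) (metis main cinner_commute)
qed

instantiation ell2_op :: cstar_algebra
begin

definition scaleC_ell2_op :: "complex \<Rightarrow> ell2_op \<Rightarrow> ell2_op" where
  "scaleC_ell2_op a T = Abs_op (Blinfun (\<lambda>x. a *\<^sub>C (T \<bullet>\<^sub>o x)))"

definition star_ell2_op :: "ell2_op \<Rightarrow> ell2_op" where
  "star_ell2_op T = (THE S. \<forall>x y. cinner (S \<bullet>\<^sub>o x) y = cinner x (T \<bullet>\<^sub>o y))"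

lemma op_apply_scaleC: "(a *\<^sub>C T) \<bullet>\<^sub>o x = a *\<^sub>C (T \<bullet>\<^sub>o x)"
proof -
  have "bounded_linear (\<lambda>x::ell2. a *\<^sub>C x)"
    by (rule bounded_linear_intro[of _ "cmod a"])
      (simp_all add: scaleC_add_right scaleR_ell2_def scaleC_scaleC mult.commute)
  then have "bounded_linear (\<lambda>x. a *\<^sub>C (T \<bullet>\<^sub>o x))"
    by (rule bounded_linear_compose) (rule blinfun.bounded_linear_right)
  then have eq: "blinfun_apply (Blinfun (\<lambda>x. a *\<^sub>C (T \<bullet>\<^sub>o x))) = (\<lambda>x. a *\<^sub>C (T \<bullet>\<^sub>o x))"
    by (rule bounded_linear_Blinfun_apply)
  then have "Blinfun (\<lambda>x. a *\<^sub>C (T \<bullet>\<^sub>o x)) \<in>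
      {T. \<forall>b x. blinfun_apply T (b *\<^sub>C x) = b *\<^sub>C blinfun_apply T x}"
    by (simp add: scaleC_scaleC mult.commute)
  then show ?thesis by (simp add: scaleC_ell2_op_def Abs_op_inverse eq)
qed

lemma op_apply_simps:
  "(S + T) \<bullet>\<^sub>o x = S \<bullet>\<^sub>o x + T \<bullet>\<^sub>o x" "(S - T) \<bullet>\<^sub>o x = S \<bullet>\<^sub>o x - T \<bullet>\<^sub>o x"
  "(- T) \<bullet>\<^sub>o x = - (T \<bullet>\<^sub>o x)" "(S * T) \<bullet>\<^sub>o x = S \<bullet>\<^sub>o (T \<bullet>\<^sub>o x)"
  "(0::ell2_op) \<bullet>\<^sub>o x = 0" "(1::ell2_op) \<bullet>\<^sub>o x = x" "(r *\<^sub>R T) \<bullet>\<^sub>o x = r *\<^sub>R (T \<bullet>\<^sub>o x)"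
  by (simp_all add: plus_ell2_op.rep_eq minus_ell2_op.rep_eq uminus_ell2_op.rep_eq
      times_ell2_op.rep_eq zero_ell2_op.rep_eq one_ell2_op.rep_eq scaleR_ell2_op.rep_eq
      blinfun.bilinear_simps)

lemma star_unique: "(\<And>x y. cinner (S \<bullet>\<^sub>o x) y = cinner x (T \<bullet>\<^sub>o y)) \<Longrightarrow> star T = S"
  unfolding star_ell2_op_def
  by (rule the_equality) (auto intro!: op_eqI cinner_eqI)

lemma cinner_star_left: "cinner (star T \<bullet>\<^sub>o x) y = cinner x (T \<bullet>\<^sub>o y)"
  by (metis adjoint_ex star_unique)

lemma cinner_star_right: "cinner x (star T \<bullet>\<^sub>o y) = cinner (T \<bullet>\<^sub>o x) y"
  by (metis cinner_star_left cinner_commute)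

instance
proof
  fix S T :: ell2_op and a b :: complex and r :: real
  note simps = op_apply_simps op_apply_scaleC
  show "a *\<^sub>C (S + T) = a *\<^sub>C S + a *\<^sub>C T" "(a + b) *\<^sub>C T = a *\<^sub>C T + b *\<^sub>C T"
    "a *\<^sub>C b *\<^sub>C T = (a * b) *\<^sub>C T" "1 *\<^sub>C T = T"
    "a *\<^sub>C S * T = a *\<^sub>C (S * T)" "S * a *\<^sub>C T = a *\<^sub>C (S * T)"
    "r *\<^sub>R T = complex_of_real r *\<^sub>C T"
    by (rule op_eqI, simp add: simps scaleC_add_right scaleC_add_left scaleC_scaleC scaleC_one
        scaleR_ell2_def)+
  show ss: "star (star T) = T" for T :: ell2_op
    by (rule star_unique) (simp add: cinner_star_right)
  show "star (S + T) = star S + star T" "star (a *\<^sub>C T) = cnj a *\<^sub>C star T"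
    "star (S * T) = star T * star S"
    by (rule star_unique, simp add: simps cinner_add_left cinner_add_right cinner_scaleC_left
        cinner_scaleC_right cinner_star_left)+
  have le: "(norm T)\<^sup>2 \<le> norm (star T * T)" for T :: ell2_op
  proof -
    have "norm (T \<bullet>\<^sub>o x) \<le> sqrt (norm (star T * T)) * norm x" for x
    proof -
      have "complex_of_real ((norm (T \<bullet>\<^sub>o x))\<^sup>2) = cinner ((star T * T) \<bullet>\<^sub>o x) x"
        by (simp add: simps cinner_star_left cinner_norm)
      then have "(norm (T \<bullet>\<^sub>o x))\<^sup>2 = cmod (cinner ((star T * T) \<bullet>\<^sub>o x) x)"
        by (metis abs_of_nonneg norm_of_real zero_le_power2)
      also have "\<dots> \<le> norm (star T * T) * norm x * norm x"
        by (rule order_trans[OF cinner_le_norm]) (intro mult_right_mono norm_op norm_ge_zero)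
      also have "\<dots> = (sqrt (norm (star T * T)) * norm x)\<^sup>2"
        by (simp add: power2_eq_square)
      finally show ?thesis by (rule power2_le_imp_le) simp
    qed
    then have "norm T \<le> sqrt (norm (star T * T))" by (intro norm_op_bound) auto
    then have "(norm T)\<^sup>2 \<le> (sqrt (norm (star T * T)))\<^sup>2" by (intro power_mono) auto
    then show ?thesis by simp
  qed
  have le': "norm T \<le> norm (star T)" for T :: ell2_op
  proof (cases "norm T = 0")
    case False
    have "norm T * norm T \<le> norm (star T) * norm T"
      using le[of T] norm_mult_ineq[of "star T" T] by (simp add: power2_eq_square)
    with False show ?thesis by (simp add: mult_le_cancel_right)
  qed simp
  have "norm (star T) = norm T" using le'[of T] le'[of "star T"] by (simp add: ss)
  then show "norm (star T * T) = (norm T)\<^sup>2"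
    using le[of T] norm_mult_ineq[of "star T" T] by (simp add: power2_eq_square)
qed

end

lemma op_eq_on_basis:
  assumes "\<And>n. S \<bullet>\<^sub>o ell2_basis n = T \<bullet>\<^sub>o ell2_basis n"
  shows "S = T"
proof (rule op_eqI)
  fix x
  have eq: "S \<bullet>\<^sub>o ell2_trunc N x = T \<bullet>\<^sub>o ell2_trunc N x" for N
    by (simp add: ell2_trunc_def blinfun.sum_right assms)
  have lim: "(\<lambda>N. U \<bullet>\<^sub>o ell2_trunc N x) \<longlonglongrightarrow> U \<bullet>\<^sub>o x" for U
    by (intro blinfun.tendsto tendsto_trunc tendsto_const)
  show "S \<bullet>\<^sub>o x = T \<bullet>\<^sub>o x"
    by (rule LIMSEQ_unique[OF lim[of S]]) (simp only: eq lim)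
qed

lemma diag_op_ex:
  assumes "\<And>n. cmod (a n) \<le> B"
  obtains T where "\<And>n. T \<bullet>\<^sub>o ell2_basis n = a n *\<^sub>C ell2_basis n"
proof -
  define f where "f x = Abs_ell2 (\<lambda>n. a n * ell2_nth x n)" for x
  have le: "(cmod (a n * ell2_nth x n))\<^sup>2 \<le> B\<^sup>2 * (cmod (ell2_nth x n))\<^sup>2" for n x
    unfolding norm_mult power_mult_distrib
    by (intro mult_right_mono power_mono assms) auto
  have B: "0 \<le> B" using assms[of 0] norm_ge_zero order_trans by blast
  have bnd: "(\<Sum>n<N. (cmod (a n * ell2_nth x n))\<^sup>2) \<le> (B * norm x)\<^sup>2" for N x
  proof -
    have "(\<Sum>n<N. (cmod (a n * ell2_nth x n))\<^sup>2) \<le> B\<^sup>2 * (\<Sum>n<N. (cmod (ell2_nth x n))\<^sup>2)"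
      unfolding sum_distrib_left by (intro sum_mono le)
    also have "\<dots> \<le> B\<^sup>2 * (norm x)\<^sup>2" by (intro mult_left_mono sum_le_norm_ell2) simp
    finally show ?thesis by (simp add: power_mult_distrib)
  qed
  have f: "ell2_nth (f x) n = a n * ell2_nth x n" for x n
    unfolding f_def using ell2_bounded_sums[OF bnd[of x]] by (simp add: Abs_ell2_inverse)
  obtain T where T: "\<And>x. T \<bullet>\<^sub>o x = f x"
  proof (rule op_exI)
    show "f (x + y) = f x + f y" for x y
      by (rule ell2_eqI) (simp add: f distrib_left)
    show "f (b *\<^sub>C x) = b *\<^sub>C f x" for b x
      by (rule ell2_eqI) (simp add: f mult.left_commute)
    show "norm (f x) \<le> B * norm x" for x
      by (rule norm_ell2_bound) (use B in \<open>simp_all add: f bnd\<close>)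
  qed blast
  show ?thesis
    by (rule that[of T]) (auto intro!: ell2_eqI simp: T f ell2_basis.rep_eq)
qed

definition compact_op :: "ell2_op \<Rightarrow> bool" where
  "compact_op T \<longleftrightarrow> compact (closure ((\<lambda>x. T \<bullet>\<^sub>o x) ` cball 0 1))"


section \<open>The unit circle and continuous functions on it\<close>

typedef circle = "sphere (0::complex) 1"
  morphisms complex_of_circle Abs_circle
  by (rule exI[of _ 1]) simp

instantiation circle :: metric_space
begin

definition "dist_circle s t = dist (complex_of_circle s) (complex_of_circle t)"
definition "(uniformity :: (circle \<times> circle) filter) =
  (INF e\<in>{0 <..}. principal {(x, y). dist x y < e})"
definition "open_circle (A :: circle set) =
  (\<forall>x\<in>A. \<forall>\<^sub>F (x', y) in uniformity. x' = x \<longrightarrow> y \<in> A)"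

instance
proof
  fix x y z :: circle
  show "dist x y = 0 \<longleftrightarrow> x = y" by (simp add: dist_circle_def complex_of_circle_inject)
  show "dist x y \<le> dist x z + dist y z" unfolding dist_circle_def by (rule dist_triangle2)
qed (rule uniformity_circle_def open_circle_def)+

end

lemma continuous_complex_of_circle: "continuous_on A complex_of_circle"
  unfolding continuous_on_iff by (auto simp: dist_circle_def)

lemma norm_complex_of_circle [simp]: "cmod (complex_of_circle t) = 1"
  using complex_of_circle[of t] by simp

text \<open>By compactness, the bounded continuous functions on the circle are all the continuous ones.\<close>

lemma compact_circle: "compact (UNIV :: circle set)"
proof -
  have "continuous_on (sphere 0 1) Abs_circle"
    unfolding continuous_on_iff by (auto simp: dist_circle_def Abs_circle_inverse)
  then have "compact (Abs_circle ` sphere 0 1)"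
    by (rule compact_continuous_image) simp
  moreover have "Abs_circle ` sphere 0 1 = UNIV"
    using type_definition.Abs_image[OF type_definition_circle] .
  ultimately show ?thesis by simp
qed

lemma continuous_circle_bcontfun:
  "continuous_on UNIV f \<Longrightarrow> f \<in> bcontfun" for f :: "circle \<Rightarrow> 'a::metric_space"
  unfolding bcontfun_def by (auto intro: compact_imp_bounded compact_continuous_image compact_circle)

lemma continuous_scaleC [continuous_intros]:
  fixes f :: "'a::topological_space \<Rightarrow> complex" and g :: "'a \<Rightarrow> 'b::cstar_algebra"
  assumes "continuous_on A f" "continuous_on A g"
  shows "continuous_on A (\<lambda>x. f x *\<^sub>C g x)"
proof -
  have "bounded_bilinear ((*\<^sub>C) :: complex \<Rightarrow> 'b \<Rightarrow> 'b)"
  proof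
    show "\<exists>K. \<forall>a (b::'b). norm (a *\<^sub>C b) \<le> norm a * norm b * K"
      by (intro exI[of _ 1]) simp
  qed (simp_all add: scaleC_add_right scaleC_add_left scaleR_scaleC scaleC_scaleC
      scaleC_complex_def mult.commute)
  then show ?thesis using assms by (rule bounded_bilinear.continuous_on)
qed

lemma continuous_star [continuous_intros]:
  fixes g :: "'a::topological_space \<Rightarrow> 'b::cstar_algebra"
  assumes "continuous_on A g"
  shows "continuous_on A (\<lambda>x. star (g x))"
proof -
  have "bounded_linear (star :: 'b \<Rightarrow> 'b)"
    by (rule bounded_linear_intro[of _ 1]) (simp_all add: star_add scaleR_scaleC star_scaleC)
  then show ?thesis using assms by (rule bounded_linear.continuous_on)
qed

text \<open>Pointwise operations; the norm is the supremum norm.\<close>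

instantiation bcontfun :: (metric_space, cstar_algebra) cstar_algebra
begin

definition "times_bcontfun (f :: 'a \<Rightarrow>\<^sub>C 'b) (g :: 'a \<Rightarrow>\<^sub>C 'b) = Bcontfun (\<lambda>x. f x * g x)"
definition "scaleC_bcontfun a (f :: 'a \<Rightarrow>\<^sub>C 'b) = Bcontfun (\<lambda>x. a *\<^sub>C f x)"
definition "star_bcontfun (f :: 'a \<Rightarrow>\<^sub>C 'b) = Bcontfun (\<lambda>x. star (f x))"

lemma apply_bcontfun_times [simp]: "apply_bcontfun (f * g) x = f x * g x"
  for f g :: "'a \<Rightarrow>\<^sub>C 'b"
proof -
  have "(\<lambda>x. f x * g x) \<in> bcontfun"
  proof (rule bcontfun_normI)
    show "norm (f x * g x) \<le> norm f * norm g" for x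
      by (rule order_trans[OF norm_mult_ineq]) (intro mult_mono norm_bounded norm_ge_zero)
  qed (intro continuous_intros continuous_on_apply_bcontfun)
  then show ?thesis by (simp add: times_bcontfun_def Bcontfun_inverse)
qed

lemma apply_bcontfun_scaleC [simp]: "apply_bcontfun (a *\<^sub>C f) x = a *\<^sub>C f x"
  for f :: "'a \<Rightarrow>\<^sub>C 'b"
proof -
  have "(\<lambda>x. a *\<^sub>C f x) \<in> bcontfun"
    by (rule bcontfun_normI[of _ "cmod a * norm f"])
      (auto intro!: continuous_intros continuous_on_apply_bcontfun mult_left_mono norm_bounded)
  then show ?thesis by (simp add: scaleC_bcontfun_def Bcontfun_inverse)
qed

lemma apply_bcontfun_star [simp]: "apply_bcontfun (star f) x = star (f x)"
  for f :: "'a \<Rightarrow>\<^sub>C 'b"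
proof -
  have "(\<lambda>x. star (f x)) \<in> bcontfun"
    by (rule bcontfun_normI[of _ "norm f"])
      (auto intro!: continuous_intros continuous_on_apply_bcontfun norm_bounded)
  then show ?thesis by (simp add: star_bcontfun_def Bcontfun_inverse)
qed

instance
proof
  fix f g h :: "'a \<Rightarrow>\<^sub>C 'b" and a b :: complex and r :: real
  show "f * g * h = f * (g * h)" "(f + g) * h = f * h + g * h" "f * (g + h) = f * g + f * h"
    "a *\<^sub>C (f + g) = a *\<^sub>C f + a *\<^sub>C g" "(a + b) *\<^sub>C f = a *\<^sub>C f + b *\<^sub>C f"
    "a *\<^sub>C b *\<^sub>C f = (a * b) *\<^sub>C f" "1 *\<^sub>C f = f"
    "a *\<^sub>C f * g = a *\<^sub>C (f * g)" "f * a *\<^sub>C g = a *\<^sub>C (f * g)"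
    "r *\<^sub>R f * g = r *\<^sub>R (f * g)" "f * r *\<^sub>R g = r *\<^sub>R (f * g)"
    "r *\<^sub>R f = complex_of_real r *\<^sub>C f"
    "star (star f) = f" "star (f + g) = star f + star g"
    "star (a *\<^sub>C f) = cnj a *\<^sub>C star f" "star (f * g) = star g * star f"
    by (rule bcontfun_eqI, simp add: algebra_simps scaleC_add_right scaleC_add_left
        scaleC_scaleC scaleC_one mult_scaleC_left mult_scaleC_right star_star star_add
        star_scaleC star_mult scaleR_scaleC)+
  show mult: "norm (f * g) \<le> norm f * norm g" for f g :: "'a \<Rightarrow>\<^sub>C 'b"
  proof (rule norm_bound)
    show "norm ((f * g) x) \<le> norm f * norm g" for x
      unfolding apply_bcontfun_times
      by (rule order_trans[OF norm_mult_ineq]) (intro mult_mono norm_bounded norm_ge_zero)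
  qed
  have "norm f \<le> sqrt (norm (star f * f))"
  proof (rule norm_bound)
    fix x
    have "(norm (f x))\<^sup>2 = norm ((star f * f) x)" by (simp add: cstar_identity)
    also have "\<dots> \<le> norm (star f * f)" by (rule norm_bounded)
    finally show "norm (f x) \<le> sqrt (norm (star f * f))" by (rule real_le_rsqrt)
  qed
  then have "(norm f)\<^sup>2 \<le> (sqrt (norm (star f * f)))\<^sup>2" by (intro power_mono) auto
  moreover have "norm (star f) \<le> norm f"
  proof (rule norm_bound)
    show "norm (star f x) \<le> norm f" for x by (simp add: norm_bounded)
  qed
  then have "norm (star f * f) \<le> norm f * norm f"
    using order_trans[OF mult[of "star f" f]] by (metis mult_right_mono norm_ge_zero)
  ultimately show "norm (star f * f) = (norm f)\<^sup>2" by (simp add: power2_eq_square)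
qed

end

instantiation bcontfun :: (topological_space, "{metric_space, one}") one
begin
definition "one_bcontfun = const_bcontfun 1"
instance ..
end

definition circle_id :: "circle \<Rightarrow>\<^sub>C complex" where
  "circle_id = Bcontfun complex_of_circle"

lemma apply_circle_id [simp]: "apply_bcontfun circle_id t = complex_of_circle t"
  by (simp add: circle_id_def Bcontfun_inverse continuous_circle_bcontfun
      continuous_complex_of_circle)

text \<open>The family \<open>t \<mapsto> f(t) T\<close> of operators.\<close>

definition op_family :: "(circle \<Rightarrow>\<^sub>C complex) \<Rightarrow> ell2_op \<Rightarrow> (circle \<Rightarrow>\<^sub>C ell2_op)" where
  "op_family f T = Bcontfun (\<lambda>t. f t *\<^sub>C T)"

lemma apply_op_family [simp]: "apply_bcontfun (op_family f T) t = f t *\<^sub>C T"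
  by (simp add: op_family_def Bcontfun_inverse continuous_circle_bcontfun continuous_intros)


section \<open>The operators and the algebras\<close>

definition shift :: ell2_op where
  "shift = (THE T. \<forall>n. T \<bullet>\<^sub>o ell2_basis n = ell2_basis (Suc n))"

definition alpha :: "real \<Rightarrow> ell2_op" where
  "alpha q = (THE T. T \<bullet>\<^sub>o ell2_basis 0 = 0 \<and>
     (\<forall>n\<ge>1. T \<bullet>\<^sub>o ell2_basis n = sqrt (1 - inverse q ^ (2 * n)) *\<^sub>R ell2_basis (n - 1)))"

definition gamma :: "real \<Rightarrow> ell2_op" where
  "gamma q = (THE T. \<forall>n. T \<bullet>\<^sub>o ell2_basis n = inverse q ^ n *\<^sub>R ell2_basis n)"

lemma shift_basis: "shift \<bullet>\<^sub>o ell2_basis n = ell2_basis (Suc n)"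
proof -
  define sh where "sh f n = (case n of 0 \<Rightarrow> 0 | Suc m \<Rightarrow> f m)" for f :: "nat \<Rightarrow> complex" and n
  have sums: "(\<lambda>n. (cmod (sh (ell2_nth x) n))\<^sup>2) sums (norm x)\<^sup>2" for x
    unfolding norm_ell2_sq
    using summable_sums[OF summable_ell2_nth[of x]]
      sums_Suc_iff[of "\<lambda>n. (cmod (sh (ell2_nth x) n))\<^sup>2" "\<Sum>n. (cmod (ell2_nth x n))\<^sup>2"]
    by (simp add: sh_def)
  define f where "f x = Abs_ell2 (sh (ell2_nth x))" for x
  have f: "ell2_nth (f x) = sh (ell2_nth x)" for x
    unfolding f_def using sums[of x] by (simp add: Abs_ell2_inverse sums_iff)
  obtain T where T: "\<And>x. T \<bullet>\<^sub>o x = f x"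
  proof (rule op_exI)
    show "f (x + y) = f x + f y" for x y
      by (rule ell2_eqI) (simp add: f sh_def split: nat.split)
    show "f (b *\<^sub>C x) = b *\<^sub>C f x" for b x
      by (rule ell2_eqI) (simp add: f sh_def split: nat.split)
    show "norm (f x) \<le> 1 * norm x" for x
      using sums[of x] by (simp add: norm_ell2_def[of "f x"] f sums_iff)
  qed blast
  have T': "\<forall>n. T \<bullet>\<^sub>o ell2_basis n = ell2_basis (Suc n)"
    by (auto intro!: ell2_eqI simp: T f sh_def ell2_basis.rep_eq split: nat.split)
  then have "\<forall>n. shift \<bullet>\<^sub>o ell2_basis n = ell2_basis (Suc n)"
    unfolding shift_def
  proof (rule theI)
    fix U assume "\<forall>n. U \<bullet>\<^sub>o ell2_basis n = ell2_basis (Suc n)"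
    with T' show "U = T" by (intro op_eq_on_basis) simp
  qed
  then show ?thesis by blast
qed

lemma star_shift_basis:
  "star shift \<bullet>\<^sub>o ell2_basis 0 = 0" "star shift \<bullet>\<^sub>o ell2_basis (Suc n) = ell2_basis n"
proof -
  have "ell2_nth (star shift \<bullet>\<^sub>o x) k = ell2_nth x (Suc k)" for x k
    unfolding cinner_basis[symmetric] cinner_star_right shift_basis ..
  then show "star shift \<bullet>\<^sub>o ell2_basis 0 = 0" "star shift \<bullet>\<^sub>o ell2_basis (Suc n) = ell2_basis n"
    by - (rule ell2_eqI, simp add: ell2_basis.rep_eq)+
qed

lemma
  assumes "1 < q"
  shows alpha_basis_0: "alpha q \<bullet>\<^sub>o ell2_basis 0 = 0"
    and alpha_basis:
      "n \<ge> 1 \<Longrightarrow> alpha q \<bullet>\<^sub>o ell2_basis n = sqrt (1 - inverse q ^ (2 * n)) *\<^sub>R ell2_basis (n - 1)"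
    and gamma_basis: "gamma q \<bullet>\<^sub>o ell2_basis n = inverse q ^ n *\<^sub>R ell2_basis n"
proof -
  have q: "0 \<le> inverse q" "inverse q \<le> 1" using assms by (auto simp: inverse_le_1_iff)
  then have pow: "0 \<le> inverse q ^ k" "inverse q ^ k \<le> 1" for k
    by (auto simp del: power_inverse intro: power_le_one)
  define b where "b n = sqrt (1 - inverse q ^ (2 * n))" for n
  define d where "d n = inverse q ^ n" for n
  have bd: "\<bar>b n\<bar> \<le> 1" "\<bar>d n\<bar> \<le> 1" for n
    using pow[of "2 * n"] pow[of n] unfolding b_def d_def by (simp_all only: abs_of_nonneg
        real_sqrt_ge_zero real_sqrt_le_1_iff diff_ge_0_iff_ge le_diff_eq)
  obtain D where D: "\<And>n. D \<bullet>\<^sub>o ell2_basis n = complex_of_real (b n) *\<^sub>C ell2_basis n"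
    by (rule diag_op_ex[of "\<lambda>n. complex_of_real (b n)" 1]) (use bd in auto)
  let ?P = "\<lambda>T. T \<bullet>\<^sub>o ell2_basis 0 = 0 \<and>
     (\<forall>n\<ge>1. T \<bullet>\<^sub>o ell2_basis n = b n *\<^sub>R ell2_basis (n - 1))"
  have P: "?P (star shift * D)"
  proof (intro conjI allI impI)
    fix n :: nat assume "1 \<le> n"
    then obtain m where "n = Suc m" by (cases n) auto
    then show "(star shift * D) \<bullet>\<^sub>o ell2_basis n = b n *\<^sub>R ell2_basis (n - 1)"
      by (simp add: op_apply_simps D star_shift_basis scaleR_ell2_def)
  qed (simp add: op_apply_simps D star_shift_basis)
  have "?P (alpha q)"
    unfolding alpha_def b_def[symmetric]
  proof (rule theI[of ?P, OF P])
    fix T assume T: "?P T"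
    show "T = star shift * D"
    proof (rule op_eq_on_basis)
      show "T \<bullet>\<^sub>o ell2_basis n = (star shift * D) \<bullet>\<^sub>o ell2_basis n" for n
      proof (cases "n = 0")
        case True
        with T P show ?thesis by metis
      next
        case False
        then have "1 \<le> n" by simp
        with T P show ?thesis by metis
      qed
    qed
  qed
  then show "alpha q \<bullet>\<^sub>o ell2_basis 0 = 0"
    and "n \<ge> 1 \<Longrightarrow> alpha q \<bullet>\<^sub>o ell2_basis n = sqrt (1 - inverse q ^ (2 * n)) *\<^sub>R ell2_basis (n - 1)"
    unfolding b_def[symmetric] by blast+
  obtain G where "\<And>n. G \<bullet>\<^sub>o ell2_basis n = complex_of_real (d n) *\<^sub>C ell2_basis n"
    by (rule diag_op_ex[of "\<lambda>n. complex_of_real (d n)" 1]) (use bd in auto)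
  then have G: "\<forall>n. G \<bullet>\<^sub>o ell2_basis n = d n *\<^sub>R ell2_basis n"
    by (simp add: scaleR_ell2_def)
  have "\<forall>n. gamma q \<bullet>\<^sub>o ell2_basis n = d n *\<^sub>R ell2_basis n"
    unfolding gamma_def d_def[symmetric]
  proof (rule theI[of "\<lambda>T. \<forall>n. T \<bullet>\<^sub>o ell2_basis n = d n *\<^sub>R ell2_basis n", OF G])
    fix T assume "\<forall>n. T \<bullet>\<^sub>o ell2_basis n = d n *\<^sub>R ell2_basis n"
    with G show "T = G" by (intro op_eq_on_basis) simp
  qed
  then show "gamma q \<bullet>\<^sub>o ell2_basis n = inverse q ^ n *\<^sub>R ell2_basis n"
    unfolding d_def[symmetric] by blast
qed

text \<open>The images of the standard generators \<open>u\<^sub>i\<^sub>j\<close>, with \<open>i, j \<in> {1, 2}\<close>, under the faithful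
  representation by norm-continuous families; here \<open>circle_id\<close> is \<open>t\<^sub>1\<close> and its conjugate is
  \<open>t\<^sub>2\<close>.\<close>

definition su2_gen :: "real \<Rightarrow> nat \<Rightarrow> nat \<Rightarrow> (circle \<Rightarrow>\<^sub>C ell2_op)" where
  "su2_gen q i j =
     (if i = 1
      then if j = 1 then op_family circle_id (alpha q)
           else (- inverse q) *\<^sub>R op_family circle_id (gamma q)
      else if j = 1 then op_family (star circle_id) (gamma q)
           else op_family (star circle_id) (star (alpha q)))"

definition proj_coord :: "real \<Rightarrow> real \<Rightarrow> nat \<Rightarrow> (circle \<Rightarrow>\<^sub>C ell2_op)" where
  "proj_coord q c i = sqrt c *\<^sub>R su2_gen q 1 i + su2_gen q 2 i"

definition quantum_CP1 :: "real \<Rightarrow> real \<Rightarrow> (circle \<Rightarrow>\<^sub>C ell2_op) set" where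
  "quantum_CP1 q c =
     cstar_generated {star (proj_coord q c i) * proj_coord q c j | i j. i \<in> {1, 2} \<and> j \<in> {1, 2}}"

lemma proj_coord_apply:
  "apply_bcontfun (proj_coord q c 1) t =
     sqrt c *\<^sub>R (complex_of_circle t *\<^sub>C alpha q) + cnj (complex_of_circle t) *\<^sub>C gamma q"
  "apply_bcontfun (proj_coord q c 2) t =
     (- inverse q * sqrt c) *\<^sub>R (complex_of_circle t *\<^sub>C gamma q) +
     cnj (complex_of_circle t) *\<^sub>C star (alpha q)"
  by (simp_all add: proj_coord_def su2_gen_def star_complex_def mult.commute)

definition X1 :: "real \<Rightarrow> real \<Rightarrow> ell2_op" where
  "X1 q c = sqrt c *\<^sub>R alpha q + gamma q"

definition X2 :: "real \<Rightarrow> real \<Rightarrow> ell2_op" where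
  "X2 q c = (- inverse q * sqrt c) *\<^sub>R gamma q + star (alpha q)"

definition toeplitz :: "ell2_op set" where
  "toeplitz = cstar_generated {shift}"

text \<open>These conditions determine the values of \<open>\<sigma>\<close> on the Toeplitz algebra; its values
  elsewhere are irrelevant.\<close>

definition symbol_map :: "(ell2_op \<Rightarrow> (circle \<Rightarrow>\<^sub>C complex)) \<Rightarrow> bool" where
  "symbol_map \<sigma> \<longleftrightarrow>
     star_hom_on toeplitz \<sigma> \<and> \<sigma> 1 = 1 \<and> \<sigma> ` toeplitz = UNIV \<and> \<sigma> shift = circle_id \<and>
     {T \<in> toeplitz. \<sigma> T = 0} = {T. compact_op T}"

definition toeplitz_pullback ::
    "(ell2_op \<Rightarrow> (circle \<Rightarrow>\<^sub>C complex)) \<Rightarrow> (ell2_op \<times> ell2_op) set" where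
  "toeplitz_pullback \<sigma> = {(T, S). T \<in> toeplitz \<and> S \<in> toeplitz \<and> \<sigma> T = \<sigma> S}"

end

theory Submission
  imports Defs
begin

text \<open>
  Put \<open>Q = q\<^sup>-\<^sup>2\<close>, \<open>A = X\<^sub>1\<^sup>*X\<^sub>1\<close>, \<open>B = X\<^sub>1\<^sup>*X\<^sub>2\<close> and \<open>N = A - c\<close>. Everything rests on two identities between the
  coordinates: \<open>X\<^sub>1X\<^sub>1\<^sup>* + X\<^sub>2X\<^sub>2\<^sup>* = 1 + c\<close> and \<open>X\<^sub>2\<^sup>*X\<^sub>2 = 1 - Q N\<close>. They give the relations of a
  Podles sphere,
  \<open>N B = Q B N\<close>, \<open>B\<^sup>*B = (c + Q N)(1 - Q N)\<close> and \<open>B B\<^sup>* = (c + N)(1 - N)\<close>.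
  So \<open>B\<close> multiplies eigenvalues of \<open>N\<close> by \<open>Q\<close>, and \<open>B\<^sup>*\<close> divides them by \<open>Q\<close> until it kills a vector
  with eigenvalue \<open>1\<close> or \<open>-c\<close>.

  In the canonical basis \<open>N\<close> is a compact Jacobi matrix (that of the Al-Salam--Carlitz
  polynomials). It has an explicit eigenvector for each of \<open>1\<close> and \<open>-c\<close>; applying \<open>B\<close> repeatedly
  produces orthonormal eigenvectors for \<open>Q\<^sup>n\<close> and \<open>-c Q\<^sup>n\<close>. These are complete
  (\<open>reducing_subspace_trivial\<close>): otherwise \<open>N\<close> has, in the orthogonal complement, an eigenvector whose
  eigenvalue is maximal in modulus; \<open>B\<^sup>*\<close> would enlarge the eigenvalue, hence kills the vector,
  so the eigenvalue is \<open>1\<close> or \<open>-c\<close>, and both eigenspaces are already used up because the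
  eigenspaces of a Jacobi matrix are simple. Consequently \<open>(A, B)\<close> is unitarily equivalent to a
  direct sum of two pairs (diagonal operator, weighted shift), which is
  \<open>podles_pair_exists\<close>.

  In this block form the generated algebra is computed in \<open>alg_eq_block_pullback\<close>. The two blocks of
  every generator are Toeplitz operators that differ by a compact operator, which means that they
  have the same symbol. Conversely, the unit is a polynomial in the generators, so by Weierstrass all
  continuous functions of \<open>N\<close> are available. They provide the spectral projections at \<open>1\<close> and \<open>-c\<close>
  and, after the weights of \<open>B\<close> are divided out, the shift acting in both blocks. From these one
  obtains all compact operators of either block and all \<open>T \<oplus> T\<close> with \<open>T\<close> Toeplitz, and thus
  the pullback.

  Finally the circle parameter is removed. At the point \<open>t\<close> the coordinates are
  \<open>x\<^sub>1(t) = t\<^sup>-\<^sup>1 U X\<^sub>1 U\<^sup>*\<close> and \<open>x\<^sub>2(t) = t U X\<^sub>2 U\<^sup>*\<close> with \<open>U\<close> a diagonal unitary in the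
  canonical basis, so \<open>B\<close> picks up the phase \<open>t\<^sup>2\<close>. In the basis of eigenvectors \<open>B\<close> is a pair
  of weighted shifts, and another diagonal unitary produces the same phase. Hence every
  element \<open>f\<close> of the algebra of families satisfies \<open>f(t) = Z(t) f(1) Z(t)\<^sup>*\<close> with \<open>Z(t)\<close> unitary, and
  evaluation at \<open>1\<close> is isometric (\<open>quantum_CP1_conjugate\<close>).
\<close>

section \<open>Diagonal operators and compactness\<close>

definition diag_op :: "(nat \<Rightarrow> complex) \<Rightarrow> ell2_op" where
  "diag_op d = (SOME T. \<forall>n. T \<bullet>\<^sub>o ell2_basis n = d n *\<^sub>C ell2_basis n)"

lemma diag_op_basis:
  assumes "Bseq d"
  shows "diag_op d \<bullet>\<^sub>o ell2_basis n = d n *\<^sub>C ell2_basis n"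
proof -
  obtain B where "\<And>n. cmod (d n) \<le> B"
    using assms unfolding Bseq_def by blast
  then obtain T where "\<forall>n. T \<bullet>\<^sub>o ell2_basis n = d n *\<^sub>C ell2_basis n"
    using diag_op_ex by blast
  then show ?thesis
    unfolding diag_op_def by (rule someI2) blast
qed

lemma star_op_nth: "ell2_nth (star T \<bullet>\<^sub>o x) n = cinner (T \<bullet>\<^sub>o ell2_basis n) x"
  using cinner_star_right[of "ell2_basis n" T x] by simp

lemma op_nth: "ell2_nth (T \<bullet>\<^sub>o x) n = cinner (star T \<bullet>\<^sub>o ell2_basis n) x"
  using star_op_nth[of "star T"] by (simp add: star_star)

lemma diag_op_unique:
  assumes "Bseq d" "\<And>n. T \<bullet>\<^sub>o ell2_basis n = d n *\<^sub>C ell2_basis n"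
  shows "T = diag_op d"
  using assms by (intro op_eq_on_basis) (simp add: diag_op_basis)

lemma star_diag_op:
  assumes "Bseq d"
  shows "star (diag_op d) = diag_op (\<lambda>n. cnj (d n))"
proof (rule diag_op_unique)
  show "Bseq (\<lambda>n. cnj (d n))" using assms by (simp add: Bseq_def)
  show "star (diag_op d) \<bullet>\<^sub>o ell2_basis n = cnj (d n) *\<^sub>C ell2_basis n" for n
    by (rule ell2_eqI)
      (simp add: star_op_nth diag_op_basis[OF assms] cinner_scaleC_left ell2_basis.rep_eq)
qed

lemma diag_op_nth:
  assumes "Bseq d"
  shows "ell2_nth (diag_op d \<bullet>\<^sub>o x) n = d n * ell2_nth x n"
proof -
  have "Bseq (\<lambda>n. cnj (d n))" using assms by (simp add: Bseq_def)
  then show ?thesis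
    by (simp add: op_nth star_diag_op[OF assms] diag_op_basis cinner_scaleC_left)
qed

lemma norm_diag_op_le:
  assumes "\<And>n. cmod (d n) \<le> b"
  shows "norm (diag_op d) \<le> b"
proof (rule norm_op_bound)
  have d: "Bseq d" using assms by (rule BseqI')
  show b: "0 \<le> b" using assms[of 0] norm_ge_zero order_trans by blast
  show "norm (diag_op d \<bullet>\<^sub>o x) \<le> b * norm x" for x
  proof (rule norm_ell2_bound)
    fix N
    have "(\<Sum>n<N. (cmod (ell2_nth (diag_op d \<bullet>\<^sub>o x) n))\<^sup>2) \<le> (\<Sum>n<N. b\<^sup>2 * (cmod (ell2_nth x n))\<^sup>2)"
      unfolding diag_op_nth[OF d] norm_mult power_mult_distrib
      by (intro sum_mono mult_right_mono power_mono assms) auto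
    also have "\<dots> \<le> b\<^sup>2 * (norm x)\<^sup>2"
      unfolding sum_distrib_left[symmetric] by (intro mult_left_mono sum_le_norm_ell2) simp
    finally show "(\<Sum>n<N. (cmod (ell2_nth (diag_op d \<bullet>\<^sub>o x) n))\<^sup>2) \<le> (b * norm x)\<^sup>2"
      by (simp add: power_mult_distrib)
  qed (use b in simp)
qed

lemma diag_op_mult:
  assumes "Bseq d" "Bseq e"
  shows "diag_op d * diag_op e = diag_op (\<lambda>n. d n * e n)"
  using assms by (intro diag_op_unique Bseq_mult)
    (simp_all add: op_apply_simps diag_op_basis scaleC_scaleC mult.commute)

lemma diag_op_add:
  assumes "Bseq d" "Bseq e"
  shows "diag_op d + diag_op e = diag_op (\<lambda>n. d n + e n)"
proof (rule diag_op_unique)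
  show "Bseq (\<lambda>n. d n + e n)"
  proof -
    obtain b b' where "\<And>n. cmod (d n) \<le> b" "\<And>n. cmod (e n) \<le> b'"
      using assms unfolding Bseq_def by blast
    then show ?thesis
      by (intro BseqI'[of _ "b + b'"]) (meson norm_triangle_mono)
  qed
qed (use assms in \<open>simp add: op_apply_simps diag_op_basis scaleC_add_left\<close>)

lemma diag_op_scaleC:
  assumes "Bseq d"
  shows "a *\<^sub>C diag_op d = diag_op (\<lambda>n. a * d n)"
  using assms
  by (intro diag_op_unique Bseq_mult) (simp_all add: op_apply_scaleC diag_op_basis scaleC_scaleC)

lemma diag_op_const: "diag_op (\<lambda>_. a) = a *\<^sub>C 1"
  by (rule diag_op_unique[symmetric]) (simp_all add: op_apply_scaleC op_apply_simps)

lemma diag_op_diff: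
  assumes "Bseq d" "Bseq e"
  shows "diag_op d - diag_op e = diag_op (\<lambda>n. d n - e n)"
proof -
  have "Bseq (\<lambda>n. - e n)" using assms by (simp add: Bseq_minus_iff)
  moreover have "diag_op e + diag_op (\<lambda>n. - e n) = 0"
    using diag_op_add[OF assms(2) calculation] diag_op_const[of 0] by simp
  then have "diag_op (\<lambda>n. - e n) = - diag_op e" by (simp add: eq_neg_iff_add_eq_0 add.commute)
  ultimately show ?thesis
    using diag_op_add[OF assms(1), of "\<lambda>n. - e n"] by simp
qed

text \<open>The coordinate projections; a compact operator is recognised by its approximation by them.\<close>

definition trunc_op :: "nat \<Rightarrow> ell2_op" where
  "trunc_op N = diag_op (\<lambda>n. if n < N then 1 else 0)"

lemma trunc_op_apply: "trunc_op N \<bullet>\<^sub>o x = ell2_trunc N x"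
proof -
  have "Bseq (\<lambda>n. if n < N then 1 else (0::complex))" by (rule BseqI'[of _ 1]) simp
  then show ?thesis
    by (intro ell2_eqI) (simp add: trunc_op_def diag_op_nth ell2_nth_trunc)
qed

lemma norm_trunc_op_le: "norm (trunc_op N) \<le> 1"
  unfolding trunc_op_def by (rule norm_diag_op_le) simp

lemma star_trunc_op: "star (trunc_op N) = trunc_op N"
proof -
  have "Bseq (\<lambda>n. if n < N then 1 else (0::complex))" by (rule BseqI'[of _ 1]) simp
  then show ?thesis by (simp add: trunc_op_def star_diag_op if_distrib cong: if_cong)
qed

text \<open>Only the finitely many coordinates below \<open>N\<close> are free, each in a compact disc. This is the total
  boundedness needed to recognise norm limits of finite-rank operators as compact.\<close>

lemma compact_bounded_coordinates:
  "compact {y. (\<forall>n<N. cmod (ell2_nth y n) \<le> R) \<and> (\<forall>n\<ge>N. ell2_nth y n = 0)}" (is "compact (?C N)")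
proof (induction N)
  case 0
  have "?C 0 \<subseteq> {0}" by (auto intro: ell2_eqI)
  then show ?case
    by (rule finite_imp_compact[OF finite_subset]) simp
next
  case (Suc N)
  have "bounded_linear (\<lambda>z. z *\<^sub>C ell2_basis N)"
    by (rule bounded_linear_intro[of _ 1])
      (simp_all add: scaleC_add_left scaleR_ell2_def scaleC_scaleC scaleR_conv_of_real)
  then have "compact ((\<lambda>z. z *\<^sub>C ell2_basis N) ` cball 0 R)"
    by (intro compact_continuous_image linear_continuous_on compact_cball)
  then have "compact {x + y | x y. x \<in> ?C N \<and> y \<in> (\<lambda>z. z *\<^sub>C ell2_basis N) ` cball 0 R}"
    using Suc by (intro compact_sums)
  moreover have "{x + y | x y. x \<in> ?C N \<and> y \<in> (\<lambda>z. z *\<^sub>C ell2_basis N) ` cball 0 R} = ?C (Suc N)"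
  proof (intro equalityI subsetI)
    fix y assume y: "y \<in> ?C (Suc N)"
    have "y - ell2_nth y N *\<^sub>C ell2_basis N \<in> ?C N"
      using y by (auto simp: ell2_basis.rep_eq)
    moreover have "ell2_nth y N \<in> cball 0 R" using y by auto
    moreover have "y = (y - ell2_nth y N *\<^sub>C ell2_basis N) + ell2_nth y N *\<^sub>C ell2_basis N" by simp
    ultimately show "y \<in> {x + y | x y. x \<in> ?C N \<and> y \<in> (\<lambda>z. z *\<^sub>C ell2_basis N) ` cball 0 R}"
      by blast
  qed (auto simp: ell2_basis.rep_eq less_Suc_eq)
  ultimately show ?case by simp
qed

text \<open>A compact image of the unit ball has a finite net, on which the strongly convergent truncations
  converge uniformly. Conversely \<open>trunc_op N * T\<close> maps the unit ball into a totally bounded set and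
  is uniformly close to \<open>T\<close>. In this form closure, products and diagonal operators
  are immediate.\<close>

lemma compact_op_iff: "compact_op T \<longleftrightarrow> (\<lambda>N. trunc_op N * T) \<longlonglongrightarrow> T"
proof
  assume T: "compact_op T"
  show "(\<lambda>N. trunc_op N * T) \<longlonglongrightarrow> T"
  proof (rule LIMSEQ_I)
    fix e :: real assume e: "0 < e"
    have "\<forall>e>0. \<exists>k. finite k \<and> closure ((\<lambda>x. T \<bullet>\<^sub>o x) ` cball 0 1) \<subseteq> (\<Union>x\<in>k. ball x e)"
      using T unfolding compact_op_def compact_eq_totally_bounded by blast
    then obtain F where F: "finite F"
        "closure ((\<lambda>x. T \<bullet>\<^sub>o x) ` cball 0 1) \<subseteq> (\<Union>x\<in>F. ball x (e/4))"
      using e by (metis zero_less_divide_iff zero_less_numeral)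
    have "\<forall>\<^sub>F N in sequentially. \<forall>y\<in>F. norm (ell2_trunc N y - y) < e/4"
    proof (intro eventually_ball_finite F ballI)
      show "\<forall>\<^sub>F N in sequentially. norm (ell2_trunc N y - y) < e/4" for y
        using tendstoD[OF tendsto_trunc[of y], of "e/4"] e by (simp only: dist_norm)
    qed
    then obtain M where M: "\<And>N y. N \<ge> M \<Longrightarrow> y \<in> F \<Longrightarrow> norm (ell2_trunc N y - y) < e/4"
      unfolding eventually_sequentially by blast
    have "norm (trunc_op N * T - T) < e" if N: "N \<ge> M" for N
    proof -
      have unit: "norm ((trunc_op N * T - T) \<bullet>\<^sub>o x) \<le> 3*e/4" if x: "norm x \<le> 1" for x
      proof -
        have "T \<bullet>\<^sub>o x \<in> closure ((\<lambda>x. T \<bullet>\<^sub>o x) ` cball 0 1)"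
          using x by (intro subsetD[OF closure_subset]) auto
        then obtain y where y: "y \<in> F" "norm (y - T \<bullet>\<^sub>o x) < e/4"
          using F(2) by (auto simp: dist_norm)
        have "norm (trunc_op N \<bullet>\<^sub>o (y - T \<bullet>\<^sub>o x)) \<le> e/4"
          using order_trans[OF norm_op mult_right_mono[OF norm_trunc_op_le]] y(2)
          by (smt (verit) norm_ge_zero)
        moreover have "(trunc_op N * T - T) \<bullet>\<^sub>o x =
            (ell2_trunc N y - y) - (trunc_op N \<bullet>\<^sub>o (y - T \<bullet>\<^sub>o x)) + (y - T \<bullet>\<^sub>o x)"
          by (simp add: op_apply_simps blinfun.diff_right trunc_op_apply)
        ultimately show ?thesis
          using M[OF N y(1)] y(2)
            norm_triangle_ineq[of "(ell2_trunc N y - y) - (trunc_op N \<bullet>\<^sub>o (y - T \<bullet>\<^sub>o x))" "y - T \<bullet>\<^sub>o x"]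
            norm_triangle_ineq4[of "ell2_trunc N y - y" "trunc_op N \<bullet>\<^sub>o (y - T \<bullet>\<^sub>o x)"]
          by simp
      qed
      have "norm (trunc_op N * T - T) \<le> 3*e/4"
      proof (rule norm_op_bound)
        show "norm ((trunc_op N * T - T) \<bullet>\<^sub>o x) \<le> 3*e/4 * norm x" for x
        proof (cases "x = 0")
          case False
          have "norm ((trunc_op N * T - T) \<bullet>\<^sub>o (x /\<^sub>R norm x)) \<le> 3*e/4"
            using False by (intro unit) simp
          then show ?thesis using False by (simp add: blinfun.scaleR_right field_simps)
        qed simp
      qed (use e in simp)
      then show ?thesis using e by simp
    qed
    then show "\<exists>M. \<forall>N\<ge>M. norm (trunc_op N * T - T) < e" by blast
  qed
next
  assume lim: "(\<lambda>N. trunc_op N * T) \<longlonglongrightarrow> T"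
  show "compact_op T"
    unfolding compact_op_def compact_eq_totally_bounded
  proof (intro conjI allI impI)
    fix e :: real assume e: "0 < e"
    obtain N where N: "norm (trunc_op N * T - T) < e/4"
      using LIMSEQ_D[OF lim, of "e/4"] e by auto
    define C where "C = {y. (\<forall>n<N. cmod (ell2_nth y n) \<le> norm T) \<and> (\<forall>n\<ge>N. ell2_nth y n = 0)}"
    have "\<forall>e>0. \<exists>k. finite k \<and> C \<subseteq> (\<Union>x\<in>k. ball x e)"
      using compact_bounded_coordinates[of N "norm T"]
      unfolding C_def compact_eq_totally_bounded by blast
    then obtain F where F: "finite F" "C \<subseteq> (\<Union>x\<in>F. ball x (e/4))"
      using e by (metis zero_less_divide_iff zero_less_numeral)
    have "(\<lambda>x. T \<bullet>\<^sub>o x) ` cball 0 1 \<subseteq> (\<Union>x\<in>F. cball x (e/2))"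
    proof clarify
      fix x :: ell2 assume "x \<in> cball 0 1"
      then have x: "norm x \<le> 1" by simp
      have Tx: "norm (T \<bullet>\<^sub>o x) \<le> norm T"
        using norm_op[of T x] mult_left_le[OF x, of "norm T"] by simp
      have "cmod (ell2_nth (T \<bullet>\<^sub>o x) n) \<le> norm T" for n
        by (rule order_trans[OF norm_ell2_nth_le Tx])
      then have "ell2_trunc N (T \<bullet>\<^sub>o x) \<in> C"
        by (simp add: C_def ell2_nth_trunc)
      then obtain y where y: "y \<in> F" "dist y (ell2_trunc N (T \<bullet>\<^sub>o x)) < e/4"
        using F(2) by auto
      have "norm ((trunc_op N * T - T) \<bullet>\<^sub>o x) \<le> e/4"
        using norm_op[of "trunc_op N * T - T" x] mult_left_le[OF x, of "norm (trunc_op N * T - T)"] N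
        by simp
      then have "dist (ell2_trunc N (T \<bullet>\<^sub>o x)) (T \<bullet>\<^sub>o x) \<le> e/4"
        by (simp add: dist_norm op_apply_simps trunc_op_apply)
      then have "dist y (T \<bullet>\<^sub>o x) \<le> e/2"
        using y(2) dist_triangle[of y "T \<bullet>\<^sub>o x" "ell2_trunc N (T \<bullet>\<^sub>o x)"] by simp
      with y(1) show "T \<bullet>\<^sub>o x \<in> (\<Union>x\<in>F. cball x (e/2))" by auto
    qed
    then have "closure ((\<lambda>x. T \<bullet>\<^sub>o x) ` cball 0 1) \<subseteq> (\<Union>x\<in>F. cball x (e/2))"
      using F(1) by (intro closure_minimal closed_UN) auto
    also have "\<dots> \<subseteq> (\<Union>x\<in>F. ball x e)" using e by force
    finally show "\<exists>k. finite k \<and> closure ((\<lambda>x. T \<bullet>\<^sub>o x) ` cball 0 1) \<subseteq> (\<Union>x\<in>k. ball x e)"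
      using F(1) by blast
  qed (simp add: complete_eq_closed)
qed

lemma closed_compact_op: "closed {T. compact_op T}"
  unfolding closed_sequential_limits
proof (intro allI impI, elim conjE)
  fix X L assume X: "\<forall>n. X n \<in> {T. compact_op T}" and L: "X \<longlonglongrightarrow> L"
  have "(\<lambda>N. trunc_op N * L) \<longlonglongrightarrow> L"
  proof (rule LIMSEQ_I)
    fix e :: real assume e: "0 < e"
    obtain n where n: "norm (X n - L) < e/4"
      using LIMSEQ_D[OF L, of "e/4"] e by auto
    have "(\<lambda>N. trunc_op N * X n) \<longlonglongrightarrow> X n" using X by (simp add: compact_op_iff)
    then obtain M where M: "\<And>N. N \<ge> M \<Longrightarrow> norm (trunc_op N * X n - X n) < e/4"
      using LIMSEQ_D[of _ "X n" "e/4"] e by auto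
    have "norm (trunc_op N * L - L) < e" if "N \<ge> M" for N
    proof -
      have "norm (trunc_op N * (L - X n)) \<le> e/4"
        using order_trans[OF norm_mult_ineq mult_right_mono[OF norm_trunc_op_le]] n
        by (smt (verit) norm_ge_zero norm_minus_commute)
      moreover have "trunc_op N * L - L = trunc_op N * (L - X n) + (trunc_op N * X n - X n) + (X n - L)"
        by (simp add: algebra_simps)
      ultimately show ?thesis
        using M[OF that] n e
          norm_triangle_ineq[of "trunc_op N * (L - X n) + (trunc_op N * X n - X n)" "X n - L"]
          norm_triangle_ineq[of "trunc_op N * (L - X n)" "trunc_op N * X n - X n"]
        by simp
    qed
    then show "\<exists>M. \<forall>N\<ge>M. norm (trunc_op N * L - L) < e" by blast
  qed
  then show "L \<in> {T. compact_op T}" by (simp add: compact_op_iff)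
qed

lemma compact_op_mult_right:
  assumes "compact_op T"
  shows "compact_op (T * S)"
proof -
  have "(\<lambda>N. trunc_op N * T * S) \<longlonglongrightarrow> T * S"
    using assms unfolding compact_op_iff by (intro tendsto_mult tendsto_const)
  then show ?thesis by (simp add: compact_op_iff mult.assoc)
qed

lemma compact_op_diag_op:
  assumes "d \<longlonglongrightarrow> 0"
  shows "compact_op (diag_op d)"
  unfolding compact_op_iff
proof (rule LIMSEQ_I)
  have d: "Bseq d" using assms by (intro convergent_imp_Bseq convergentI)
  have t: "Bseq (\<lambda>n. if n < N then 1 else (0::complex))" for N by (rule BseqI'[of _ 1]) simp
  fix e :: real assume e: "0 < e"
  obtain M where M: "\<And>n. n \<ge> M \<Longrightarrow> cmod (d n) < e/2"
    using LIMSEQ_D[OF assms, of "e/2"] e by auto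
  have "norm (trunc_op N * diag_op d - diag_op d) < e" if N: "N \<ge> M" for N
  proof -
    have "trunc_op N * diag_op d - diag_op d = diag_op (\<lambda>n. (if n < N then 1 else 0) * d n - d n)"
      unfolding trunc_op_def by (simp only: diag_op_mult diag_op_diff Bseq_mult t d)
    also have "norm \<dots> \<le> e/2"
    proof (rule norm_diag_op_le)
      show "cmod ((if n < N then 1 else 0) * d n - d n) \<le> e/2" for n
        using M[of n] N e by (cases "n < N") (auto simp: less_imp_le)
    qed
    finally show ?thesis using e by simp
  qed
  then show "\<exists>M. \<forall>N\<ge>M. norm (trunc_op N * diag_op d - diag_op d) < e" by blast
qed

section \<open>C*-subalgebras\<close>

lemma cstar_subalgebraD:
  assumes "cstar_subalgebra A"
  shows cstar_subalgebra_zero: "0 \<in> A"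
    and cstar_subalgebra_add: "x \<in> A \<Longrightarrow> y \<in> A \<Longrightarrow> x + y \<in> A"
    and cstar_subalgebra_scaleC: "x \<in> A \<Longrightarrow> a *\<^sub>C x \<in> A"
    and cstar_subalgebra_mult: "x \<in> A \<Longrightarrow> y \<in> A \<Longrightarrow> x * y \<in> A"
    and cstar_subalgebra_star: "x \<in> A \<Longrightarrow> star x \<in> A"
    and cstar_subalgebra_closed: "closed A"
  using assms unfolding cstar_subalgebra_def by blast+

lemma scaleC_minus1: "(-1) *\<^sub>C x = - x" for x :: "'a::complex_vector"
proof -
  have "(-1) *\<^sub>C x + x = ((-1) + 1) *\<^sub>C x"
    by (simp only: scaleC_add_left scaleC_one)
  then show ?thesis by (simp add: eq_neg_iff_add_eq_0)
qed

lemma cstar_subalgebra_diff: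
  assumes "cstar_subalgebra A" "x \<in> A" "y \<in> A"
  shows "x - y \<in> A"
proof -
  have "x + (-1) *\<^sub>C y \<in> A" by (intro cstar_subalgebraD[OF assms(1)] assms)
  then show ?thesis by (simp add: scaleC_minus1)
qed

lemma cstar_subalgebra_scaleR: "cstar_subalgebra A \<Longrightarrow> x \<in> A \<Longrightarrow> r *\<^sub>R x \<in> A"
  by (simp add: scaleR_scaleC cstar_subalgebra_scaleC)

lemma star_scaleR: "star (r *\<^sub>R x) = r *\<^sub>R star x" for x :: "'a::cstar_algebra"
  by (simp add: scaleR_scaleC star_scaleC)

lemma cstar_subalgebra_power:
  fixes x :: ell2_op
  assumes "cstar_subalgebra A" "x \<in> A" "1 \<in> A"
  shows "x ^ n \<in> A"
  using assms(2,3) by (induction n) (auto intro: cstar_subalgebra_mult[OF assms(1)])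

lemma cstar_generated_least: "cstar_subalgebra A \<Longrightarrow> F \<subseteq> A \<Longrightarrow> cstar_generated F \<subseteq> A"
  unfolding cstar_generated_def by blast

lemma cstar_generated_superset: "F \<subseteq> cstar_generated F"
  unfolding cstar_generated_def by blast

lemma star_one: "star (1::ell2_op) = 1"
  by (rule star_unique) (simp add: op_apply_simps)

lemma star_hom_on_diff:
  assumes "star_hom_on A \<phi>" "cstar_subalgebra A" "x \<in> A" "y \<in> A"
  shows "\<phi> (x - y) = \<phi> x - \<phi> y"
proof -
  have "\<phi> (x + (-1) *\<^sub>C y) = \<phi> x + (-1) *\<^sub>C \<phi> y"
    using assms cstar_subalgebra_scaleC[OF assms(2,4)] unfolding star_hom_on_def by metis
  then show ?thesis by (simp add: scaleC_minus1)
qed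

section \<open>The Toeplitz algebra\<close>

lemma star_shift_shift: "star shift * shift = 1"
  by (rule op_eq_on_basis) (simp add: op_apply_simps shift_basis star_shift_basis)

lemma cstar_subalgebra_toeplitz: "cstar_subalgebra toeplitz"
  unfolding toeplitz_def by (rule cstar_subalgebra_generated)

lemma shift_in_toeplitz: "shift \<in> toeplitz"
  unfolding toeplitz_def using cstar_generated_superset by blast

lemma one_in_toeplitz: "1 \<in> toeplitz"
  using cstar_subalgebra_toeplitz shift_in_toeplitz star_shift_shift
  by (metis cstar_subalgebra_mult cstar_subalgebra_star)

context
  fixes \<sigma> assumes \<sigma>: "symbol_map \<sigma>"
begin

lemma compact_op_iff_symbol: "compact_op T \<longleftrightarrow> T \<in> toeplitz \<and> \<sigma> T = 0"
  using \<sigma> unfolding symbol_map_def by blast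

lemma symbol_hom: "star_hom_on toeplitz \<sigma>"
  using \<sigma> unfolding symbol_map_def by blast

text \<open>Since the kernel of the symbol map consists of the compact operators, the pullback can be
  described without it. In this form it is visibly closed, because the compact operators are.\<close>

lemma toeplitz_pullback_eq:
  "toeplitz_pullback \<sigma> = {(T, S). T \<in> toeplitz \<and> S \<in> toeplitz \<and> compact_op (T - S)}"
  unfolding toeplitz_pullback_def compact_op_iff_symbol
  using star_hom_on_diff[OF symbol_hom cstar_subalgebra_toeplitz]
    cstar_subalgebra_diff[OF cstar_subalgebra_toeplitz] by auto

text \<open>That compactness passes to adjoints and is preserved by Toeplitz operators from the left is read
  off from the symbol map, whose kernel is a self-adjoint ideal.\<close>

lemma compact_op_star: "compact_op T \<Longrightarrow> compact_op (star T)"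
  using symbol_hom cstar_subalgebra_star[OF cstar_subalgebra_toeplitz]
  unfolding compact_op_iff_symbol star_hom_on_def by simp

lemma compact_op_mult_toeplitz: "compact_op T \<Longrightarrow> S \<in> toeplitz \<Longrightarrow> compact_op (S * T)"
  using symbol_hom cstar_subalgebra_mult[OF cstar_subalgebra_toeplitz]
  unfolding compact_op_iff_symbol star_hom_on_def by simp

lemma compact_op_add: "compact_op S \<Longrightarrow> compact_op T \<Longrightarrow> compact_op (S + T)"
  using symbol_hom cstar_subalgebra_add[OF cstar_subalgebra_toeplitz]
  unfolding compact_op_iff_symbol star_hom_on_def by simp

lemma compact_op_scaleC: "compact_op T \<Longrightarrow> compact_op (a *\<^sub>C T)"
  using symbol_hom cstar_subalgebra_scaleC[OF cstar_subalgebra_toeplitz]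
  unfolding compact_op_iff_symbol star_hom_on_def by simp

end

subsection \<open>Matrix units\<close>

lemma star_shift_power_basis:
  "star shift ^ i \<bullet>\<^sub>o ell2_basis n = (if i \<le> n then ell2_basis (n - i) else 0)"
proof (induction i)
  case (Suc i)
  show ?case
  proof (cases "i < n")
    case True
    then have "n - i = Suc (n - Suc i)" by simp
    with True Suc show ?thesis by (simp add: op_apply_simps star_shift_basis)
  next
    case False
    with Suc show ?thesis by (cases "i = n") (auto simp: op_apply_simps star_shift_basis)
  qed
qed (simp add: op_apply_simps)

lemma shift_power_basis: "shift ^ i \<bullet>\<^sub>o ell2_basis n = ell2_basis (n + i)"
  by (induction i) (simp_all add: op_apply_simps shift_basis)

lemma trunc_op_basis: "trunc_op N \<bullet>\<^sub>o ell2_basis n = (if n < N then ell2_basis n else 0)"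
  by (rule ell2_eqI) (simp add: trunc_op_apply ell2_nth_trunc ell2_basis.rep_eq)

lemma trunc_op_eq_sum: "trunc_op N = (\<Sum>i<N. shift ^ i * trunc_op 1 * star shift ^ i)"
proof (induction N)
  case 0
  show ?case by (rule op_eq_on_basis) (simp add: trunc_op_basis op_apply_simps)
next
  case (Suc N)
  have "trunc_op (Suc N) = trunc_op N + shift ^ N * trunc_op 1 * star shift ^ N"
    by (rule op_eq_on_basis)
      (auto simp: trunc_op_basis op_apply_simps star_shift_power_basis shift_power_basis
        less_Suc_eq)
  then show ?case by (simp add: Suc)
qed

text \<open>\<open>trunc_op 1\<close> is the rank-one projection onto the first basis vector.\<close>

lemma trunc_op_1_corner:
  "trunc_op 1 * T * trunc_op 1 = ell2_nth (T \<bullet>\<^sub>o ell2_basis 0) 0 *\<^sub>C trunc_op 1"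
proof (rule op_eq_on_basis)
  show "(trunc_op 1 * T * trunc_op 1) \<bullet>\<^sub>o ell2_basis n =
      (ell2_nth (T \<bullet>\<^sub>o ell2_basis 0) 0 *\<^sub>C trunc_op 1) \<bullet>\<^sub>o ell2_basis n" for n
  proof (cases "n = 0")
    case True
    have "ell2_trunc (Suc 0) (ell2_basis 0) = ell2_basis 0"
      by (rule ell2_eqI) (simp add: ell2_nth_trunc ell2_basis.rep_eq)
    with True show ?thesis
      by (intro ell2_eqI)
        (simp add: op_apply_simps op_apply_scaleC trunc_op_basis trunc_op_apply ell2_nth_trunc
          ell2_basis.rep_eq)
  qed (simp add: op_apply_simps op_apply_scaleC trunc_op_basis)
qed

text \<open>\<open>shift ^ i * trunc_op 1 * star shift ^ j\<close> is the matrix unit in position \<open>(i, j)\<close>. A compact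
  operator with compact adjoint is the norm limit of its two-sided truncations, which are finite
  combinations of matrix units.\<close>

lemma compact_op_in_closed_span:
  assumes F: "closed F" "\<And>S T. S \<in> F \<Longrightarrow> T \<in> F \<Longrightarrow> S + T \<in> F" "\<And>a T. T \<in> F \<Longrightarrow> a *\<^sub>C T \<in> F"
    and unit: "\<And>i j. shift ^ i * trunc_op 1 * star shift ^ j \<in> F"
    and T: "compact_op T" "compact_op (star T)"
  shows "T \<in> F"
proof -
  have "0 \<in> F" using F(3)[OF unit, of 0 0 0] by simp
  then have sum: "(\<Sum>i\<in>I. f i) \<in> F" if "\<And>i. i \<in> I \<Longrightarrow> f i \<in> F" for f and I :: "nat set"
    using that by (induction I rule: infinite_finite_induct) (auto intro: F(2))
  have entry: "shift ^ i * trunc_op 1 * star shift ^ i * T * (shift ^ j * trunc_op 1 * star shift ^ j) \<in> F"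
    for i j
  proof -
    have "shift ^ i * trunc_op 1 * star shift ^ i * T * (shift ^ j * trunc_op 1 * star shift ^ j) =
        shift ^ i * (trunc_op 1 * (star shift ^ i * T * shift ^ j) * trunc_op 1) * star shift ^ j"
      by (simp only: mult.assoc)
    also have "\<dots> = ell2_nth ((star shift ^ i * T * shift ^ j) \<bullet>\<^sub>o ell2_basis 0) 0 *\<^sub>C
        (shift ^ i * trunc_op 1 * star shift ^ j)"
      by (simp only: trunc_op_1_corner mult_scaleC_left mult_scaleC_right)
    finally show ?thesis by (simp only: F(3)[OF unit])
  qed
  have in_F: "trunc_op N * T * trunc_op N \<in> F" for N
    unfolding trunc_op_eq_sum[of N] sum_distrib_left sum_distrib_right by (intro sum entry)
  have left: "(\<lambda>N. trunc_op N * T) \<longlonglongrightarrow> T" and "(\<lambda>N. trunc_op N * star T) \<longlonglongrightarrow> star T"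
    using T by (simp_all add: compact_op_iff)
  then have "(\<lambda>N. norm (star (trunc_op N * star T - star T))) \<longlonglongrightarrow> 0"
    unfolding norm_star by (simp add: LIM_zero_iff tendsto_norm_zero_iff)
  \<comment> \<open>Taking adjoints turns left truncations of \<open>star T\<close> into right truncations of \<open>T\<close>.\<close>
  then have right: "(\<lambda>N. T * trunc_op N - T) \<longlonglongrightarrow> 0"
    by (simp add: star_diff star_mult star_star star_trunc_op tendsto_norm_zero_iff)
  have "(\<lambda>N. (trunc_op N * T - T) * trunc_op N) \<longlonglongrightarrow> 0"
  proof (rule Lim_null_comparison)
    show "(\<lambda>N. norm (trunc_op N * T - T)) \<longlonglongrightarrow> 0"
      using left by (simp add: LIM_zero_iff tendsto_norm_zero_iff)
    show "\<forall>\<^sub>F N in sequentially. norm ((trunc_op N * T - T) * trunc_op N) \<le> norm (trunc_op N * T - T)"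
      using order_trans[OF norm_mult_ineq mult_left_le[OF norm_trunc_op_le]] by simp
  qed
  from tendsto_add[OF tendsto_add[OF this right] tendsto_const[of T]]
  have "(\<lambda>N. trunc_op N * T * trunc_op N) \<longlonglongrightarrow> T"
    by (simp add: algebra_simps)
  then show ?thesis by (rule closed_sequentially[OF F(1) in_F])
qed

section \<open>Block diagonal operators\<close>

text \<open>Two isometries with orthogonal ranges that together span the space: the Hilbert space is
  written as a direct sum of two copies of itself, without leaving the type of operators on it.\<close>

locale orthogonal_splitting =
  fixes J K :: ell2_op
  assumes star_J_J: "star J * J = 1" and star_K_K: "star K * K = 1"
    and star_J_K: "star J * K = 0"
    and complete: "J * star J + K * star K = 1"
begin

definition block_op :: "ell2_op \<Rightarrow> ell2_op \<Rightarrow> ell2_op" where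
  "block_op T S = J * T * star J + K * S * star K"

lemma star_K_J: "star K * J = 0"
  using arg_cong[OF star_J_K, of star] by (simp add: star_mult star_star)

lemma splitting_cancel:
  "star J * (J * x) = x" "star K * (K * x) = x" "star J * (K * x) = 0" "star K * (J * x) = 0"
  by (simp_all add: mult.assoc[symmetric] star_J_J star_K_K star_J_K star_K_J)

lemma block_op_mult: "block_op T S * block_op T' S' = block_op (T * T') (S * S')"
  by (simp add: block_op_def distrib_left distrib_right mult.assoc splitting_cancel)

lemma block_op_add: "block_op T S + block_op T' S' = block_op (T + T') (S + S')"
  by (simp add: block_op_def distrib_left distrib_right)

lemma block_op_diff: "block_op T S - block_op T' S' = block_op (T - T') (S - S')"
  by (simp add: block_op_def algebra_simps)

lemma block_op_scaleC: "a *\<^sub>C block_op T S = block_op (a *\<^sub>C T) (a *\<^sub>C S)"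
  by (simp add: block_op_def scaleC_add_right mult_scaleC_left mult_scaleC_right)

lemma star_block_op: "star (block_op T S) = block_op (star T) (star S)"
  by (simp add: block_op_def star_add star_mult star_star mult.assoc)

lemma block_op_one: "block_op 1 1 = 1"
  using complete by (simp add: block_op_def)

lemma block_op_zero: "block_op 0 0 = 0"
  by (simp add: block_op_def)

lemma block_op_power: "block_op T S ^ n = block_op (T ^ n) (S ^ n)"
  by (induction n) (simp_all add: block_op_one block_op_mult)

text \<open>The blocks are recovered by compression, which is continuous; closed conditions on the blocks
  therefore give closed sets of block diagonal operators.\<close>

lemma compress_block_op:
  "star J * block_op T S * J = T" "star K * block_op T S * K = S"
  by (simp_all add: block_op_def distrib_left distrib_right mult.assoc splitting_cancel
      star_J_J star_K_K star_J_K star_K_J)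

lemma norm_isometry_le: "norm J \<le> 1" "norm K \<le> 1"
proof -
  have "norm (1::ell2_op) \<le> 1" by (rule norm_op_bound) (simp_all add: op_apply_simps)
  then have "(norm J)\<^sup>2 \<le> 1\<^sup>2" "(norm K)\<^sup>2 \<le> 1\<^sup>2"
    using cstar_identity[of J] cstar_identity[of K] by (simp_all add: star_J_J star_K_K)
  then show "norm J \<le> 1" "norm K \<le> 1" using power2_le_imp_le zero_le_one by blast+
qed

lemma norm_block_op_le: "norm (block_op T S) \<le> norm T + norm S"
proof -
  have *: "norm (U * R * star U) \<le> norm R" if "norm U \<le> 1" for U R :: ell2_op
    using norm_mult_ineq[of "U * R" "star U"] norm_mult_ineq[of U R] that
    by (smt (verit) mult_left_le mult_right_mono mult_left_le_one_le norm_ge_zero norm_star)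
  show ?thesis
    unfolding block_op_def
    by (rule norm_triangle_le) (intro add_mono * norm_isometry_le)
qed

lemma continuous_on_block_op [continuous_intros]:
  "continuous_on A f \<Longrightarrow> continuous_on A g \<Longrightarrow> continuous_on A (\<lambda>x. block_op (f x) (g x))"
  unfolding block_op_def by (intro continuous_intros)

end

section \<open>The algebra generated by a pair of weighted shifts\<close>

text \<open>The weights of the shift \<open>B\<close> as a function of the eigenvalue: the square root of
  \<open>B\<^sup>*B = (c + Q N)(1 - Q N)\<close>.\<close>

definition shift_gain :: "real \<Rightarrow> real \<Rightarrow> real \<Rightarrow> real" where
  "shift_gain c Q x = sqrt ((c + Q * x) * (1 - Q * x))"

lemma shift_gain_pos:
  assumes "0 < c" "0 < Q" "Q < 1" "x \<in> {-c..1}"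
  shows "0 < shift_gain c Q x"
proof -
  have "Q * x \<le> Q * 1" "Q * (- c) \<le> Q * x"
    using assms by (intro mult_left_mono; simp)+
  then have "Q * x \<le> Q" "- (Q * c) \<le> Q * x" by simp_all
  moreover have "Q * c < 1 * c" using assms by (intro mult_strict_right_mono) auto
  ultimately have "0 < c + Q * x" "0 < 1 - Q * x" using assms(3) by linarith+
  then show ?thesis by (simp add: shift_gain_def)
qed

lemma continuous_on_shift_gain: "continuous_on A (shift_gain c Q)"
  unfolding shift_gain_def by (intro continuous_intros)

lemma spectrum_points:
  assumes "0 < (c::real)" "0 < Q" "Q < 1"
  shows "Q ^ n \<in> {-c..1}" "- c * Q ^ n \<in> {-c..1}"
proof -
  have "0 \<le> Q ^ n" "Q ^ n \<le> 1" using assms by (auto intro: power_le_one)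
  moreover have "0 \<le> c * Q ^ n" "c * Q ^ n \<le> c"
    using assms calculation mult_left_le[of "Q ^ n" c] by auto
  ultimately show "Q ^ n \<in> {-c..1}" "- c * Q ^ n \<in> {-c..1}"
    using assms(1) unfolding mult_minus_left atLeastAtMost_iff by linarith+
qed

lemma Bseq_continuous_sample:
  fixes f :: "real \<Rightarrow> real"
  assumes "continuous_on {a..b} f" "\<And>n. p n \<in> {a..b}"
  shows "Bseq (\<lambda>n. complex_of_real (f (p n)))"
proof -
  have "bounded (f ` {a..b})"
    using assms(1) by (intro compact_imp_bounded compact_continuous_image) auto
  then obtain B where "\<forall>y\<in>f ` {a..b}. norm y \<le> B" unfolding bounded_iff by blast
  then have "\<bar>f x\<bar> \<le> B" if "x \<in> {a..b}" for x using that by auto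
  with assms(2) show ?thesis by (intro BseqI'[of _ B]) (simp only: norm_of_real)
qed

context orthogonal_splitting
begin

text \<open>Closedness is the point: membership is expressed through the compressions, which are
  continuous, and through the closed sets of Toeplitz and of compact operators.\<close>

lemma cstar_subalgebra_block_pullback:
  assumes \<sigma>: "symbol_map \<sigma>"
  shows "cstar_subalgebra {block_op T S |T S. (T, S) \<in> toeplitz_pullback \<sigma>}" (is "cstar_subalgebra ?P")
proof -
  note tp = cstar_subalgebraD[OF cstar_subalgebra_toeplitz]
  \<comment> \<open>\<open>R\<close> is block diagonal iff it is rebuilt from its own compressions.\<close>
  have compress: "?P = {R. R = block_op (star J * R * J) (star K * R * K)} \<inter>
      ((\<lambda>R. star J * R * J) -` toeplitz \<inter> ((\<lambda>R. star K * R * K) -` toeplitz \<inter>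
      (\<lambda>R. star J * R * J - star K * R * K) -` {T. compact_op T}))"
    unfolding toeplitz_pullback_eq[OF \<sigma>] by (auto simp: compress_block_op)
  have "closed {R. R = block_op (star J * R * J) (star K * R * K)}"
    by (intro closed_Collect_eq continuous_intros)
  then have "closed ?P"
    unfolding compress
    by (intro closed_Int closed_vimage tp(6) closed_compact_op continuous_intros)
  moreover have "0 \<in> ?P"
  proof -
    have "(0, 0) \<in> toeplitz_pullback \<sigma>" unfolding toeplitz_pullback_def using tp(1) by simp
    then show ?thesis using block_op_zero[symmetric] by blast
  qed
  moreover have "x + y \<in> ?P" if xy: "x \<in> ?P" "y \<in> ?P" for x y
  proof -
    obtain T S T' S' where *: "x = block_op T S" "y = block_op T' S'" "T \<in> toeplitz"
        "S \<in> toeplitz" "compact_op (T - S)" "T' \<in> toeplitz" "S' \<in> toeplitz" "compact_op (T' - S')"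
      using xy unfolding toeplitz_pullback_eq[OF \<sigma>] by blast
    have "(T + T') - (S + S') = (T - S) + (T' - S')" by simp
    then have "compact_op ((T + T') - (S + S'))"
      using * compact_op_add[OF \<sigma>] by metis
    then show ?thesis
      unfolding toeplitz_pullback_eq[OF \<sigma>] using * tp(2) block_op_add by blast
  qed
  moreover have "a *\<^sub>C x \<in> ?P" if "x \<in> ?P" for a x
  proof -
    obtain T S where *: "x = block_op T S" "T \<in> toeplitz" "S \<in> toeplitz" "compact_op (T - S)"
      using \<open>x \<in> ?P\<close> unfolding toeplitz_pullback_eq[OF \<sigma>] by blast
    have "a *\<^sub>C T - a *\<^sub>C S = a *\<^sub>C (T - S)"
      using scaleC_add_right[of a "T - S" S] by simp
    then have "compact_op (a *\<^sub>C T - a *\<^sub>C S)" using compact_op_scaleC[OF \<sigma> *(4)] by simp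
    then show ?thesis
      unfolding toeplitz_pullback_eq[OF \<sigma>] using * tp(3) block_op_scaleC by blast
  qed
  moreover have "x * y \<in> ?P" if xy: "x \<in> ?P" "y \<in> ?P" for x y
  proof -
    obtain T S T' S' where *: "x = block_op T S" "y = block_op T' S'" "T \<in> toeplitz"
        "S \<in> toeplitz" "compact_op (T - S)" "T' \<in> toeplitz" "S' \<in> toeplitz" "compact_op (T' - S')"
      using xy unfolding toeplitz_pullback_eq[OF \<sigma>] by blast
    have "T * T' - S * S' = T * (T' - S') + (T - S) * S'" by (simp add: algebra_simps)
    then have "compact_op (T * T' - S * S')"
      using * compact_op_add[OF \<sigma>] compact_op_mult_toeplitz[OF \<sigma>] compact_op_mult_right by metis
    then show ?thesis
      unfolding toeplitz_pullback_eq[OF \<sigma>] using * tp(4) block_op_mult by blast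
  qed
  moreover have "star x \<in> ?P" if "x \<in> ?P" for x
  proof -
    obtain T S where *: "x = block_op T S" "T \<in> toeplitz" "S \<in> toeplitz" "compact_op (T - S)"
      using \<open>x \<in> ?P\<close> unfolding toeplitz_pullback_eq[OF \<sigma>] by blast
    have "compact_op (star T - star S)" using compact_op_star[OF \<sigma> *(4)] by (simp add: star_diff)
    then show ?thesis
      unfolding toeplitz_pullback_eq[OF \<sigma>] using * tp(5) star_block_op by blast
  qed
  ultimately show ?thesis unfolding cstar_subalgebra_def by blast
qed

text \<open>The function \<open>f\<close> applied to the operator whose eigenvalues are \<open>Q\<^sup>n\<close> on the first summand and
  \<open>- c Q\<^sup>n\<close> on the second.\<close>

definition spectral_op :: "real \<Rightarrow> real \<Rightarrow> (real \<Rightarrow> real) \<Rightarrow> ell2_op" where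
  "spectral_op c Q f = block_op (diag_op (\<lambda>n. complex_of_real (f (Q ^ n))))
     (diag_op (\<lambda>n. complex_of_real (f (- c * Q ^ n))))"

end

text \<open>The normal form of the generators of a Podles sphere: on each summand \<open>A - c\<close> is diagonal and \<open>B\<close> is
  a weighted shift whose weights are a function of the eigenvalues of \<open>A - c\<close>.\<close>

locale podles_pair = orthogonal_splitting +
  fixes c Q :: real and A B :: ell2_op
  assumes c: "0 < c" and Q: "0 < Q" "Q < 1"
    and A: "A = c *\<^sub>R 1 + spectral_op c Q (\<lambda>x. x)"
    and B: "B = block_op shift shift * spectral_op c Q (shift_gain c Q)"
begin

abbreviation "functional_op \<equiv> spectral_op c Q"

lemma Bseq_spectrum:
  assumes "continuous_on {-c..1} f"
  shows "Bseq (\<lambda>n. complex_of_real (f (Q ^ n)))" "Bseq (\<lambda>n. complex_of_real (f (- c * Q ^ n)))"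
  by (rule Bseq_continuous_sample[OF assms], rule spectrum_points[OF c Q])+

lemma functional_op_mult:
  assumes "continuous_on {-c..1} f" "continuous_on {-c..1} g"
  shows "functional_op f * functional_op g = functional_op (\<lambda>x. f x * g x)"
  unfolding spectral_op_def block_op_mult of_real_mult
    diag_op_mult[OF Bseq_spectrum(1)[OF assms(1)] Bseq_spectrum(1)[OF assms(2)]]
    diag_op_mult[OF Bseq_spectrum(2)[OF assms(1)] Bseq_spectrum(2)[OF assms(2)]] ..

lemma functional_op_add:
  assumes "continuous_on {-c..1} f" "continuous_on {-c..1} g"
  shows "functional_op f + functional_op g = functional_op (\<lambda>x. f x + g x)"
  unfolding spectral_op_def block_op_add of_real_add
    diag_op_add[OF Bseq_spectrum(1)[OF assms(1)] Bseq_spectrum(1)[OF assms(2)]]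
    diag_op_add[OF Bseq_spectrum(2)[OF assms(1)] Bseq_spectrum(2)[OF assms(2)]] ..

lemma functional_op_scaleR:
  assumes "continuous_on {-c..1} f"
  shows "r *\<^sub>R functional_op f = functional_op (\<lambda>x. r * f x)"
  unfolding spectral_op_def scaleR_scaleC block_op_scaleC of_real_mult
    diag_op_scaleC[OF Bseq_spectrum(1)[OF assms]] diag_op_scaleC[OF Bseq_spectrum(2)[OF assms]] ..

lemma functional_op_const: "functional_op (\<lambda>_. r) = r *\<^sub>R 1"
  unfolding spectral_op_def diag_op_const block_op_scaleC[symmetric] block_op_one scaleR_scaleC ..

lemma functional_op_cong:
  assumes "\<And>x. x \<in> {-c..1} \<Longrightarrow> f x = g x"
  shows "functional_op f = functional_op g"
proof -
  have "f (Q ^ n) = g (Q ^ n)" "f (- c * Q ^ n) = g (- c * Q ^ n)" for n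
    by (rule assms, rule spectrum_points[OF c Q])+
  then show ?thesis by (simp only: spectral_op_def)
qed

lemma star_functional_op:
  assumes "continuous_on {-c..1} f"
  shows "star (functional_op f) = functional_op f"
  unfolding spectral_op_def star_block_op star_diag_op[OF Bseq_spectrum(1)[OF assms]]
    star_diag_op[OF Bseq_spectrum(2)[OF assms]] complex_cnj_complex_of_real ..

lemma norm_functional_op_diff_le:
  assumes "continuous_on {-c..1} f" "continuous_on {-c..1} g" "\<And>x. x \<in> {-c..1} \<Longrightarrow> \<bar>f x - g x\<bar> \<le> e"
  shows "norm (functional_op f - functional_op g) \<le> 2 * e"
proof -
  have le: "norm (diag_op (\<lambda>n. complex_of_real (f (p n)) - complex_of_real (g (p n)))) \<le> e"
    if "\<And>n. p n \<in> {-c..1}" for p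
    using assms(3)[OF that] by (intro norm_diag_op_le) (simp flip: of_real_diff)
  have "norm (diag_op (\<lambda>n. complex_of_real (f (Q ^ n)) - complex_of_real (g (Q ^ n)))) +
    norm (diag_op (\<lambda>n. complex_of_real (f (- c * Q ^ n)) - complex_of_real (g (- c * Q ^ n)))) \<le> e + e"
    by (intro add_mono le spectrum_points[OF c Q])
  then show ?thesis
    unfolding spectral_op_def block_op_diff
      diag_op_diff[OF Bseq_spectrum(1)[OF assms(1)] Bseq_spectrum(1)[OF assms(2)]]
      diag_op_diff[OF Bseq_spectrum(2)[OF assms(1)] Bseq_spectrum(2)[OF assms(2)]]
    by (intro order_trans[OF norm_block_op_le]) simp
qed

definition alg :: "ell2_op set" where
  "alg = cstar_generated {B, A}"

lemma cstar_subalgebra_alg: "cstar_subalgebra alg"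
  unfolding alg_def by (rule cstar_subalgebra_generated)

lemmas algD = cstar_subalgebraD[OF cstar_subalgebra_alg]
  cstar_subalgebra_diff[OF cstar_subalgebra_alg] cstar_subalgebra_scaleR[OF cstar_subalgebra_alg]

lemma generators_in_alg: "A \<in> alg" "B \<in> alg"
  unfolding alg_def using cstar_generated_superset by blast+

lemma star_shift_block: "star (block_op shift shift) * (block_op shift shift * x) = x"
  by (simp add: mult.assoc[symmetric] star_block_op block_op_mult star_shift_shift block_op_one)

lemma star_B_B: "star B * B = functional_op (\<lambda>x. (c + Q * x) * (1 - Q * x))"
proof -
  have "star B * B = functional_op (shift_gain c Q) * functional_op (shift_gain c Q)"
    unfolding B by (simp add: star_mult mult.assoc star_shift_block
        star_functional_op continuous_on_shift_gain)
  also have "\<dots> = functional_op (\<lambda>x. (c + Q * x) * (1 - Q * x))"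
    unfolding functional_op_mult[OF continuous_on_shift_gain continuous_on_shift_gain]
  proof (rule functional_op_cong)
    fix x assume "x \<in> {-c..1}"
    then have "0 < shift_gain c Q x" by (rule shift_gain_pos[OF c Q])
    then have "0 \<le> (c + Q * x) * (1 - Q * x)" by (simp add: shift_gain_def)
    then show "shift_gain c Q x * shift_gain c Q x = (c + Q * x) * (1 - Q * x)"
      by (simp add: shift_gain_def)
  qed
  finally show ?thesis .
qed

lemma A_functional: "A = functional_op (\<lambda>x. c + x)"
  unfolding A functional_op_const[symmetric] by (intro functional_op_add continuous_intros)

text \<open>The generated algebra is not unital by definition. But \<open>B\<^sup>*B\<close> is a polynomial in \<open>A\<close> with the
  nonzero constant term \<open>k\<close>, and its other terms lie in the algebra.\<close>

lemma one_in_alg: "1 \<in> alg"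
proof -
  \<comment> \<open>The value of \<open>(c + Q x) (1 - Q x)\<close> at \<open>x = - c\<close>, where \<open>A = c + x\<close> vanishes.\<close>
  define k where "k = c * (1 - Q) * (1 + Q * c)"
  have "0 < 1 + Q * c" using c Q by (simp add: add_pos_pos)
  then have k: "k \<noteq> 0" using c Q by (simp add: k_def)
  have "k *\<^sub>R 1 = functional_op (\<lambda>x. (c + Q * x) * (1 - Q * x) +
      ((- (Q * (1 + Q * c) - Q * c * (1 - Q))) * (c + x) + Q\<^sup>2 * ((c + x) * (c + x))))"
    unfolding functional_op_const[symmetric]
    by (intro functional_op_cong) (simp add: k_def power2_eq_square algebra_simps)
  also have "\<dots> = star B * B + ((- (Q * (1 + Q * c) - Q * c * (1 - Q))) *\<^sub>R A + Q\<^sup>2 *\<^sub>R (A * A))"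
    unfolding star_B_B unfolding A_functional
    by (subst functional_op_mult functional_op_scaleR functional_op_add,
        (intro continuous_intros)+)+ (rule refl)
  also have "\<dots> \<in> alg"
    by (intro algD generators_in_alg)
  finally have "(1/k) *\<^sub>R (k *\<^sub>R (1::ell2_op)) \<in> alg" by (rule algD)
  with k show ?thesis by simp
qed

text \<open>Uniform approximation on \<open>[-c, 1]\<close>, which contains all eigenvalues, by polynomials; the unit
  takes care of the constant terms.\<close>

lemma functional_op_in_alg:
  assumes f: "continuous_on {-c..1} f"
  shows "functional_op f \<in> alg"
proof -
  have id: "functional_op (\<lambda>x. x) \<in> alg"
    using algD(7)[OF generators_in_alg(1) algD(8)[OF one_in_alg, of c]] by (simp add: A)
  have continuous_real_polynomial: "continuous_on {-c..1} p" if "real_polynomial_function p" for p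
    using that by (simp add: continuous_on_polymonial_function real_polynomial_function_eq)
  have poly: "functional_op p \<in> alg" if "real_polynomial_function p" for p
    using that
  proof (induction rule: real_polynomial_function.induct)
    case (linear h)
    have "h = (\<lambda>x. h 1 * x)"
      using linear.hyps by (metis bounded_linear.linear linear_times_of_real mult.commute
          mult.right_neutral linear_scale real_scaleR_def)
    moreover have "functional_op (\<lambda>x. h 1 * x) \<in> alg"
      using algD(8)[OF id, of "h 1"] by (simp add: functional_op_scaleR)
    ultimately show ?case by simp
  next
    case (const r)
    show ?case unfolding functional_op_const by (intro algD one_in_alg)
  next
    case (add g h)
    then show ?case
      using algD(2)[of "functional_op g" "functional_op h"]
        functional_op_add[of g h, OF continuous_real_polynomial continuous_real_polynomial] by simp
  next
    case (mult g h)
    then show ?case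
      using algD(4)[of "functional_op g" "functional_op h"]
        functional_op_mult[of g h, OF continuous_real_polynomial continuous_real_polynomial] by simp
  qed
  have "functional_op f \<in> closure alg"
    unfolding closure_approachable
  proof (intro allI impI)
    fix e :: real assume e: "0 < e"
    obtain p where p: "real_polynomial_function p" "\<And>x. x \<in> {-c..1} \<Longrightarrow> \<bar>f x - p x\<bar> < e/4"
      using Stone_Weierstrass_real_polynomial_function[OF compact_Icc f, of "e/4"] e by auto
    have "continuous_on {-c..1} p"
      using p(1) by (rule continuous_real_polynomial)
    then have "norm (functional_op f - functional_op p) \<le> 2 * (e/4)"
      using p(2) f by (intro norm_functional_op_diff_le) (auto simp: less_imp_le)
    then have "dist (functional_op p) (functional_op f) < e"
      using e by (simp add: dist_norm norm_minus_commute)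
    with poly[OF p(1)] show "\<exists>y\<in>alg. dist y (functional_op f) < e" by blast
  qed
  then show ?thesis using algD(6) by (simp add: closure_closed)
qed

text \<open>The weights of \<open>B\<close> are bounded away from zero on \<open>[-c, 1]\<close>, hence can be divided out by a
  continuous function of the diagonal operator.\<close>

lemma block_shift_in_alg: "block_op shift shift \<in> alg"
proof -
  have inv: "continuous_on {-c..1} (\<lambda>x. 1 / shift_gain c Q x)"
    using shift_gain_pos[OF c Q] by (intro continuous_intros continuous_on_shift_gain) force
  have "functional_op (shift_gain c Q) * functional_op (\<lambda>x. 1 / shift_gain c Q x) =
      functional_op (\<lambda>_. 1)"
    unfolding functional_op_mult[OF continuous_on_shift_gain inv]
    using shift_gain_pos[OF c Q] by (intro functional_op_cong) force
  then have "block_op shift shift = B * functional_op (\<lambda>x. 1 / shift_gain c Q x)"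
    by (simp add: B mult.assoc functional_op_const)
  then show ?thesis by (simp add: algD generators_in_alg functional_op_in_alg inv)
qed

text \<open>The extreme eigenvalues \<open>1\<close> and \<open>-c\<close> are isolated and each belongs to a single block. The
  functions are piecewise linear, equal to \<open>1\<close> at one of these points and to \<open>0\<close> at all other
  eigenvalues.\<close>

lemma corner_in_alg: "block_op (trunc_op 1) 0 \<in> alg" "block_op 0 (trunc_op 1) \<in> alg"
proof -
  have pw: "Q ^ n \<le> Q" if "n \<noteq> 0" for n
    using that Q power_decreasing[of 1 n Q] by (simp add: Suc_le_eq)
  have pos: "0 < Q ^ n" for n using Q by simp
  have zero: "(0::ell2_op) = diag_op (\<lambda>_. 0)" by (simp add: diag_op_const)
  \<comment> \<open>The next eigenvalues towards zero are \<open>Q\<close> and \<open>- c Q\<close>.\<close>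
  let ?f = "\<lambda>x. max 0 ((x - Q) / (1 - Q))" and ?g = "\<lambda>x. max 0 ((- x - c * Q) / (c - c * Q))"
  have cQ: "c * Q < c" using mult_strict_left_mono[OF Q(2) c] by simp
  have f: "?f (Q ^ n) = (if n < 1 then 1 else 0)" "?f (- c * Q ^ n) = 0" for n
  proof -
    show "?f (Q ^ n) = (if n < 1 then 1 else 0)"
      using Q pw[of n] by (cases n) (auto simp: max_def divide_nonpos_pos field_simps)
    have "- c * Q ^ n \<le> 0" using c pos[of n] by simp
    then have "(- c * Q ^ n - Q) / (1 - Q) \<le> 0" using Q by (intro divide_nonpos_pos) linarith+
    then show "?f (- c * Q ^ n) = 0" by simp
  qed
  have g: "?g (- c * Q ^ n) = (if n < 1 then 1 else 0)" "?g (Q ^ n) = 0" for n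
  proof -
    have "(- (- c * Q ^ n) - c * Q) / (c - c * Q) \<le> 0" if "n \<noteq> 0"
      using mult_left_mono[OF pw[OF that], of c] c cQ by (intro divide_nonpos_pos) auto
    then show "?g (- c * Q ^ n) = (if n < 1 then 1 else 0)"
      using cQ c by (cases "n = 0") auto
    have "0 < c * Q" using c Q by simp
    then have "(- (Q ^ n) - c * Q) / (c - c * Q) \<le> 0"
      using pos[of n] cQ by (intro divide_nonpos_pos) linarith+
    then show "?g (Q ^ n) = 0" by simp
  qed
  have "block_op (trunc_op 1) 0 = functional_op ?f"
    unfolding spectral_op_def f trunc_op_def zero
    by (rule arg_cong2[where f = block_op]; rule arg_cong[where f = diag_op]) auto
  moreover have "block_op 0 (trunc_op 1) = functional_op ?g"
    unfolding spectral_op_def g trunc_op_def zero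
    by (rule arg_cong2[where f = block_op]; rule arg_cong[where f = diag_op]) auto
  moreover have "continuous_on {-c..1} ?f" "continuous_on {-c..1} ?g"
    using Q c cQ by (intro continuous_intros; simp)+
  ultimately show "block_op (trunc_op 1) 0 \<in> alg" "block_op 0 (trunc_op 1) \<in> alg"
    by (simp_all only: functional_op_in_alg)
qed

text \<open>The shift in both blocks moves the corner projection of a single block to all matrix units of
  that block.\<close>

lemma compact_block_in_alg:
  assumes T: "compact_op T" "compact_op (star T)"
  shows "block_op T 0 \<in> alg" "block_op 0 T \<in> alg"
proof -
  have V: "block_op (shift ^ i) (shift ^ i) \<in> alg" "block_op (star shift ^ j) (star shift ^ j) \<in> alg"
    for i j
    using cstar_subalgebra_power[OF cstar_subalgebra_alg block_shift_in_alg one_in_alg, of i]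
      cstar_subalgebra_power[OF cstar_subalgebra_alg algD(5)[OF block_shift_in_alg] one_in_alg, of j]
    by (simp_all add: block_op_power star_block_op)
  have "T \<in> (\<lambda>T. block_op T 0) -` alg"
  proof (rule compact_op_in_closed_span)
    show "closed ((\<lambda>T. block_op T 0) -` alg)"
      by (intro closed_vimage algD continuous_intros)
    show "S + T \<in> (\<lambda>T. block_op T 0) -` alg"
      if "S \<in> (\<lambda>T. block_op T 0) -` alg" "T \<in> (\<lambda>T. block_op T 0) -` alg" for S T
      using that algD(2)[of "block_op S 0" "block_op T 0"] by (simp add: block_op_add)
    show "a *\<^sub>C T \<in> (\<lambda>T. block_op T 0) -` alg" if "T \<in> (\<lambda>T. block_op T 0) -` alg" for a T
      using that algD(3)[of "block_op T 0" a] by (simp add: block_op_scaleC)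
    show "shift ^ i * trunc_op 1 * star shift ^ j \<in> (\<lambda>T. block_op T 0) -` alg" for i j
      using algD(4)[OF algD(4)[OF V(1) corner_in_alg(1)] V(2), of i j] by (simp add: block_op_mult)
  qed (use T in auto)
  then show "block_op T 0 \<in> alg" by simp
  have "T \<in> block_op 0 -` alg"
  proof (rule compact_op_in_closed_span)
    show "closed (block_op 0 -` alg)"
      by (intro closed_vimage algD continuous_intros)
    show "S + T \<in> block_op 0 -` alg" if "S \<in> block_op 0 -` alg" "T \<in> block_op 0 -` alg" for S T
      using that algD(2)[of "block_op 0 S" "block_op 0 T"] by (simp add: block_op_add)
    show "a *\<^sub>C T \<in> block_op 0 -` alg" if "T \<in> block_op 0 -` alg" for a T
      using that algD(3)[of "block_op 0 T" a] by (simp add: block_op_scaleC)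
    show "shift ^ i * trunc_op 1 * star shift ^ j \<in> block_op 0 -` alg" for i j
      using algD(4)[OF algD(4)[OF V(1) corner_in_alg(2)] V(2), of i j] by (simp add: block_op_mult)
  qed (use T in auto)
  then show "block_op 0 T \<in> alg" by simp
qed

lemma block_toeplitz_in_alg:
  assumes "T \<in> toeplitz"
  shows "block_op T T \<in> alg"
proof -
  have "cstar_subalgebra {T. block_op T T \<in> alg}"
    unfolding cstar_subalgebra_def
  proof (intro conjI ballI allI)
    have "closed ((\<lambda>T. block_op T T) -` alg)"
      by (intro closed_vimage algD continuous_intros)
    then show "closed {T. block_op T T \<in> alg}" by (simp add: vimage_def)
  qed (use algD(1-5) in \<open>auto simp: block_op_zero block_op_mult[symmetric] block_op_add[symmetric]
      block_op_scaleC[symmetric] star_block_op[symmetric]\<close>)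
  then have "toeplitz \<subseteq> {T. block_op T T \<in> alg}"
    unfolding toeplitz_def using block_shift_in_alg by (intro cstar_generated_least) auto
  with assms show ?thesis by blast
qed

text \<open>For continuous \<open>f\<close> the entries of both blocks of \<open>spectral_op c Q f\<close> tend to \<open>f 0\<close>. Both blocks
  are thus compact perturbations of the same scalar, and the shift occurs equally in both
  blocks of \<open>B\<close>. For the converse, \<open>T \<oplus> S = (S \<oplus> S) + ((T - S) \<oplus> 0)\<close>.\<close>

lemma alg_eq_block_pullback:
  assumes \<sigma>: "symbol_map \<sigma>"
  shows "alg = {block_op T S |T S. (T, S) \<in> toeplitz_pullback \<sigma>}" (is "alg = ?P")
proof
  note P = cstar_subalgebraD[OF cstar_subalgebra_block_pullback[OF \<sigma>]]
  have diag: "functional_op f \<in> ?P" if f: "continuous_on {-c..1} f" for f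
  proof -
    have lim: "(\<lambda>n. complex_of_real (f (r * Q ^ n)) - of_real (f 0)) \<longlonglongrightarrow> 0"
      if r: "\<And>n. r * Q ^ n \<in> {-c..1}" for r
    proof -
      have "(\<lambda>n. r * Q ^ n) \<longlonglongrightarrow> r * 0" using Q by (intro tendsto_intros LIMSEQ_realpow_zero) auto
      then have "(\<lambda>n. f (r * Q ^ n)) \<longlonglongrightarrow> f 0"
        using f r c by (intro continuous_on_tendsto_compose[OF f]) auto
      then have "(\<lambda>n. complex_of_real (f (r * Q ^ n))) \<longlonglongrightarrow> of_real (f 0)" by (rule tendsto_of_real)
      then show ?thesis by (simp add: LIM_zero_iff)
    qed
    define d where "d r = diag_op (\<lambda>n. complex_of_real (f (r * Q ^ n)))" for r
    have d: "compact_op (d r - complex_of_real (f 0) *\<^sub>C 1)" if r: "r = 1 \<or> r = - c" for r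
    proof -
      have pts: "\<And>n. r * Q ^ n \<in> {-c..1}" using spectrum_points[OF c Q] r by force
      then have "Bseq (\<lambda>n. complex_of_real (f (r * Q ^ n)))" by (rule Bseq_continuous_sample[OF f])
      then show ?thesis
        unfolding d_def diag_op_const[symmetric]
        using compact_op_diag_op[OF lim[OF pts]] by (simp add: diag_op_diff)
    qed
    have t: "d r \<in> toeplitz" if r: "r = 1 \<or> r = - c" for r
    proof -
      have "(d r - complex_of_real (f 0) *\<^sub>C 1) + complex_of_real (f 0) *\<^sub>C 1 \<in> toeplitz"
        using d[OF r] compact_op_iff_symbol[OF \<sigma>] one_in_toeplitz
        by (intro cstar_subalgebraD[OF cstar_subalgebra_toeplitz]) auto
      then show ?thesis by simp
    qed
    have eq: "d 1 - d (- c) = (d 1 - complex_of_real (f 0) *\<^sub>C 1) +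
        (-1) *\<^sub>C (d (- c) - complex_of_real (f 0) *\<^sub>C 1)"
      by (simp add: scaleC_minus1)
    have "compact_op (d 1 - d (- c))"
      unfolding eq
      using compact_op_add[OF \<sigma> d compact_op_scaleC[OF \<sigma> d], of 1 "- c" "-1"] by simp
    moreover have "functional_op f = block_op (d 1) (d (- c))" by (simp add: spectral_op_def d_def)
    ultimately show ?thesis unfolding toeplitz_pullback_eq[OF \<sigma>] using t by blast
  qed
  have "block_op shift shift \<in> ?P"
    unfolding toeplitz_pullback_def using shift_in_toeplitz by blast
  then have "B \<in> ?P"
    unfolding B by (intro P diag continuous_on_shift_gain)
  moreover have "A \<in> ?P" unfolding A_functional by (intro diag continuous_intros)
  ultimately show "alg \<subseteq> ?P"
    unfolding alg_def by (intro cstar_generated_least cstar_subalgebra_block_pullback \<sigma>) auto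
  show "?P \<subseteq> alg"
  proof clarify
    fix T S assume "(T, S) \<in> toeplitz_pullback \<sigma>"
    then have *: "T \<in> toeplitz" "S \<in> toeplitz" "compact_op (T - S)"
      by (auto simp: toeplitz_pullback_eq[OF \<sigma>])
    have "block_op T S = block_op S S + block_op (T - S) 0" by (simp add: block_op_add)
    also have "\<dots> \<in> alg"
      using * compact_op_star[OF \<sigma>] by (intro algD block_toeplitz_in_alg compact_block_in_alg) auto
    finally show "block_op T S \<in> alg" .
  qed
qed

lemma alg_isomorphic_pullback:
  assumes \<sigma>: "symbol_map \<sigma>"
  shows "alg \<cong>\<^sub>* toeplitz_pullback \<sigma>"
  unfolding cstar_isomorphic_def
proof (intro exI conjI)
  let ?\<phi> = "\<lambda>R. (star J * R * J, star K * R * K)"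
  have \<phi>: "?\<phi> (block_op T S) = (T, S)" for T S by (simp add: compress_block_op)
  show "star_hom_on alg ?\<phi>"
    unfolding star_hom_on_def alg_eq_block_pullback[OF \<sigma>]
    by (auto simp: block_op_add block_op_mult block_op_scaleC star_block_op compress_block_op
        times_prod_def scaleC_prod_def star_prod_def)
  show "bij_betw ?\<phi> alg (toeplitz_pullback \<sigma>)"
    unfolding alg_eq_block_pullback[OF \<sigma>]
    by (rule bij_betw_byWitness[where f' = "\<lambda>(T, S). block_op T S"]) (auto simp: compress_block_op)
qed

end

section \<open>Eigenvectors of compact self-adjoint operators\<close>

text \<open>Unit vectors of \<open>M\<close> that almost attain the norm \<open>r\<close> of the restriction are approximate
  eigenvectors of \<open>T\<^sup>2\<close> for \<open>r\<^sup>2\<close>. By compactness a subsequence converges to an eigenvector \<open>y\<close> of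
  \<open>T\<^sup>2\<close>, and the factorisation \<open>(T - r)(T + r) y = 0\<close> gives an eigenvector of \<open>T\<close>.\<close>

lemma compact_selfadjoint_maximal_eigenvector:
  assumes T: "compact_op T" "star T = T"
    and M: "closed M" "\<And>x y. x \<in> M \<Longrightarrow> y \<in> M \<Longrightarrow> x + y \<in> M" "\<And>r x. x \<in> M \<Longrightarrow> r *\<^sub>R x \<in> M"
    and inv: "\<And>x. x \<in> M \<Longrightarrow> T \<bullet>\<^sub>o x \<in> M"
    and x0: "x0 \<in> M" "T \<bullet>\<^sub>o x0 \<noteq> 0"
  obtains x \<mu> where "x \<in> M" "x \<noteq> 0" "T \<bullet>\<^sub>o x = \<mu> *\<^sub>R x" "\<mu> \<noteq> 0"
    "\<And>y. y \<in> M \<Longrightarrow> norm (T \<bullet>\<^sub>o y) \<le> \<bar>\<mu>\<bar> * norm y"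
proof -
  define U where "U = {x \<in> M. norm x = 1}"
  define r where "r = (SUP x\<in>U. norm (T \<bullet>\<^sub>o x))"
  have bdd: "bdd_above ((\<lambda>x. norm (T \<bullet>\<^sub>o x)) ` U)"
  proof (rule bdd_aboveI2)
    show "norm (T \<bullet>\<^sub>o x) \<le> norm T" if "x \<in> U" for x
      using norm_op[of T x] that by (simp add: U_def)
  qed
  have x0': "x0 \<noteq> 0" using x0(2) by auto
  then have "x0 /\<^sub>R norm x0 \<in> U" using x0(1) M(3) by (simp add: U_def)
  then have r_ge: "norm (T \<bullet>\<^sub>o (x0 /\<^sub>R norm x0)) \<le> r" and U: "U \<noteq> {}"
    unfolding r_def using bdd by (auto intro: cSUP_upper)
  have "0 < norm (T \<bullet>\<^sub>o (x0 /\<^sub>R norm x0))"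
    using x0' x0(2) by (simp add: blinfun.scaleR_right)
  with r_ge have r: "0 < r" by linarith
  have bound: "norm (T \<bullet>\<^sub>o y) \<le> r * norm y" if y: "y \<in> M" for y
  proof (cases "y = 0")
    case False
    then have "y /\<^sub>R norm y \<in> U" using y M(3) by (simp add: U_def)
    then have "norm (T \<bullet>\<^sub>o (y /\<^sub>R norm y)) \<le> r" unfolding r_def by (rule cSUP_upper[OF _ bdd])
    then show ?thesis using False by (simp add: blinfun.scaleR_right field_simps)
  qed simp
  have "\<exists>x\<in>U. r - 1 / Suc n < norm (T \<bullet>\<^sub>o x)" for n
    using less_cSUP_iff[OF U bdd, of "r - 1 / Suc n"] unfolding r_def[symmetric] by simp
  then obtain x where x: "\<And>n. x n \<in> U" "\<And>n. r - 1 / Suc n < norm (T \<bullet>\<^sub>o x n)" by metis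
  have lim_norm: "(\<lambda>n. norm (T \<bullet>\<^sub>o x n)) \<longlonglongrightarrow> r"
  proof (rule tendsto_sandwich)
    show "(\<lambda>n. r - 1 / Suc n) \<longlonglongrightarrow> r"
      using tendsto_diff[OF tendsto_const[of r] LIMSEQ_inverse_real_of_nat]
      by (simp add: inverse_eq_divide)
    show "\<forall>\<^sub>F n in sequentially. norm (T \<bullet>\<^sub>o x n) \<le> r"
    proof (intro always_eventually allI)
      show "norm (T \<bullet>\<^sub>o x n) \<le> r" for n
        using bound[of "x n"] x(1)[of n] by (simp add: U_def)
    qed
  qed (use x(2) in \<open>auto simp: less_imp_le\<close>)
  \<comment> \<open>The defect of \<open>x n\<close> as an eigenvector of \<open>T\<^sup>2\<close>.\<close>
  define d where "d n = T \<bullet>\<^sub>o T \<bullet>\<^sub>o x n - r\<^sup>2 *\<^sub>R x n" for n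
  have sym: "inner (T \<bullet>\<^sub>o y) z = inner y (T \<bullet>\<^sub>o z)" for y z
    using cinner_star_left[of T y z] T(2) by (simp add: inner_ell2_def)
  have d_le: "(norm (d n))\<^sup>2 \<le> r\<^sup>2 * (r\<^sup>2 - (norm (T \<bullet>\<^sub>o x n))\<^sup>2)" for n
  proof -
    have xn: "x n \<in> M" "inner (x n) (x n) = 1"
      using x(1)[of n] by (auto simp: U_def norm_eq_1)
    have "(norm (d n))\<^sup>2 = (norm (T \<bullet>\<^sub>o T \<bullet>\<^sub>o x n))\<^sup>2 - 2 * r\<^sup>2 * inner (T \<bullet>\<^sub>o T \<bullet>\<^sub>o x n) (x n) + r\<^sup>2 * r\<^sup>2"
      unfolding d_def power2_norm_eq_inner
      by (simp add: inner_diff_left inner_diff_right xn inner_commute algebra_simps)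
    also have "inner (T \<bullet>\<^sub>o T \<bullet>\<^sub>o x n) (x n) = (norm (T \<bullet>\<^sub>o x n))\<^sup>2"
      unfolding power2_norm_eq_inner by (rule sym)
    also have "(norm (T \<bullet>\<^sub>o T \<bullet>\<^sub>o x n))\<^sup>2 \<le> (r * norm (T \<bullet>\<^sub>o x n))\<^sup>2"
      by (intro power_mono bound inv xn) simp
    finally show ?thesis by (simp add: power_mult_distrib algebra_simps)
  qed
  have "(\<lambda>n. r\<^sup>2 * (r\<^sup>2 - (norm (T \<bullet>\<^sub>o x n))\<^sup>2)) \<longlonglongrightarrow> r\<^sup>2 * (r\<^sup>2 - r\<^sup>2)"
    by (intro tendsto_intros lim_norm)
  then have "(\<lambda>n. (norm (d n))\<^sup>2) \<longlonglongrightarrow> 0"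
    by (intro Lim_null_comparison[where f = "\<lambda>n. (norm (d n))\<^sup>2"]) (use d_le in auto)
  then have "(\<lambda>n. sqrt ((norm (d n))\<^sup>2)) \<longlonglongrightarrow> sqrt 0" by (rule tendsto_real_sqrt)
  then have d0: "d \<longlonglongrightarrow> 0" by (simp add: tendsto_norm_zero_iff)
  have "T \<bullet>\<^sub>o x n \<in> closure ((\<lambda>x. T \<bullet>\<^sub>o x) ` cball 0 1)" for n
    using x(1)[of n] by (intro subsetD[OF closure_subset]) (auto simp: U_def)
  then obtain z \<phi> where \<phi>: "strict_mono \<phi>" "((\<lambda>n. T \<bullet>\<^sub>o x n) \<circ> \<phi>) \<longlonglongrightarrow> z"
    using T(1) unfolding compact_op_def compact_def by metis
  have "(\<lambda>n. T \<bullet>\<^sub>o T \<bullet>\<^sub>o x (\<phi> n)) \<longlonglongrightarrow> T \<bullet>\<^sub>o z"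
    using \<phi>(2) unfolding comp_def by (intro blinfun.tendsto tendsto_const)
  then have "(\<lambda>n. (1 / r\<^sup>2) *\<^sub>R (T \<bullet>\<^sub>o T \<bullet>\<^sub>o x (\<phi> n) - d (\<phi> n))) \<longlonglongrightarrow> (1 / r\<^sup>2) *\<^sub>R (T \<bullet>\<^sub>o z - 0)"
    using LIMSEQ_subseq_LIMSEQ[OF d0 \<phi>(1)] unfolding comp_def
    by (intro tendsto_scaleR tendsto_const tendsto_diff)
  moreover define y where "y = (1 / r\<^sup>2) *\<^sub>R (T \<bullet>\<^sub>o z)"
  ultimately have lim: "(\<lambda>n. x (\<phi> n)) \<longlonglongrightarrow> y" using r by (simp add: d_def)
  then have "(\<lambda>n. T \<bullet>\<^sub>o x (\<phi> n)) \<longlonglongrightarrow> T \<bullet>\<^sub>o y" by (intro blinfun.tendsto tendsto_const)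
  then have "T \<bullet>\<^sub>o y = z" using \<phi>(2) LIMSEQ_unique unfolding comp_def by blast
  then have TT: "T \<bullet>\<^sub>o T \<bullet>\<^sub>o y = r\<^sup>2 *\<^sub>R y" using r by (simp add: y_def)
  have yM: "y \<in> M" using closed_sequentially[OF M(1) _ lim] x(1) by (simp add: U_def)
  have "(\<lambda>n. norm (x (\<phi> n))) \<longlonglongrightarrow> norm y" by (intro tendsto_norm lim)
  then have "norm y = 1" using x(1) by (simp add: U_def LIMSEQ_const_iff)
  then have y0: "y \<noteq> 0" by auto
  show ?thesis
  proof (cases "T \<bullet>\<^sub>o y + r *\<^sub>R y = 0")
    case True
    then have "T \<bullet>\<^sub>o y = (- r) *\<^sub>R y" by (simp add: eq_neg_iff_add_eq_0)
    with yM y0 r bound show ?thesis by (intro that[of y "- r"]) auto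
  next
    case False
    have "T \<bullet>\<^sub>o (T \<bullet>\<^sub>o y + r *\<^sub>R y) = r *\<^sub>R (T \<bullet>\<^sub>o y + r *\<^sub>R y)"
      by (simp add: blinfun.bilinear_simps TT scaleR_add_right power2_eq_square add.commute)
    with yM r bound False M(2,3) inv show ?thesis
      by (intro that[of "T \<bullet>\<^sub>o y + r *\<^sub>R y" r]) auto
  qed
qed

section \<open>Isometries from orthonormal sequences\<close>

lemma cinner_sum_right: "cinner x (\<Sum>i\<in>I. f i) = (\<Sum>i\<in>I. cinner x (f i))"
  by (induction I rule: infinite_finite_induct) (simp_all add: cinner_add_right)

lemma bessel_inequality:
  fixes v :: "nat \<Rightarrow> ell2"
  assumes v: "\<And>m n. cinner (v m) (v n) = (if m = n then 1 else 0)"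
  shows "(\<Sum>n<N. (cmod (cinner (v n) x))\<^sup>2) \<le> (norm x)\<^sup>2"
proof -
  define w where "w = (\<Sum>n<N. cinner (v n) x *\<^sub>C v n)"
  define s where "s = (\<Sum>n<N. (cmod (cinner (v n) x))\<^sup>2)"
  have s0: "0 \<le> s" by (simp add: s_def sum_nonneg)
  have cs: "complex_of_real s = (\<Sum>n<N. cnj (cinner (v n) x) * cinner (v n) x)"
    by (simp only: s_def of_real_sum complex_norm_square mult.commute)
  have vw: "cinner (v m) w = cinner (v m) x" if "m < N" for m
  proof -
    have "cinner (v m) w = (\<Sum>n<N. if n = m then cinner (v n) x else 0)"
      unfolding w_def cinner_sum_right by (intro sum.cong) (auto simp: cinner_scaleC_right v)
    with that show ?thesis by simp
  qed
  have "cinner w x = complex_of_real s"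
    unfolding cs by (simp add: w_def cinner_sum_left cinner_scaleC_left)
  then have "s = cmod (cinner w x)" using s0 by simp
  also have "\<dots> \<le> norm w * norm x" by (rule cinner_le_norm)
  finally have le: "s \<le> norm w * norm x" .
  have "cinner w w = complex_of_real s"
    unfolding cs by (subst (1) w_def) (simp add: cinner_sum_left cinner_scaleC_left vw)
  then have "(norm w)\<^sup>2 = s" unfolding cinner_norm of_real_eq_iff .
  then have nw: "norm w * norm w = s" by (simp add: power2_eq_square)
  have "norm w \<le> norm x"
  proof (cases "norm w = 0")
    case False
    then show ?thesis using le unfolding nw[symmetric] by (simp add: mult_le_cancel_left)
  qed simp
  then have "norm w * norm w \<le> norm x * norm x" by (intro mult_mono) auto
  then show ?thesis unfolding nw by (simp add: s_def power2_eq_square)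
qed

text \<open>The adjoint is constructed first: it sends \<open>x\<close> to its coefficient sequence, which is
  square-summable by Bessel.\<close>

lemma isometry_of_orthonormal:
  assumes v: "\<And>m n. cinner (v m) (v n) = (if m = n then 1 else 0)"
  obtains J where "\<And>n. J \<bullet>\<^sub>o ell2_basis n = v n" "star J * J = 1"
proof -
  define f where "f x = Abs_ell2 (\<lambda>n. cinner (v n) x)" for x
  have f: "ell2_nth (f x) = (\<lambda>n. cinner (v n) x)" for x
    unfolding f_def using ell2_bounded_sums[OF bessel_inequality[OF v, where x = x]]
    by (simp add: Abs_ell2_inverse)
  obtain L where L: "\<And>x. L \<bullet>\<^sub>o x = f x"
  proof (rule op_exI)
    show "f (x + y) = f x + f y" for x y by (rule ell2_eqI) (simp add: f cinner_add_right)
    show "f (a *\<^sub>C x) = a *\<^sub>C f x" for a x by (rule ell2_eqI) (simp add: f cinner_scaleC_right)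
    show "norm (f x) \<le> 1 * norm x" for x
      by (rule norm_ell2_bound) (simp_all add: f bessel_inequality[OF v])
  qed blast
  have J: "star L \<bullet>\<^sub>o ell2_basis n = v n" for n
  proof (rule cinner_eqI)
    show "cinner (star L \<bullet>\<^sub>o ell2_basis n) z = cinner (v n) z" for z
      by (simp add: cinner_star_left L f)
  qed
  have "L * star L = 1"
    by (rule op_eq_on_basis, rule ell2_eqI) (auto simp: op_apply_simps J L f v ell2_basis.rep_eq)
  with J show ?thesis by (intro that[of "star L"]) (simp_all add: star_star)
qed

section \<open>Relations between the generators\<close>

locale nonstandard_line =
  fixes q c :: real
  assumes q: "1 < q" and c: "0 < c"
begin

text \<open>Subtracting \<open>c\<close> moves the accumulation point of the spectrum of \<open>X\<^sub>1\<^sup>*X\<^sub>1\<close> to zero, which makes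
  the operator compact; in the canonical basis it is a Jacobi matrix.\<close>

definition jacobi_op :: ell2_op where
  "jacobi_op = star (X1 q c) * X1 q c - c *\<^sub>R 1"

text \<open>This operator raises the index of the eigenvectors of \<open>jacobi_op\<close>.\<close>

definition raising_op :: ell2_op where
  "raising_op = star (X1 q c) * X2 q c"

lemma q0: "q \<noteq> 0" "0 < inverse q" "inverse q < 1"
  using q by (auto simp: inverse_less_1_iff)

lemma Q: "0 < (inverse q)\<^sup>2" "(inverse q)\<^sup>2 < 1"
  using q0 by (auto simp: power_less_one_iff simp del: power_inverse)

lemma gap_pos: "0 < 1 - inverse q ^ (2 * Suc n)"
  using q0 power_less_one_iff[of "inverse q" "2 * Suc n"] by simp

lemma Bseq_gamma: "Bseq (\<lambda>n. complex_of_real (inverse q ^ n))"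
proof (rule BseqI')
  show "norm (complex_of_real (inverse q ^ n)) \<le> 1" for n
    using q0 power_le_one[of "inverse q" n] unfolding norm_of_real by simp
qed

lemma gamma_diag: "gamma q = diag_op (\<lambda>n. complex_of_real (inverse q ^ n))"
  by (rule diag_op_unique[OF Bseq_gamma]) (simp add: gamma_basis[OF q] scaleR_ell2_def)

lemma star_gamma: "star (gamma q) = gamma q"
  using star_diag_op[OF Bseq_gamma] unfolding gamma_diag complex_cnj_complex_of_real .

lemma star_alpha_basis:
  "star (alpha q) \<bullet>\<^sub>o ell2_basis n = sqrt (1 - inverse q ^ (2 * Suc n)) *\<^sub>R ell2_basis (Suc n)"
proof (rule ell2_eqI)
  show "ell2_nth (star (alpha q) \<bullet>\<^sub>o ell2_basis n) k =
      ell2_nth (sqrt (1 - inverse q ^ (2 * Suc n)) *\<^sub>R ell2_basis (Suc n)) k" for k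
  proof (cases k)
    case 0
    then show ?thesis
      by (simp add: star_op_nth alpha_basis_0[OF q] scaleR_ell2_def ell2_basis.rep_eq)
  next
    case (Suc m)
    then show ?thesis
      by (simp add: star_op_nth alpha_basis[OF q] scaleR_ell2_def cinner_scaleC_left
          ell2_basis.rep_eq del: power_inverse)
  qed
qed

lemma alpha_basis_Suc:
  "alpha q \<bullet>\<^sub>o ell2_basis (Suc n) = sqrt (1 - inverse q ^ (2 * Suc n)) *\<^sub>R ell2_basis n"
  using alpha_basis[OF q, of "Suc n"] by simp

lemma gamma_alpha: "gamma q * alpha q = q *\<^sub>R (alpha q * gamma q)"
proof (rule op_eq_on_basis)
  show "(gamma q * alpha q) \<bullet>\<^sub>o ell2_basis n = (q *\<^sub>R (alpha q * gamma q)) \<bullet>\<^sub>o ell2_basis n" for n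
    using q0(1) by (cases n)
      (simp_all add: op_apply_simps alpha_basis_0[OF q] alpha_basis_Suc gamma_basis[OF q]
        blinfun.scaleR_right)
qed

lemma star_alpha_gamma: "star (alpha q) * gamma q = q *\<^sub>R (gamma q * star (alpha q))"
  using arg_cong[OF gamma_alpha, of star] by (simp add: star_mult star_scaleR star_gamma)

lemma star_alpha_alpha: "star (alpha q) * alpha q = 1 - gamma q * gamma q"
proof (rule op_eq_on_basis)
  show "(star (alpha q) * alpha q) \<bullet>\<^sub>o ell2_basis n = (1 - gamma q * gamma q) \<bullet>\<^sub>o ell2_basis n" for n
  proof (cases n)
    case (Suc m)
    have "sqrt (1 - inverse q ^ (2 * Suc m)) * sqrt (1 - inverse q ^ (2 * Suc m)) =
        1 - inverse q ^ (2 * Suc m)"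
      using gap_pos[of m] by simp
    moreover have "inverse q ^ (2 * Suc m) = inverse q ^ Suc m * inverse q ^ Suc m"
      by (simp add: mult_2 power_add del: power_inverse)
    ultimately show ?thesis
      unfolding Suc op_apply_simps alpha_basis_Suc star_alpha_basis gamma_basis[OF q]
        blinfun.scaleR_right scaleR_scaleR
      by (simp only: scaleR_diff_left scaleR_one)
  qed (simp add: op_apply_simps alpha_basis_0[OF q] gamma_basis[OF q])
qed

lemma alpha_star_alpha: "alpha q * star (alpha q) = 1 - (inverse q)\<^sup>2 *\<^sub>R (gamma q * gamma q)"
proof (rule op_eq_on_basis)
  fix n
  have "sqrt (1 - inverse q ^ (2 * Suc n)) * sqrt (1 - inverse q ^ (2 * Suc n)) =
      1 - inverse q ^ (2 * Suc n)"
    using gap_pos[of n] by simp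
  moreover have "inverse q ^ (2 * Suc n) = (inverse q)\<^sup>2 * (inverse q ^ n * inverse q ^ n)"
    by (simp add: mult_2 power_add power2_eq_square del: power_inverse)
  ultimately show "(alpha q * star (alpha q)) \<bullet>\<^sub>o ell2_basis n =
      (1 - (inverse q)\<^sup>2 *\<^sub>R (gamma q * gamma q)) \<bullet>\<^sub>o ell2_basis n"
    unfolding op_apply_simps alpha_basis_Suc star_alpha_basis gamma_basis[OF q]
      blinfun.scaleR_right scaleR_scaleR
    by (simp only: scaleR_diff_left scaleR_one)
qed

lemma sqrt_c: "sqrt c * sqrt c = c" "sqrt c * (sqrt c * x) = c * x"
  using c by (simp_all add: mult.assoc[symmetric])

lemma abs_c: "\<bar>c\<bar> = c"
  using c by simp

lemma X1_X1: "star (X1 q c) * X1 q c = c *\<^sub>R (star (alpha q) * alpha q) +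
    sqrt c *\<^sub>R (star (alpha q) * gamma q + gamma q * alpha q) + gamma q * gamma q"
  by (simp add: X1_def star_add star_scaleR star_gamma sqrt_c abs_c scaleR_add_right distrib_left
      distrib_right add_ac)

lemma jacobi_op_eq: "jacobi_op = (1 - c) *\<^sub>R (gamma q * gamma q) +
    sqrt c *\<^sub>R (star (alpha q) * gamma q + gamma q * alpha q)"
  unfolding jacobi_op_def X1_X1 star_alpha_alpha
  by (simp add: scaleR_diff_right scaleR_diff_left)

text \<open>The off-diagonal terms cancel because of \<open>gamma_alpha\<close> and its adjoint. This is the unitarity of
  the quantum matrix \<open>(u\<^sub>i\<^sub>j)\<close>.\<close>

lemma X_column: "X1 q c * star (X1 q c) + X2 q c * star (X2 q c) = (1 + c) *\<^sub>R 1"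
proof -
  have "X1 q c * star (X1 q c) = c *\<^sub>R (alpha q * star (alpha q)) +
    sqrt c *\<^sub>R (alpha q * gamma q + gamma q * star (alpha q)) + gamma q * gamma q"
    by (simp add: X1_def star_add star_scaleR star_gamma sqrt_c abs_c scaleR_add_right distrib_left
        distrib_right add_ac)
  moreover have "X2 q c * star (X2 q c) = ((inverse q)\<^sup>2 * c) *\<^sub>R (gamma q * gamma q) -
    (inverse q * sqrt c) *\<^sub>R (gamma q * alpha q + star (alpha q) * gamma q) + star (alpha q) * alpha q"
    by (simp add: X2_def star_add star_diff star_minus star_star star_scaleR star_gamma sqrt_c abs_c q0(1)
        algebra_simps power2_eq_square)
  moreover have "(inverse q * sqrt c) *\<^sub>R (gamma q * alpha q + star (alpha q) * gamma q) =
      sqrt c *\<^sub>R (alpha q * gamma q + gamma q * star (alpha q))"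
  proof -
    have "inverse q * sqrt c * q = sqrt c" using q0(1) by simp
    then show ?thesis
      by (simp only: gamma_alpha star_alpha_gamma scaleR_add_right scaleR_scaleR)
  qed
  ultimately show ?thesis
    by (simp add: star_alpha_alpha alpha_star_alpha scaleR_diff_right scaleR_add_left mult.commute)
qed

lemma X2_X2: "star (X2 q c) * X2 q c =
    (1 + (inverse q)\<^sup>2 * c) *\<^sub>R 1 - (inverse q)\<^sup>2 *\<^sub>R (star (X1 q c) * X1 q c)"
proof -
  have "star (X2 q c) * X2 q c = ((inverse q)\<^sup>2 * c) *\<^sub>R (gamma q * gamma q) -
    (inverse q * sqrt c) *\<^sub>R (gamma q * star (alpha q) + alpha q * gamma q) + alpha q * star (alpha q)"
    by (simp add: X2_def star_add star_diff star_minus star_star star_scaleR star_gamma sqrt_c abs_c q0(1)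
        algebra_simps power2_eq_square)
  moreover have "(inverse q * sqrt c) *\<^sub>R (gamma q * star (alpha q) + alpha q * gamma q) =
      ((inverse q)\<^sup>2 * sqrt c) *\<^sub>R (star (alpha q) * gamma q + gamma q * alpha q)"
  proof -
    have "(inverse q)\<^sup>2 * sqrt c * q = inverse q * sqrt c"
      using q0(1) by (simp add: power2_eq_square)
    then show ?thesis
      by (simp only: gamma_alpha star_alpha_gamma scaleR_add_right scaleR_scaleR)
  qed
  ultimately show ?thesis
    unfolding X1_X1 star_alpha_alpha alpha_star_alpha
    by (simp add: scaleR_diff_right scaleR_add_right scaleR_add_left mult.commute)
qed

lemma X1_X1_jacobi: "star (X1 q c) * X1 q c = c *\<^sub>R 1 + jacobi_op"
  by (simp add: jacobi_op_def)

text \<open>Both diagonal products \<open>X\<^sub>i\<^sup>*X\<^sub>i\<close> are affine in the same operator; therefore products of \<open>B\<close> with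
  its adjoint become polynomials in it.\<close>

lemma X2_X2_jacobi: "star (X2 q c) * X2 q c = 1 - (inverse q)\<^sup>2 *\<^sub>R jacobi_op"
  unfolding X2_X2 X1_X1_jacobi by (simp add: scaleR_add_right scaleR_add_left del: power_inverse)

lemma star_jacobi_op: "star jacobi_op = jacobi_op"
  by (simp add: jacobi_op_def star_diff star_mult star_star star_scaleR star_one)

lemma X_column_swap:
  "X1 q c * star (X1 q c) = (1 + c) *\<^sub>R 1 - X2 q c * star (X2 q c)"
  "X2 q c * star (X2 q c) = (1 + c) *\<^sub>R 1 - X1 q c * star (X1 q c)"
  using X_column by (simp_all add: eq_diff_eq add.commute)

text \<open>The product \<open>X\<^sub>1X\<^sub>1\<^sup>*\<close> between the outer factors is replaced by \<open>1 + c - X\<^sub>2X\<^sub>2\<^sup>*\<close>. The same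
  substitution, or its mirror image, yields the next two relations.\<close>

lemma jacobi_raising: "jacobi_op * raising_op = (inverse q)\<^sup>2 *\<^sub>R (raising_op * jacobi_op)"
proof -
  have "(c *\<^sub>R 1 + jacobi_op) * raising_op = star (X1 q c) * (X1 q c * star (X1 q c)) * X2 q c"
    unfolding X1_X1_jacobi[symmetric] raising_op_def by (simp only: mult.assoc)
  also have "\<dots> = (1 + c) *\<^sub>R raising_op - raising_op * (star (X2 q c) * X2 q c)"
    unfolding X_column_swap(1) raising_op_def by (simp add: algebra_simps)
  also have "\<dots> = c *\<^sub>R raising_op + (inverse q)\<^sup>2 *\<^sub>R (raising_op * jacobi_op)"
    unfolding X2_X2_jacobi by (simp add: algebra_simps)
  finally show ?thesis by (simp add: distrib_right)
qed

lemma star_raising_raising: "star raising_op * raising_op =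
    (c *\<^sub>R 1 + (inverse q)\<^sup>2 *\<^sub>R jacobi_op) * (1 - (inverse q)\<^sup>2 *\<^sub>R jacobi_op)"
proof -
  have "star raising_op * raising_op = star (X2 q c) * (X1 q c * star (X1 q c)) * X2 q c"
    unfolding raising_op_def by (simp only: mult.assoc star_mult star_star)
  also have "\<dots> = (1 + c) *\<^sub>R (star (X2 q c) * X2 q c) -
      (star (X2 q c) * X2 q c) * (star (X2 q c) * X2 q c)"
    unfolding X_column_swap(1) by (simp add: algebra_simps)
  also have "\<dots> = (c *\<^sub>R 1 + (inverse q)\<^sup>2 *\<^sub>R jacobi_op) * (1 - (inverse q)\<^sup>2 *\<^sub>R jacobi_op)"
    unfolding X2_X2_jacobi by (simp add: algebra_simps)
  finally show ?thesis .
qed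

lemma raising_star_raising: "raising_op * star raising_op = (c *\<^sub>R 1 + jacobi_op) * (1 - jacobi_op)"
proof -
  have "raising_op * star raising_op = star (X1 q c) * (X2 q c * star (X2 q c)) * X1 q c"
    unfolding raising_op_def by (simp only: mult.assoc star_mult star_star)
  also have "\<dots> = (1 + c) *\<^sub>R (star (X1 q c) * X1 q c) -
      (star (X1 q c) * X1 q c) * (star (X1 q c) * X1 q c)"
    unfolding X_column_swap(2) by (simp add: algebra_simps)
  also have "\<dots> = (c *\<^sub>R 1 + jacobi_op) * (1 - jacobi_op)"
    unfolding X1_X1_jacobi by (simp add: algebra_simps)
  finally show ?thesis .
qed

text \<open>The compact operator \<open>gamma q\<close> can be factored out on the left.\<close>

lemma compact_jacobi_op: "compact_op jacobi_op"
proof -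
  have "(\<lambda>n. complex_of_real (inverse q ^ n)) \<longlonglongrightarrow> of_real 0"
    using q0 by (intro tendsto_of_real LIMSEQ_realpow_zero) auto
  then have "compact_op (gamma q)" unfolding gamma_diag by (intro compact_op_diag_op) simp
  moreover have "jacobi_op = gamma q * ((1 - c) *\<^sub>R gamma q + sqrt c *\<^sub>R (q *\<^sub>R star (alpha q) + alpha q))"
    unfolding jacobi_op_eq star_alpha_gamma by (simp add: distrib_left scaleR_add_right)
  ultimately show ?thesis by (simp only: compact_op_mult_right)
qed

end

context nonstandard_line
begin

section \<open>Eigenvectors of the Jacobi operator\<close>

lemma cinner_jacobi_op: "cinner (jacobi_op \<bullet>\<^sub>o x) y = cinner x (jacobi_op \<bullet>\<^sub>o y)"
  using cinner_star_left[of jacobi_op x y] by (simp add: star_jacobi_op)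

lemma jacobi_op_basis:
  "jacobi_op \<bullet>\<^sub>o ell2_basis n = ((1 - c) * (inverse q ^ n * inverse q ^ n)) *\<^sub>R ell2_basis n +
     (sqrt c * (inverse q ^ n * sqrt (1 - inverse q ^ (2 * Suc n)))) *\<^sub>R ell2_basis (Suc n) +
     (case n of 0 \<Rightarrow> 0 | Suc m \<Rightarrow>
        (sqrt c * (sqrt (1 - inverse q ^ (2 * Suc m)) * inverse q ^ m)) *\<^sub>R ell2_basis m)"
  unfolding jacobi_op_eq
  by (cases n) (simp_all add: op_apply_simps gamma_basis[OF q] alpha_basis_0[OF q] alpha_basis_Suc
      star_alpha_basis blinfun.scaleR_right scaleR_add_right
      del: power_inverse power_Suc mult_Suc_right)

text \<open>The eigenvalue equation is a three-term recurrence with nonzero coefficients at the next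
  index, so the first coordinate determines all others.\<close>

lemma jacobi_eigenvector_determined:
  assumes x: "jacobi_op \<bullet>\<^sub>o x = \<mu> *\<^sub>R x" "ell2_nth x 0 = 0"
  shows "x = 0"
proof -
  have "\<forall>m\<le>n. ell2_nth x m = 0" for n
  proof (induction n)
    case 0
    then show ?case using x(2) by simp
  next
    case (Suc n)
    have "cinner (jacobi_op \<bullet>\<^sub>o ell2_basis n) x = \<mu> * ell2_nth x n"
      unfolding cinner_jacobi_op x(1) by (simp add: scaleR_ell2_def)
    also have "\<dots> = 0" using Suc by simp
    finally have "(sqrt c * (inverse q ^ n * sqrt (1 - inverse q ^ (2 * Suc n)))) *
        ell2_nth x (Suc n) = 0"
      using Suc unfolding jacobi_op_basis
      by (cases n) (simp_all add: cinner_add_left scaleR_ell2_def cinner_scaleC_left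
          del: power_inverse power_Suc mult_Suc_right mult_eq_0_iff)
    moreover have "sqrt c * (inverse q ^ n * sqrt (1 - inverse q ^ (2 * Suc n))) \<noteq> 0"
      using c q0 gap_pos[of n] by simp
    ultimately have "ell2_nth x (Suc n) = 0"
      by (metis mult_eq_0_iff of_real_eq_0_iff)
    with Suc show ?case by (simp add: le_Suc_eq)
  qed
  then show ?thesis by (intro ell2_eqI) auto
qed

lemma jacobi_eigenspace_simple:
  assumes x: "jacobi_op \<bullet>\<^sub>o x = \<mu> *\<^sub>R x" and y: "jacobi_op \<bullet>\<^sub>o y = \<mu> *\<^sub>R y" and "x \<noteq> 0"
  shows "y = (ell2_nth y 0 / ell2_nth x 0) *\<^sub>C x"
proof -
  have x0: "ell2_nth x 0 \<noteq> 0" using jacobi_eigenvector_determined[OF x] \<open>x \<noteq> 0\<close> by blast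
  let ?d = "y - (ell2_nth y 0 / ell2_nth x 0) *\<^sub>C x"
  have "jacobi_op \<bullet>\<^sub>o ?d = \<mu> *\<^sub>R ?d"
    by (simp add: blinfun.diff_right x y scaleR_diff_right)
      (simp add: scaleR_ell2_def scaleC_scaleC mult.commute)
  then have "?d = 0"
    by (rule jacobi_eigenvector_determined) (simp add: x0)
  then show ?thesis by simp
qed

lemma norm_raising_op:
  assumes "jacobi_op \<bullet>\<^sub>o x = \<mu> *\<^sub>R x"
  shows "(norm (raising_op \<bullet>\<^sub>o x))\<^sup>2 = (c + (inverse q)\<^sup>2 * \<mu>) * (1 - (inverse q)\<^sup>2 * \<mu>) * (norm x)\<^sup>2"
proof -
  have "(star raising_op * raising_op) \<bullet>\<^sub>o x =
      ((c + (inverse q)\<^sup>2 * \<mu>) * (1 - (inverse q)\<^sup>2 * \<mu>)) *\<^sub>R x"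
    unfolding star_raising_raising
    by (simp add: op_apply_simps assms blinfun.bilinear_simps algebra_simps del: power_inverse)
  moreover have "(norm (raising_op \<bullet>\<^sub>o x))\<^sup>2 = Re (cinner ((star raising_op * raising_op) \<bullet>\<^sub>o x) x)"
    by (simp add: op_apply_simps cinner_star_left cinner_norm)
  moreover have "Re (cinner (k *\<^sub>R x) x) = k * (norm x)\<^sup>2" for k
    by (simp add: scaleR_ell2_def cinner_scaleC_left cinner_norm)
  ultimately show ?thesis by (simp only:)
qed

text \<open>The first basis vector is a coherent state: a common eigenvector of the two factors
  \<open>X\<^sub>1\<close> and \<open>X\<^sub>2\<^sup>*\<close> of \<open>B\<^sup>*\<close>.\<close>

lemma star_raising_basis_0:
  "star raising_op \<bullet>\<^sub>o ell2_basis 0 = (- (inverse q * sqrt c)) *\<^sub>R ell2_basis 0"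
  unfolding raising_op_def X1_def X2_def
  by (simp add: star_mult star_star star_add star_minus star_diff star_scaleR star_gamma op_apply_simps
      gamma_basis[OF q] alpha_basis_0[OF q])

text \<open>The kernel is invariant under \<open>B\<close> and at most one-dimensional, so \<open>B x = u x\<close>. On the kernel
  \<open>B\<^sup>*B = c\<close>, whence \<open>|u|\<^sup>2 = c\<close>; pairing with the first basis vector gives
  \<open>|u|\<^sup>2 = c / q\<^sup>2\<close> instead.\<close>

lemma jacobi_op_injective:
  assumes "jacobi_op \<bullet>\<^sub>o x = 0"
  shows "x = 0"
proof (rule ccontr)
  assume x0: "x \<noteq> 0"
  have x: "jacobi_op \<bullet>\<^sub>o x = 0 *\<^sub>R x" using assms by simp
  define u where "u = ell2_nth (raising_op \<bullet>\<^sub>o x) 0 / ell2_nth x 0"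
  have "(jacobi_op * raising_op) \<bullet>\<^sub>o x = 0"
    unfolding jacobi_raising by (simp add: op_apply_simps assms)
  then have "jacobi_op \<bullet>\<^sub>o raising_op \<bullet>\<^sub>o x = 0 *\<^sub>R (raising_op \<bullet>\<^sub>o x)" by (simp add: op_apply_simps)
  from jacobi_eigenspace_simple[OF x this x0]
  have "raising_op \<bullet>\<^sub>o x = u *\<^sub>C x" by (simp add: u_def)
  then have "(cmod u)\<^sup>2 * (norm x)\<^sup>2 = c * (norm x)\<^sup>2"
    using norm_raising_op[OF x] by (simp add: power_mult_distrib)
  then have u: "(cmod u)\<^sup>2 = c" using x0 by simp
  have "ell2_nth (raising_op \<bullet>\<^sub>o x) 0 = - (inverse q * sqrt c) * ell2_nth x 0"
    unfolding op_nth star_raising_basis_0 by (simp add: scaleR_ell2_def cinner_scaleC_left)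
  moreover have "ell2_nth x 0 \<noteq> 0" using jacobi_eigenvector_determined[OF x] x0 by blast
  ultimately have "u = - complex_of_real (inverse q * sqrt c)" by (simp add: u_def)
  then have "cmod u = \<bar>inverse q * sqrt c\<bar>" by (simp only: norm_minus_cancel norm_of_real)
  then have "(inverse q)\<^sup>2 * c = c"
    using u c by (simp add: power_mult_distrib del: power_inverse)
  with Q(2) c show False by simp
qed

text \<open>The equation determines the ratio \<open>k n\<close> of successive coordinates, which tends to zero; the
  product of these ratios is therefore square-summable.\<close>

lemma ground_vector_exists:
  fixes \<kappa> :: real
  obtains v where "ell2_nth v 0 = 1" "alpha q \<bullet>\<^sub>o v = \<kappa> *\<^sub>R (gamma q \<bullet>\<^sub>o v)"
proof -
  define k where "k n = \<kappa> * inverse q ^ n / sqrt (1 - inverse q ^ (2 * Suc n))" for n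
  define f where "f n = (\<Prod>j<n. k j)" for n
  \<comment> \<open>The square root in the denominator of \<open>k n\<close> is smallest at \<open>n = 0\<close>.\<close>
  define E where "E = sqrt (1 - (inverse q)\<^sup>2)"
  have E: "0 < E"
    using Q(2) unfolding E_def by (simp only: real_sqrt_gt_0_iff diff_gt_0_iff_gt)
  have "(\<lambda>n. inverse q ^ n) \<longlonglongrightarrow> 0" using q0 by (intro LIMSEQ_realpow_zero) auto
  then have "(\<lambda>n. \<bar>\<kappa>\<bar> * inverse q ^ n / E) \<longlonglongrightarrow>
      \<bar>\<kappa>\<bar> * 0 / E"
    using E by (intro tendsto_divide tendsto_mult tendsto_const) auto
  then have "\<forall>\<^sub>F n in sequentially. \<bar>\<kappa>\<bar> * inverse q ^ n / E < 1/2"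
    by (rule order_tendstoD) simp
  then obtain M where M: "\<And>n. n \<ge> M \<Longrightarrow> \<bar>\<kappa>\<bar> * inverse q ^ n / E < 1/2"
    unfolding eventually_sequentially by blast
  have k: "\<bar>k n\<bar> \<le> 1/2" if "n \<ge> M" for n
  proof -
    have "inverse q ^ (2 * Suc n) \<le> inverse q ^ 2"
      using q0 by (intro power_decreasing) auto
    then have le: "E \<le> sqrt (1 - inverse q ^ (2 * Suc n))"
      unfolding E_def by (intro real_sqrt_le_mono diff_left_mono)
    have "0 \<le> \<bar>\<kappa>\<bar> * inverse q ^ n" using q0 by simp
    moreover have "\<bar>k n\<bar> = \<bar>\<kappa>\<bar> * inverse q ^ n / sqrt (1 - inverse q ^ (2 * Suc n))"
      using q0 gap_pos[of n] by (simp add: k_def abs_mult del: power_inverse)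
    ultimately have "\<bar>k n\<bar> \<le> \<bar>\<kappa>\<bar> * inverse q ^ n / E"
      using le E by (simp only: divide_left_mono mult_pos_pos order_less_le_trans[OF E le])
    then show ?thesis using M[OF that] by linarith
  qed
  have "summable (\<lambda>n. (f n)\<^sup>2)"
  proof (rule summable_ratio_test)
    show "norm ((f (Suc n))\<^sup>2) \<le> 1/4 * norm ((f n)\<^sup>2)" if "n \<ge> M" for n
    proof -
      have "(k n)\<^sup>2 \<le> 1/4" using power_mono[OF k[OF that], of 2] by (simp add: power2_eq_square)
      then have "(f n)\<^sup>2 * (k n)\<^sup>2 \<le> (f n)\<^sup>2 * (1/4)" by (intro mult_left_mono) auto
      then show ?thesis by (simp add: f_def power_mult_distrib)
    qed
  qed simp
  then have "ell2_nth (Abs_ell2 (\<lambda>n. complex_of_real (f n))) = (\<lambda>n. complex_of_real (f n))"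
    by (intro Abs_ell2_inverse) simp
  then obtain v where v: "ell2_nth v = (\<lambda>n. complex_of_real (f n))" by blast
  show ?thesis
  proof (rule that)
    show "ell2_nth v 0 = 1" by (simp add: v f_def)
    show "alpha q \<bullet>\<^sub>o v = \<kappa> *\<^sub>R (gamma q \<bullet>\<^sub>o v)"
    proof (rule ell2_eqI)
      fix n
      have "ell2_nth (alpha q \<bullet>\<^sub>o v) n = complex_of_real (sqrt (1 - inverse q ^ (2 * Suc n)) * f (Suc n))"
        unfolding op_nth star_alpha_basis scaleR_ell2_def cinner_scaleC_left cinner_basis v by simp
      also have "sqrt (1 - inverse q ^ (2 * Suc n)) * f (Suc n) = \<kappa> * (inverse q ^ n * f n)"
        using gap_pos[of n] by (simp add: f_def k_def)
      also have "complex_of_real \<dots> = ell2_nth (\<kappa> *\<^sub>R (gamma q \<bullet>\<^sub>o v)) n"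
        unfolding scaleR_ell2_def scaleC_ell2.rep_eq op_nth star_gamma gamma_basis[OF q]
          cinner_scaleC_left cinner_basis v by simp
      finally show "ell2_nth (alpha q \<bullet>\<^sub>o v) n = ell2_nth (\<kappa> *\<^sub>R (gamma q \<bullet>\<^sub>o v)) n" .
    qed
  qed
qed

text \<open>With \<open>alpha v = \<kappa> gamma v\<close> all terms of \<open>jacobi_op v\<close> reduce to \<open>gamma\<^sup>2 v\<close> and \<open>v\<close>; the condition
  on \<open>\<kappa>\<close> makes the coefficient of \<open>gamma\<^sup>2 v\<close> vanish.\<close>

lemma jacobi_ground_vector:
  assumes "\<kappa> \<noteq> 0" and v: "alpha q \<bullet>\<^sub>o v = \<kappa> *\<^sub>R (gamma q \<bullet>\<^sub>o v)"
    and k: "1 - c - sqrt c / \<kappa> + sqrt c * \<kappa> = 0"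
  shows "jacobi_op \<bullet>\<^sub>o v = (sqrt c / \<kappa>) *\<^sub>R v"
proof -
  let ?g = "gamma q \<bullet>\<^sub>o gamma q \<bullet>\<^sub>o v"
  have "gamma q \<bullet>\<^sub>o v = (1/\<kappa>) *\<^sub>R (alpha q \<bullet>\<^sub>o v)" using assms(1) v by simp
  then have "star (alpha q) \<bullet>\<^sub>o gamma q \<bullet>\<^sub>o v = (1/\<kappa>) *\<^sub>R ((star (alpha q) * alpha q) \<bullet>\<^sub>o v)"
    by (simp add: op_apply_simps blinfun.scaleR_right)
  also have "\<dots> = (1/\<kappa>) *\<^sub>R v - (1/\<kappa>) *\<^sub>R ?g"
    unfolding star_alpha_alpha by (simp add: op_apply_simps scaleR_diff_right)
  finally have "jacobi_op \<bullet>\<^sub>o v = (1 - c) *\<^sub>R ?g + sqrt c *\<^sub>R ((1/\<kappa>) *\<^sub>R v - (1/\<kappa>) *\<^sub>R ?g + \<kappa> *\<^sub>R ?g)"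
    unfolding jacobi_op_eq by (simp add: op_apply_simps v blinfun.scaleR_right)
  also have "\<dots> = (1 - c - sqrt c / \<kappa> + sqrt c * \<kappa>) *\<^sub>R ?g + (sqrt c / \<kappa>) *\<^sub>R v"
    by (simp add: algebra_simps)
  finally show ?thesis unfolding k by simp
qed

text \<open>The condition on \<open>\<kappa>\<close> is a quadratic equation with the roots \<open>sqrt c\<close> and \<open>- 1 / sqrt c\<close>, which
  correspond to the eigenvalues \<open>1\<close> and \<open>- c\<close>.\<close>

lemma jacobi_ground_exists:
  assumes "\<mu> = 1 \<or> \<mu> = - c"
  obtains v where "v \<noteq> 0" "jacobi_op \<bullet>\<^sub>o v = \<mu> *\<^sub>R v"
proof -
  \<comment> \<open>This is \<open>sqrt c\<close> for \<open>\<mu> = 1\<close> and \<open>- 1 / sqrt c\<close> for \<open>\<mu> = - c\<close>.\<close>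
  define \<kappa> where "\<kappa> = sqrt c / \<mu>"
  have s: "sqrt c \<noteq> 0" "sqrt c * sqrt c = c" using c by auto
  have k: "\<kappa> \<noteq> 0" "1 - c - sqrt c / \<kappa> + sqrt c * \<kappa> = 0" "sqrt c / \<kappa> = \<mu>"
    using assms s c by (auto simp: \<kappa>_def)
  obtain v where v: "ell2_nth v 0 = 1" "alpha q \<bullet>\<^sub>o v = \<kappa> *\<^sub>R (gamma q \<bullet>\<^sub>o v)"
    by (rule ground_vector_exists)
  have "v \<noteq> 0" using v(1) by auto
  with jacobi_ground_vector[OF k(1) v(2) k(2)] k(3) show ?thesis by (intro that) auto
qed

lemma jacobi_eigenvectors_orthogonal:
  assumes "jacobi_op \<bullet>\<^sub>o x = \<mu> *\<^sub>R x" "jacobi_op \<bullet>\<^sub>o y = \<nu> *\<^sub>R y" "\<mu> \<noteq> \<nu>"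
  shows "cinner x y = 0"
proof -
  have "complex_of_real \<mu> * cinner x y = complex_of_real \<nu> * cinner x y"
    using cinner_jacobi_op[of x y]
    by (simp add: assms scaleR_ell2_def cinner_scaleC_left cinner_scaleC_right)
  with assms(3) show ?thesis by simp
qed

text \<open>Starting from a ground vector, normalise after every application of \<open>raising_op\<close>. No step
  gives zero because the weights are positive on \<open>[-c, 1]\<close>.\<close>

lemma jacobi_ladder:
  assumes \<mu>: "\<mu> = 1 \<or> \<mu> = - c"
  shows "\<exists>u. \<forall>n. jacobi_op \<bullet>\<^sub>o u n = (\<mu> * ((inverse q)\<^sup>2) ^ n) *\<^sub>R u n \<and> norm (u n) = 1 \<and>
    raising_op \<bullet>\<^sub>o u n = shift_gain c ((inverse q)\<^sup>2) (\<mu> * ((inverse q)\<^sup>2) ^ n) *\<^sub>R u (Suc n)"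
proof -
  let ?Q = "(inverse q)\<^sup>2"
  obtain v where v: "v \<noteq> 0" "jacobi_op \<bullet>\<^sub>o v = \<mu> *\<^sub>R v" by (rule jacobi_ground_exists[OF \<mu>])
  define g where "g n = shift_gain c ?Q (\<mu> * ?Q ^ n)" for n
  have "\<mu> * ?Q ^ n \<in> {-c..1}" for n
    using \<mu> spectrum_points[OF c Q, of n] by (auto simp del: power_inverse atLeastAtMost_iff)
  then have g: "0 < g n" for n unfolding g_def by (intro shift_gain_pos[OF c Q])
  define u where "u = rec_nat (v /\<^sub>R norm v) (\<lambda>n x. (raising_op \<bullet>\<^sub>o x) /\<^sub>R g n)"
  have u: "u 0 = v /\<^sub>R norm v" "\<And>n. u (Suc n) = (raising_op \<bullet>\<^sub>o u n) /\<^sub>R g n"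
    by (simp_all add: u_def)
  have eig: "jacobi_op \<bullet>\<^sub>o u n = (\<mu> * ?Q ^ n) *\<^sub>R u n \<and> norm (u n) = 1" for n
  proof (induction n)
    case 0
    show ?case using v by (simp add: u blinfun.scaleR_right)
  next
    case (Suc n)
    have "jacobi_op \<bullet>\<^sub>o raising_op \<bullet>\<^sub>o u n = (jacobi_op * raising_op) \<bullet>\<^sub>o u n"
      by (simp add: op_apply_simps)
    also have "\<dots> = (\<mu> * ?Q ^ Suc n) *\<^sub>R (raising_op \<bullet>\<^sub>o u n)"
      unfolding jacobi_raising using Suc
      by (simp add: op_apply_simps blinfun.scaleR_right mult_ac del: power_inverse)
    finally have "jacobi_op \<bullet>\<^sub>o u (Suc n) = (\<mu> * ?Q ^ Suc n) *\<^sub>R u (Suc n)"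
      by (simp add: u blinfun.scaleR_right mult_ac del: power_inverse)
    moreover have "(norm (raising_op \<bullet>\<^sub>o u n))\<^sup>2 = (g n)\<^sup>2"
      using norm_raising_op[of "u n" "\<mu> * ?Q ^ n"] Suc g[of n]
      by (simp add: g_def shift_gain_def del: power_inverse)
    then have "norm (raising_op \<bullet>\<^sub>o u n) = g n" using g[of n] by (simp add: power2_eq_iff_nonneg)
    then have "norm (u (Suc n)) = 1" using g[of n] by (simp add: u)
    ultimately show ?case by blast
  qed
  have "raising_op \<bullet>\<^sub>o u n = shift_gain c ?Q (\<mu> * ?Q ^ n) *\<^sub>R u (Suc n)" for n
    using g[of n] by (simp add: u g_def[symmetric] del: power_inverse)
  with eig show ?thesis by blast
qed

text \<open>In a nonzero subspace there would be an eigenvector \<open>x\<close> whose eigenvalue \<open>\<mu>\<close> has the largest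
  possible modulus. As \<open>B\<^sup>* x\<close> has the eigenvalue \<open>q\<^sup>2 \<mu>\<close>, it vanishes; then
  \<open>B B\<^sup>* x = (c + \<mu>)(1 - \<mu>) x\<close> leaves only the eigenvalues excluded by hypothesis.\<close>

lemma reducing_subspace_trivial:
  assumes M: "closed M" "\<And>x y. x \<in> M \<Longrightarrow> y \<in> M \<Longrightarrow> x + y \<in> M" "\<And>r x. x \<in> M \<Longrightarrow> r *\<^sub>R x \<in> M"
    and inv: "\<And>x. x \<in> M \<Longrightarrow> jacobi_op \<bullet>\<^sub>o x \<in> M" "\<And>x. x \<in> M \<Longrightarrow> star raising_op \<bullet>\<^sub>o x \<in> M"
    and ground: "\<And>x \<mu>. x \<in> M \<Longrightarrow> \<mu> = 1 \<or> \<mu> = - c \<Longrightarrow> jacobi_op \<bullet>\<^sub>o x = \<mu> *\<^sub>R x \<Longrightarrow> x = 0"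
    and y: "y \<in> M"
  shows "y = 0"
proof (rule ccontr)
  assume "y \<noteq> 0"
  then have "jacobi_op \<bullet>\<^sub>o y \<noteq> 0" using jacobi_op_injective by blast
  then obtain x \<mu> where x: "x \<in> M" "x \<noteq> 0" "jacobi_op \<bullet>\<^sub>o x = \<mu> *\<^sub>R x" "\<mu> \<noteq> 0"
      and max: "\<And>z. z \<in> M \<Longrightarrow> norm (jacobi_op \<bullet>\<^sub>o z) \<le> \<bar>\<mu>\<bar> * norm z"
    using compact_selfadjoint_maximal_eigenvector[OF compact_jacobi_op star_jacobi_op M inv(1) y]
    by metis
  define z where "z = star raising_op \<bullet>\<^sub>o x"
  have "star raising_op * jacobi_op = (inverse q)\<^sup>2 *\<^sub>R (jacobi_op * star raising_op)"
    using arg_cong[OF jacobi_raising, of star]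
    by (simp only: star_mult star_scaleR star_jacobi_op)
  then have "(star raising_op * jacobi_op) \<bullet>\<^sub>o x = (inverse q)\<^sup>2 *\<^sub>R (jacobi_op \<bullet>\<^sub>o z)"
    by (simp add: op_apply_simps z_def del: power_inverse)
  then have "\<mu> *\<^sub>R z = (inverse q)\<^sup>2 *\<^sub>R (jacobi_op \<bullet>\<^sub>o z)"
    by (simp add: op_apply_simps x(3) blinfun.scaleR_right z_def del: power_inverse)
  then have "\<bar>\<mu>\<bar> * norm z = (inverse q)\<^sup>2 * norm (jacobi_op \<bullet>\<^sub>o z)"
    by (metis abs_power2 norm_scaleR)
  also have "\<dots> \<le> (inverse q)\<^sup>2 * (\<bar>\<mu>\<bar> * norm z)"
    using max[of z] inv(2)[OF x(1)] by (intro mult_left_mono) (simp_all add: z_def)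
  finally have "(1 - (inverse q)\<^sup>2) * (\<bar>\<mu>\<bar> * norm z) \<le> 0" by (simp only: left_diff_distrib mult_1 diff_le_0_iff_le)
  moreover have "0 < 1 - (inverse q)\<^sup>2" using Q(2) by simp
  ultimately have "\<bar>\<mu>\<bar> * norm z \<le> 0" by (simp only: mult_le_0_iff) linarith
  then have "z = 0" using x(4) by (simp add: mult_le_0_iff)
  then have "(raising_op * star raising_op) \<bullet>\<^sub>o x = 0" by (simp add: op_apply_simps z_def)
  then have "((c + \<mu>) * (1 - \<mu>)) *\<^sub>R x = 0"
    unfolding raising_star_raising
    by (simp add: op_apply_simps x(3) blinfun.bilinear_simps algebra_simps)
  then have "\<mu> = 1 \<or> \<mu> = - c" using x(2) by (auto simp: eq_neg_iff_add_eq_0 add.commute)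
  then show False using ground[OF x(1) _ x(3)] x(2) by blast
qed

text \<open>The two ladders of eigenvectors give the isometries. The vectors orthogonal to both ladders
  form a subspace to which \<open>reducing_subspace_trivial\<close> applies, so the splitting is complete.\<close>

lemma podles_pair_exists:
  "\<exists>J K. podles_pair J K c ((inverse q)\<^sup>2) (star (X1 q c) * X1 q c) (star (X1 q c) * X2 q c)"
proof -
  let ?Q = "(inverse q)\<^sup>2"
  obtain u where u: "\<And>n. jacobi_op \<bullet>\<^sub>o u n = (1 * ?Q ^ n) *\<^sub>R u n" "\<And>n. norm (u n) = 1"
    "\<And>n. raising_op \<bullet>\<^sub>o u n = shift_gain c ?Q (1 * ?Q ^ n) *\<^sub>R u (Suc n)"
    using jacobi_ladder[OF disjI1[OF refl]] by blast
  obtain w where w: "\<And>n. jacobi_op \<bullet>\<^sub>o w n = (- c * ?Q ^ n) *\<^sub>R w n" "\<And>n. norm (w n) = 1"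
    "\<And>n. raising_op \<bullet>\<^sub>o w n = shift_gain c ?Q (- c * ?Q ^ n) *\<^sub>R w (Suc n)"
    using jacobi_ladder[OF disjI2[OF refl]] by blast
  have inj: "m = n" if "?Q ^ m = ?Q ^ n" for m n
    using that power_inject_exp' Q by (metis less_irrefl linorder_neqE_nat power_strict_decreasing)
  have uu: "cinner (u m) (u n) = (if m = n then 1 else 0)" for m n
    using jacobi_eigenvectors_orthogonal[OF u(1) u(1), of m n] inj[of m n] cinner_norm[of "u n"]
    by (auto simp: u(2) simp del: power_inverse)
  have ww: "cinner (w m) (w n) = (if m = n then 1 else 0)" for m n
    using jacobi_eigenvectors_orthogonal[OF w(1) w(1), of m n] inj[of m n] cinner_norm[of "w n"] c
    by (auto simp: w(2) simp del: power_inverse)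
  have uw: "cinner (u m) (w n) = 0" for m n
  proof (rule jacobi_eigenvectors_orthogonal[OF u(1) w(1)])
    have "0 < ?Q ^ m" "0 < c * ?Q ^ n" using Q(1) c by (simp_all del: power_inverse)
    then show "1 * ?Q ^ m \<noteq> - c * ?Q ^ n" by (simp only: mult_minus_left)
  qed
  obtain J where J: "\<And>n. J \<bullet>\<^sub>o ell2_basis n = u n" "star J * J = 1"
    using isometry_of_orthonormal[OF uu] by blast
  obtain K where K: "\<And>n. K \<bullet>\<^sub>o ell2_basis n = w n" "star K * K = 1"
    using isometry_of_orthonormal[OF ww] by blast
  have JK: "star J * K = 0"
    by (rule op_eq_on_basis, rule ell2_eqI) (simp add: op_apply_simps star_op_nth J(1) K(1) uw)
  have KJ: "star K * J = 0"
    using arg_cong[OF JK, of star] by (simp add: star_mult star_star)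
  define M where "M = {x. \<forall>n. cinner (u n) x = 0 \<and> cinner (w n) x = 0}"
  have M_trivial: "y = 0" if y: "y \<in> M" for y
  proof (rule reducing_subspace_trivial[OF _ _ _ _ _ _ y])
    have "closed {x. cinner z x = 0}" for z
      by (intro closed_Collect_eq continuous_on_const
          linear_continuous_on bounded_bilinear.bounded_linear_right[OF bounded_bilinear_cinner])
    then show "closed M" unfolding M_def by (intro closed_Collect_all closed_Collect_conj)
    show "x + y \<in> M" if "x \<in> M" "y \<in> M" for x y using that by (simp add: M_def cinner_add_right)
    show "r *\<^sub>R x \<in> M" if "x \<in> M" for r x
      using that by (simp add: M_def scaleR_ell2_def cinner_scaleC_right)
    show "jacobi_op \<bullet>\<^sub>o x \<in> M" if "x \<in> M" for x
      using that unfolding M_def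
      by (simp add: cinner_jacobi_op[symmetric] u(1) w(1) scaleR_ell2_def cinner_scaleC_left)
    show "star raising_op \<bullet>\<^sub>o x \<in> M" if "x \<in> M" for x
      using that unfolding M_def
      by (simp add: cinner_star_right u(3) w(3) scaleR_ell2_def cinner_scaleC_left)
    show "x = 0" if x: "x \<in> M" and \<mu>: "\<mu> = 1 \<or> \<mu> = - c" and e: "jacobi_op \<bullet>\<^sub>o x = \<mu> *\<^sub>R x" for x \<mu>
    proof -
      have "\<exists>z. jacobi_op \<bullet>\<^sub>o z = \<mu> *\<^sub>R z \<and> norm z = 1 \<and> cinner z x = 0"
        using \<mu>
      proof
        assume "\<mu> = 1"
        then show ?thesis using u(1)[of 0] u(2)[of 0] x by (intro exI[of _ "u 0"]) (simp add: M_def)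
      next
        assume "\<mu> = - c"
        then show ?thesis using w(1)[of 0] w(2)[of 0] x by (intro exI[of _ "w 0"]) (simp add: M_def)
      qed
      then obtain z where z: "jacobi_op \<bullet>\<^sub>o z = \<mu> *\<^sub>R z" "norm z = 1" "cinner z x = 0" by blast
      then have "z \<noteq> 0" by auto
      then obtain a where a: "x = a *\<^sub>C z" using jacobi_eigenspace_simple[OF z(1) e] by blast
      with z have "a = 0" by (simp add: cinner_scaleC_right cinner_norm)
      with a show "x = 0" by simp
    qed
  qed
  have complete: "J * star J + K * star K = 1"
  proof (rule op_eqI)
    fix x
    define y where "y = x - (J * star J + K * star K) \<bullet>\<^sub>o x"
    have "star J * (1 - (J * star J + K * star K)) = 0" "star K * (1 - (J * star J + K * star K)) = 0"
      using J(2) K(2) JK KJ by (simp_all add: right_diff_distrib distrib_left mult.assoc[symmetric])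
    then have "star J \<bullet>\<^sub>o y = 0" "star K \<bullet>\<^sub>o y = 0"
      unfolding y_def by (metis op_apply_simps(2,4,5,6))+
    then have "y \<in> M"
      unfolding M_def using star_op_nth[of J y] star_op_nth[of K y] by (simp add: J(1) K(1))
    then have "y = 0" by (rule M_trivial)
    then show "(J * star J + K * star K) \<bullet>\<^sub>o x = 1 \<bullet>\<^sub>o x" by (simp add: y_def op_apply_simps)
  qed
  interpret orthogonal_splitting J K
    by unfold_locales (rule J(2) K(2) JK complete)+
  have Bs: "Bseq (\<lambda>n. complex_of_real (f (r * ?Q ^ n)))"
    if "continuous_on {-c..1} f" "r = 1 \<or> r = - c" for f r
    using that(2) spectrum_points[OF c Q]
    by (intro Bseq_continuous_sample[OF that(1)]) (auto simp del: power_inverse atLeastAtMost_iff)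
  define D where "D f r = diag_op (\<lambda>n. complex_of_real (f (r * ?Q ^ n)))" for f r
  have spec: "spectral_op c ?Q f = block_op (D f 1) (D f (- c))" for f
    by (simp add: spectral_op_def D_def del: power_inverse)
  have D: "D f r \<bullet>\<^sub>o ell2_basis n = f (r * ?Q ^ n) *\<^sub>R ell2_basis n"
    if "continuous_on {-c..1} f" "r = 1 \<or> r = - c" for f r n
    unfolding D_def diag_op_basis[OF Bs[OF that]] scaleR_ell2_def ..
  have intertwine: "T = block_op R S" if "T * J = J * R" "T * K = K * S" for T R S
  proof -
    have "T = T * (J * star J + K * star K)" unfolding complete by simp
    then show ?thesis using that by (simp add: block_op_def distrib_left mult.assoc[symmetric])
  qed
  have id: "continuous_on {-c..1} (\<lambda>x::real. x)" by (intro continuous_intros)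
  have N: "jacobi_op = spectral_op c ?Q (\<lambda>x. x)"
    unfolding spec
  proof (rule intertwine)
    show "jacobi_op * J = J * D (\<lambda>x. x) 1"
      by (rule op_eq_on_basis) (simp add: op_apply_simps D[OF id] J(1) u(1) blinfun.scaleR_right)
    show "jacobi_op * K = K * D (\<lambda>x. x) (- c)"
      by (rule op_eq_on_basis) (simp add: op_apply_simps D[OF id] K(1) w(1) blinfun.scaleR_right
          blinfun.minus_right)
  qed
  have B: "raising_op = block_op shift shift * spectral_op c ?Q (shift_gain c ?Q)"
    unfolding spec block_op_mult
  proof (rule intertwine)
    show "raising_op * J = J * (shift * D (shift_gain c ?Q) 1)"
      by (rule op_eq_on_basis) (simp add: op_apply_simps D[OF continuous_on_shift_gain] J(1)
          u(3)[simplified] blinfun.scaleR_right shift_basis)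
    show "raising_op * K = K * (shift * D (shift_gain c ?Q) (- c))"
      by (rule op_eq_on_basis) (simp add: op_apply_simps D[OF continuous_on_shift_gain] K(1)
          w(3)[simplified] blinfun.scaleR_right shift_basis)
  qed
  have "podles_pair J K c ?Q (star (X1 q c) * X1 q c) (star (X1 q c) * X2 q c)"
    by unfold_locales
      (use c Q N B X1_X1_jacobi in \<open>simp_all only: raising_op_def[symmetric]\<close>)
  then show ?thesis by blast
qed

end

section \<open>Isometric images\<close>

lemma cstar_isomorphic_trans:
  assumes "A \<cong>\<^sub>* B" "B \<cong>\<^sub>* C"
  shows "A \<cong>\<^sub>* C"
proof -
  obtain \<phi> \<psi> where \<phi>: "star_hom_on A \<phi>" "bij_betw \<phi> A B" and \<psi>: "star_hom_on B \<psi>" "bij_betw \<psi> B C"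
    using assms unfolding cstar_isomorphic_def by blast
  have "\<phi> x \<in> B" if "x \<in> A" for x using \<phi>(2) that by (auto simp: bij_betw_def)
  then have "star_hom_on A (\<psi> \<circ> \<phi>)"
    using \<phi>(1) \<psi>(1) unfolding star_hom_on_def by simp
  with bij_betw_trans[OF \<phi>(2) \<psi>(2)] show ?thesis unfolding cstar_isomorphic_def by blast
qed

text \<open>Being isometric makes the image complete, hence closed, so it is the algebra generated by the
  images of the generators.\<close>

lemma cstar_isomorphic_isometric_image:
  fixes \<phi> :: "'a::cstar_algebra \<Rightarrow> 'b::cstar_algebra"
  assumes hom: "star_hom_on (cstar_generated F) \<phi>"
    and iso: "\<And>x. x \<in> cstar_generated F \<Longrightarrow> norm (\<phi> x) = norm x"
  shows "cstar_generated F \<cong>\<^sub>* cstar_generated (\<phi> ` F)"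
proof -
  let ?A = "cstar_generated F" and ?B = "cstar_generated (\<phi> ` F)"
  have A: "cstar_subalgebra ?A" and B: "cstar_subalgebra ?B" by (rule cstar_subalgebra_generated)+
  note AD = cstar_subalgebraD[OF A] and BD = cstar_subalgebraD[OF B]
  have h: "\<phi> (x + y) = \<phi> x + \<phi> y" "\<phi> (a *\<^sub>C x) = a *\<^sub>C \<phi> x" "\<phi> (x * y) = \<phi> x * \<phi> y"
    "\<phi> (star x) = star (\<phi> x)" if "x \<in> ?A" "y \<in> ?A" for x y a
    using hom that unfolding star_hom_on_def by blast+
  have h0: "\<phi> 0 = 0" using iso[OF AD(1)] by simp
  have dist: "norm (\<phi> x - \<phi> y) = norm (x - y)" if "x \<in> ?A" "y \<in> ?A" for x y
    using star_hom_on_diff[OF hom A that] iso[OF cstar_subalgebra_diff[OF A that]] by simp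
  have image_closed: "closed (\<phi> ` ?A)"
    unfolding closed_sequential_limits
  proof (intro allI impI, elim conjE)
    fix y l assume y: "\<forall>n. y n \<in> \<phi> ` ?A" and l: "y \<longlonglongrightarrow> l"
    then have "\<forall>n. \<exists>x\<in>?A. y n = \<phi> x" by blast
    then obtain x where x: "\<And>n. x n \<in> ?A" "\<And>n. y n = \<phi> (x n)" by metis
    have "Cauchy y" using l by (rule LIMSEQ_imp_Cauchy)
    then have "Cauchy x" unfolding Cauchy_iff x(2) using dist[OF x(1) x(1)] by simp
    then obtain z where z: "x \<longlonglongrightarrow> z" using Cauchy_convergent convergentD by blast
    have zA: "z \<in> ?A" by (rule closed_sequentially[OF AD(6) x(1) z])
    have "(\<lambda>n. norm (y n - \<phi> z)) \<longlonglongrightarrow> 0"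
      unfolding x(2) dist[OF x(1) zA] using z by (simp add: LIM_zero_iff tendsto_norm_zero_iff)
    then have "y \<longlonglongrightarrow> \<phi> z" by (simp add: LIM_zero_iff tendsto_norm_zero_iff)
    then have "l = \<phi> z" using l LIMSEQ_unique by blast
    with zA show "l \<in> \<phi> ` ?A" by blast
  qed
  have image_zero: "0 \<in> \<phi> ` ?A" using h0 AD(1) by (metis imageI)
  have image_ops: "a + b \<in> \<phi> ` ?A" "a * b \<in> \<phi> ` ?A" "k *\<^sub>C a \<in> \<phi> ` ?A" "star a \<in> \<phi> ` ?A"
    if ab: "a \<in> \<phi> ` ?A" "b \<in> \<phi> ` ?A" for a b k
  proof -
    obtain x y where xy: "x \<in> ?A" "a = \<phi> x" "y \<in> ?A" "b = \<phi> y" using ab by blast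
    then have eqs: "a + b = \<phi> (x + y)" "a * b = \<phi> (x * y)" "k *\<^sub>C a = \<phi> (k *\<^sub>C x)"
        "star a = \<phi> (star x)"
      by (simp_all add: h)
    show "a + b \<in> \<phi> ` ?A" "a * b \<in> \<phi> ` ?A" "k *\<^sub>C a \<in> \<phi> ` ?A" "star a \<in> \<phi> ` ?A"
      unfolding eqs by (intro imageI AD xy(1,3))+
  qed
  have "cstar_subalgebra (\<phi> ` ?A)"
    unfolding cstar_subalgebra_def
    by (intro conjI ballI allI image_closed image_zero image_ops; assumption)
  then have 1: "?B \<subseteq> \<phi> ` ?A"
    using cstar_generated_superset[of F] by (intro cstar_generated_least image_mono)
  have "closed {x \<in> ?A. \<phi> x \<in> ?B}"
    unfolding closed_sequential_limits
  proof (intro allI impI, elim conjE)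
    fix x l assume x: "\<forall>n. x n \<in> {x \<in> ?A. \<phi> x \<in> ?B}" and l: "x \<longlonglongrightarrow> l"
    have lA: "l \<in> ?A" by (rule closed_sequentially[OF AD(6) _ l]) (use x in auto)
    have "(\<lambda>n. norm (\<phi> (x n) - \<phi> l)) = (\<lambda>n. norm (x n - l))"
      using x dist[OF _ lA] by auto
    then have "(\<lambda>n. norm (\<phi> (x n) - \<phi> l)) \<longlonglongrightarrow> 0"
      using l by (simp add: LIM_zero_iff tendsto_norm_zero_iff)
    then have "(\<lambda>n. \<phi> (x n)) \<longlonglongrightarrow> \<phi> l" by (simp add: LIM_zero_iff tendsto_norm_zero_iff)
    then have "\<phi> l \<in> ?B" by (rule closed_sequentially[OF BD(6), rotated]) (use x in auto)
    with lA show "l \<in> {x \<in> ?A. \<phi> x \<in> ?B}" by blast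
  qed
  then have "cstar_subalgebra {x \<in> ?A. \<phi> x \<in> ?B}"
    unfolding cstar_subalgebra_def using AD(1-5) BD(1-5) h h0 by simp
  moreover have "F \<subseteq> {x \<in> ?A. \<phi> x \<in> ?B}"
    using cstar_generated_superset[of F] cstar_generated_superset[of "\<phi> ` F"] by blast
  ultimately have "?A \<subseteq> {x \<in> ?A. \<phi> x \<in> ?B}" by (rule cstar_generated_least)
  with 1 have "\<phi> ` ?A = ?B" by blast
  moreover have "inj_on \<phi> ?A"
    by (rule inj_onI) (metis dist eq_iff_diff_eq_0 norm_eq_zero)
  ultimately show ?thesis
    unfolding cstar_isomorphic_def bij_betw_def using hom by blast
qed

lemma cstar_generated_eqI:
  assumes "F \<subseteq> cstar_generated G" "G \<subseteq> cstar_generated F"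
  shows "cstar_generated F = cstar_generated G"
  using assms by (intro equalityI cstar_generated_least cstar_subalgebra_generated)

section \<open>Removing the circle parameter\<close>

definition phase_op :: "complex \<Rightarrow> ell2_op" where
  "phase_op z = diag_op (\<lambda>n. z ^ n)"

context
  fixes z :: complex
  assumes z: "cmod z = 1"
begin

lemma cnj_unit: "z * cnj z = 1" "cnj z * z = 1"
  using z complex_norm_square[of z] by (simp_all add: mult.commute)

lemma phase_op_basis: "phase_op z \<bullet>\<^sub>o ell2_basis n = z ^ n *\<^sub>C ell2_basis n"
  unfolding phase_op_def by (rule diag_op_basis, rule BseqI'[of _ 1]) (simp add: norm_power z)

lemma star_phase_op: "star (phase_op z) = phase_op (cnj z)"
proof -
  have "Bseq (\<lambda>n. z ^ n)" by (rule BseqI'[of _ 1]) (simp add: norm_power z)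
  then show ?thesis by (simp add: phase_op_def star_diag_op)
qed

lemma star_phase_op_basis: "star (phase_op z) \<bullet>\<^sub>o ell2_basis n = cnj z ^ n *\<^sub>C ell2_basis n"
proof -
  have "Bseq (\<lambda>n. cnj z ^ n)" by (rule BseqI'[of _ 1]) (simp add: norm_power z)
  from diag_op_basis[OF this] show ?thesis by (simp only: star_phase_op phase_op_def[of "cnj z"])
qed

lemma phase_op_unitary: "phase_op z * star (phase_op z) = 1" "star (phase_op z) * phase_op z = 1"
  by (rule op_eq_on_basis,
      simp add: op_apply_simps phase_op_basis star_phase_op_basis scaleC_scaleC scaleC_one
        power_mult_distrib[symmetric] cnj_unit)+

text \<open>Conjugation by the phases multiplies a matrix entry in position \<open>(m, n)\<close> by \<open>z\<^sup>m cnj z\<^sup>n\<close>, which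
  is constant along each diagonal.\<close>

lemma phase_conjugate_lowering:
  assumes T: "T \<bullet>\<^sub>o ell2_basis 0 = 0" "\<And>n. T \<bullet>\<^sub>o ell2_basis (Suc n) = d n *\<^sub>R ell2_basis n"
  shows "phase_op z * T * star (phase_op z) = cnj z *\<^sub>C T"
proof (rule op_eq_on_basis)
  fix n
  show "(phase_op z * T * star (phase_op z)) \<bullet>\<^sub>o ell2_basis n = (cnj z *\<^sub>C T) \<bullet>\<^sub>o ell2_basis n"
  proof (cases n)
    case (Suc m)
    have "cnj z ^ Suc m * (of_real (d m) * z ^ m) = cnj z * of_real (d m) * (z * cnj z) ^ m"
      by (simp add: power_mult_distrib)
    then have "cnj z ^ Suc m * (of_real (d m) * z ^ m) = cnj z * of_real (d m)"
      by (simp only: cnj_unit) simp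
    then show ?thesis
      unfolding Suc op_apply_simps op_apply_scaleC star_phase_op_basis op_scaleC T(2)
        scaleR_ell2_def phase_op_basis scaleC_scaleC by (simp only: mult.assoc)
  qed (simp add: op_apply_simps op_apply_scaleC star_phase_op_basis T(1))
qed

lemma phase_conjugate_diagonal:
  assumes T: "\<And>n. T \<bullet>\<^sub>o ell2_basis n = d n *\<^sub>C ell2_basis n"
  shows "phase_op z * T * star (phase_op z) = T"
proof (rule op_eq_on_basis)
  fix n
  have "cnj z ^ n * (d n * z ^ n) = d n * (z * cnj z) ^ n"
    by (simp add: power_mult_distrib)
  then have "cnj z ^ n * (d n * z ^ n) = d n"
    by (simp only: cnj_unit) simp
  then show "(phase_op z * T * star (phase_op z)) \<bullet>\<^sub>o ell2_basis n = T \<bullet>\<^sub>o ell2_basis n"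
    unfolding op_apply_simps star_phase_op_basis op_scaleC T phase_op_basis scaleC_scaleC
    by (simp only: mult.assoc)
qed

lemma phase_conjugate_star:
  assumes "phase_op z * T * star (phase_op z) = a *\<^sub>C T"
  shows "phase_op z * star T * star (phase_op z) = cnj a *\<^sub>C star T"
  using arg_cong[OF assms, of star] by (simp add: star_mult star_star star_scaleC mult.assoc)

end

lemma phase_conjugate_shift:
  assumes "cmod z = 1"
  shows "phase_op z * shift * star (phase_op z) = z *\<^sub>C shift"
proof -
  have "phase_op z * star shift * star (phase_op z) = cnj z *\<^sub>C star shift"
    by (rule phase_conjugate_lowering[OF assms, where d = "\<lambda>_. 1"])
      (simp_all add: star_shift_basis)
  from phase_conjugate_star[OF assms this] show ?thesis by (simp add: star_star)
qed

context podles_pair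
begin

text \<open>The gauge automorphism that fixes \<open>A\<close> and multiplies \<open>B\<close> by a phase is implemented by a unitary:
  \<open>A\<close> is diagonal in both blocks and \<open>B\<close> is a weighted shift there.\<close>

lemma block_phase_conjugate:
  assumes z: "cmod z = 1"
  defines "V \<equiv> block_op (phase_op z) (phase_op z)"
  shows "V * star V = 1" "star V * V = 1" "V * A * star V = A" "V * B * star V = z *\<^sub>C B"
proof -
  show V: "V * star V = 1" "star V * V = 1"
    by (simp_all add: V_def star_block_op block_op_mult phase_op_unitary[OF z] block_op_one)
  have f: "V * functional_op f * star V = functional_op f" if f: "continuous_on {-c..1} f" for f
    unfolding V_def spectral_op_def star_block_op block_op_mult
      phase_conjugate_diagonal[OF z diag_op_basis[OF Bseq_spectrum(1)[OF f]]]
      phase_conjugate_diagonal[OF z diag_op_basis[OF Bseq_spectrum(2)[OF f]]] ..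
  show "V * A * star V = A" unfolding A_functional by (intro f continuous_intros)
  have s: "V * block_op shift shift * star V = z *\<^sub>C block_op shift shift"
    by (simp add: V_def star_block_op block_op_mult phase_conjugate_shift[OF z] block_op_scaleC)
  have "V * B * star V = (V * block_op shift shift * star V) *
      (V * functional_op (shift_gain c Q) * star V)"
    unfolding B using V(2) by (simp add: mult.assoc) (simp add: mult.assoc[symmetric])
  also have "\<dots> = z *\<^sub>C B"
    unfolding s f[OF continuous_on_shift_gain] B by (simp add: mult_scaleC_left)
  finally show "V * B * star V = z *\<^sub>C B" .
qed

end

definition circle_one :: circle where
  "circle_one = Abs_circle 1"

lemma complex_of_circle_one: "complex_of_circle circle_one = 1"
  by (simp add: circle_one_def Abs_circle_inverse)

context nonstandard_line
begin

lemma proj_coord_at_one: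
  "apply_bcontfun (proj_coord q c 1) circle_one = X1 q c"
  "apply_bcontfun (proj_coord q c 2) circle_one = X2 q c"
  unfolding proj_coord_apply complex_of_circle_one X1_def X2_def by (simp_all add: scaleC_one)

lemma proj_coord_conjugate:
  fixes t :: circle
  defines "z \<equiv> complex_of_circle t"
  defines "U \<equiv> phase_op ((cnj z)\<^sup>2)"
  shows "apply_bcontfun (proj_coord q c 1) t = cnj z *\<^sub>C (U * X1 q c * star U)"
    and "apply_bcontfun (proj_coord q c 2) t = z *\<^sub>C (U * X2 q c * star U)"
    and "star U * U = 1"
proof -
  have z1: "cmod z = 1" and w: "cmod ((cnj z)\<^sup>2) = 1" by (simp_all add: z_def norm_power)
  show "star U * U = 1" unfolding U_def by (rule phase_op_unitary(2)[OF w])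
  have a: "U * alpha q * star U = cnj ((cnj z)\<^sup>2) *\<^sub>C alpha q"
    unfolding U_def by (rule phase_conjugate_lowering[OF w alpha_basis_0[OF q] alpha_basis_Suc])
  have sa: "U * star (alpha q) * star U = (cnj z)\<^sup>2 *\<^sub>C star (alpha q)"
    using phase_conjugate_star[OF w] a unfolding U_def by fastforce
  have g: "U * gamma q * star U = gamma q"
    unfolding U_def gamma_diag by (rule phase_conjugate_diagonal[OF w diag_op_basis[OF Bseq_gamma]])
  have e: "cnj z * cnj ((cnj z)\<^sup>2) = z" "z * (cnj z)\<^sup>2 = cnj z"
    using cnj_unit[OF z1] by (simp_all add: power2_eq_square flip: mult.assoc)
  have r: "a *\<^sub>C (r *\<^sub>R T) = r *\<^sub>R (a *\<^sub>C T)" for a r and T :: ell2_op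
    by (simp add: scaleR_scaleC scaleC_scaleC mult.commute)
  have "U * X1 q c * star U = sqrt c *\<^sub>R (U * alpha q * star U) + U * gamma q * star U"
    by (simp add: X1_def distrib_left distrib_right)
  then show "apply_bcontfun (proj_coord q c 1) t = cnj z *\<^sub>C (U * X1 q c * star U)"
    unfolding proj_coord_apply z_def[symmetric] a g
    by (simp only: scaleC_add_right r scaleC_scaleC e)
  have "U * X2 q c * star U = (- inverse q * sqrt c) *\<^sub>R (U * gamma q * star U) +
      U * star (alpha q) * star U"
    by (simp add: X2_def distrib_left distrib_right right_diff_distrib left_diff_distrib)
  then show "apply_bcontfun (proj_coord q c 2) t = z *\<^sub>C (U * X2 q c * star U)"
    unfolding proj_coord_apply z_def[symmetric] sa g
    by (simp only: scaleC_add_right r scaleC_scaleC e)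
qed

lemma star_X_mult_scaled_conjugate:
  fixes U X Y :: ell2_op
  assumes "star U * U = 1"
  shows "star (a *\<^sub>C (U * X * star U)) * (b *\<^sub>C (U * Y * star U)) =
    (cnj a * b) *\<^sub>C (U * (star X * Y) * star U)"
proof -
  have "star (U * X * star U) * (U * Y * star U) = U * star X * (star U * U) * Y * star U"
    by (simp add: star_mult star_star mult.assoc)
  then show ?thesis
    by (simp add: assms star_scaleC mult_scaleC_left mult_scaleC_right scaleC_scaleC mult.assoc
        mult.commute)
qed

text \<open>At \<open>t\<close> the generator \<open>x\<^sub>i\<^sup>*x\<^sub>j\<close> equals a phase times \<open>U X\<^sub>i\<^sup>*X\<^sub>j U\<^sup>*\<close>. The phase is absorbed by the
  unitary \<open>V\<close> of the gauge automorphism. The families with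
  \<open>f(t) = Z(t) f(1) Z(t)\<^sup>*\<close> form a C*-subalgebra that contains all four generators.\<close>

lemma quantum_CP1_conjugate:
  obtains Z where "\<And>t. norm (Z t) \<le> 1"
    "\<And>f t. f \<in> quantum_CP1 q c \<Longrightarrow>
      apply_bcontfun f t = Z t * apply_bcontfun f circle_one * star (Z t)"
proof -
  let ?A = "star (X1 q c) * X1 q c" and ?B = "star (X1 q c) * X2 q c"
  obtain J K where "podles_pair J K c ((inverse q)\<^sup>2) ?A ?B" using podles_pair_exists by blast
  then interpret podles_pair J K c "(inverse q)\<^sup>2" ?A ?B .
  define z where "z t = complex_of_circle t" for t
  define U where "U t = phase_op ((cnj (z t))\<^sup>2)" for t
  define V where "V t = block_op (phase_op ((z t)\<^sup>2)) (phase_op ((z t)\<^sup>2))" for t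
  define Z where "Z t = U t * V t" for t
  have z: "cmod (z t) = 1" "cmod ((z t)\<^sup>2) = 1" for t by (simp_all add: z_def norm_power)
  have U: "star (U t) * U t = 1" for t unfolding U_def z_def by (rule proj_coord_conjugate(3))
  note V = block_phase_conjugate[OF z(2), folded V_def]
  have ZZ: "star (Z t) * Z t = 1" for t
  proof -
    have "star (Z t) * Z t = star (V t) * (star (U t) * U t) * V t"
      by (simp add: Z_def star_mult mult.assoc)
    then show ?thesis by (simp add: U V)
  qed
  have "norm (Z t) \<le> 1" for t
  proof -
    have "norm (1::ell2_op) \<le> 1" by (rule norm_op_bound) (simp_all add: op_apply_simps)
    then have "(norm (Z t))\<^sup>2 \<le> 1\<^sup>2" using cstar_identity[of "Z t"] by (simp add: ZZ)
    then show ?thesis using power2_le_imp_le zero_le_one by blast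
  qed
  moreover have "apply_bcontfun f t = Z t * apply_bcontfun f circle_one * star (Z t)"
    if f: "f \<in> quantum_CP1 q c" for f t
  proof -
    let ?S = "{f. \<forall>t. apply_bcontfun f t = Z t * apply_bcontfun f circle_one * star (Z t)}"
    have cont: "continuous_on UNIV (\<lambda>f::circle \<Rightarrow>\<^sub>C ell2_op. apply_bcontfun f s)" for s
      by (intro linear_continuous_on bounded_linear_intro[of _ 1])
        (simp_all add: norm_bounded)
    have S: "cstar_subalgebra ?S"
      unfolding cstar_subalgebra_def
    proof (intro conjI ballI allI)
      show "closed ?S"
        by (intro closed_Collect_all closed_Collect_eq cont continuous_intros)
      show "0 \<in> ?S" by simp
      fix f g k assume "f \<in> ?S" "g \<in> ?S"
      then have fg: "apply_bcontfun f t = Z t * apply_bcontfun f circle_one * star (Z t)"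
        "apply_bcontfun g t = Z t * apply_bcontfun g circle_one * star (Z t)" for t by blast+
      define a b where ab: "a = apply_bcontfun f circle_one" "b = apply_bcontfun g circle_one"
      note fg' = fg[folded ab]
      have cancel: "star (Z t) * (Z t * x) = x" for t x
        by (simp add: ZZ mult.assoc[symmetric])
      show "f + g \<in> ?S" "k *\<^sub>C f \<in> ?S" "f * g \<in> ?S" "star f \<in> ?S"
        by (intro CollectI allI, simp add: ab[symmetric], simp add: fg' distrib_left distrib_right
            mult_scaleC_left mult_scaleC_right star_mult star_star mult.assoc cancel)+
    qed
    have gen: "star (proj_coord q c i) * proj_coord q c j \<in> ?S" if ij: "i \<in> {1,2}" "j \<in> {1,2}" for i j
    proof -
      let ?X = "\<lambda>i::nat. apply_bcontfun (proj_coord q c i) circle_one"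
      let ?s = "\<lambda>(i::nat) t. if i = 1 then cnj (z t) else z t"
      have X: "apply_bcontfun (proj_coord q c i) t = ?s i t *\<^sub>C (U t * ?X i * star (U t))"
        if "i \<in> {1,2}" for i t
        using that proj_coord_conjugate(1,2)[of t] proj_coord_at_one
        by (auto simp: U_def z_def)
      have k: "V t * (star (?X i) * ?X j) * star (V t) =
          (cnj (?s i t) * ?s j t) *\<^sub>C (star (?X i) * ?X j)" for t
      proof -
        have zz: "z t * cnj (z t) = 1" "cnj (z t) * z t = 1" by (intro cnj_unit z(1))+
        have "V t * star ?B * star (V t) = star (V t * ?B * star (V t))"
          by (simp only: star_mult star_star mult.assoc)
        also have "\<dots> = (cnj (z t))\<^sup>2 *\<^sub>C star ?B" by (simp only: V(4) star_scaleC complex_cnj_power)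
        finally have B': "V t * (star (X2 q c) * X1 q c) * star (V t) =
            (cnj (z t))\<^sup>2 *\<^sub>C (star (X2 q c) * X1 q c)" by (simp add: star_mult star_star)
        have D: "V t * (star (X2 q c) * X2 q c) * star (V t) = star (X2 q c) * X2 q c"
          unfolding X2_X2 using V(1,3)
          by (simp add: left_diff_distrib right_diff_distrib mult.assoc)
        have s: "?s 1 t = cnj (z t)" "?s 2 t = z t" by simp_all
        consider "i = 1" "j = 1" | "i = 1" "j = 2" | "i = 2" "j = 1" | "i = 2" "j = 2"
          using ij by blast
        then show ?thesis
        proof cases
          case 1
          show ?thesis
            unfolding 1 s proj_coord_at_one complex_cnj_cnj zz scaleC_one by (rule V(3))
        next
          case 2
          show ?thesis
            unfolding 2 s proj_coord_at_one complex_cnj_cnj power2_eq_square[symmetric] by (rule V(4))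
        next
          case 3
          show ?thesis
            unfolding 3 s proj_coord_at_one power2_eq_square[symmetric] by (rule B')
        next
          case 4
          show ?thesis
            unfolding 4 s proj_coord_at_one zz scaleC_one by (rule D)
        qed
      qed
      have "apply_bcontfun (star (proj_coord q c i) * proj_coord q c j) t =
          Z t * (star (?X i) * ?X j) * star (Z t)" for t
      proof -
        have "apply_bcontfun (star (proj_coord q c i) * proj_coord q c j) t =
            (cnj (?s i t) * ?s j t) *\<^sub>C (U t * (star (?X i) * ?X j) * star (U t))"
          by (simp only: apply_bcontfun_times apply_bcontfun_star X[OF ij(1), of t] X[OF ij(2), of t]
              star_X_mult_scaled_conjugate[OF U])
        also have "\<dots> = U t * ((cnj (?s i t) * ?s j t) *\<^sub>C (star (?X i) * ?X j)) * star (U t)"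
          by (simp only: mult_scaleC_left mult_scaleC_right)
        also have "\<dots> = Z t * (star (?X i) * ?X j) * star (Z t)"
          unfolding k[symmetric] Z_def by (simp only: star_mult mult.assoc)
        finally show ?thesis .
      qed
      then show ?thesis unfolding mem_Collect_eq apply_bcontfun_times apply_bcontfun_star by blast
    qed
    have "quantum_CP1 q c \<subseteq> ?S"
      unfolding quantum_CP1_def using gen by (intro cstar_generated_least[OF S]) blast
    with f show ?thesis by blast
  qed
  ultimately show ?thesis by (rule that)
qed

text \<open>Evaluation at \<open>1\<close> is isometric, and its image is generated by all four products \<open>X\<^sub>i\<^sup>*X\<^sub>j\<close>. The
  two further products are redundant: one is \<open>B\<^sup>*\<close> and the other is affine in \<open>A\<close>.\<close>

lemma quantum_CP1_isomorphic:
  "quantum_CP1 q c \<cong>\<^sub>* cstar_generated {star (X1 q c) * X2 q c, star (X1 q c) * X1 q c}"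
proof -
  let ?A = "star (X1 q c) * X1 q c" and ?B = "star (X1 q c) * X2 q c"
  obtain J K where "podles_pair J K c ((inverse q)\<^sup>2) ?A ?B" using podles_pair_exists by blast
  then interpret podles_pair J K c "(inverse q)\<^sup>2" ?A ?B .
  let ?G = "{star (proj_coord q c i) * proj_coord q c j | i j. i \<in> {1, 2} \<and> j \<in> {1, 2}}"
  let ?ev = "\<lambda>f::circle \<Rightarrow>\<^sub>C ell2_op. apply_bcontfun f circle_one"
  obtain Z where Z: "\<And>t. norm (Z t) \<le> 1" "\<And>f t. f \<in> quantum_CP1 q c \<Longrightarrow>
      apply_bcontfun f t = Z t * apply_bcontfun f circle_one * star (Z t)"
    using quantum_CP1_conjugate by blast
  have "cstar_generated ?G \<cong>\<^sub>* cstar_generated (?ev ` ?G)"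
  proof (rule cstar_isomorphic_isometric_image)
    show "star_hom_on (cstar_generated ?G) ?ev" by (simp add: star_hom_on_def)
    fix f assume "f \<in> cstar_generated ?G"
    then have f: "f \<in> quantum_CP1 q c" by (simp add: quantum_CP1_def)
    have "norm f \<le> norm (?ev f)"
    proof (rule norm_bound)
      fix t
      have "norm (apply_bcontfun f t) \<le> norm (Z t) * norm (?ev f) * norm (star (Z t))"
        unfolding Z(2)[OF f, of t]
        by (intro order_trans[OF norm_mult_ineq] mult_right_mono norm_mult_ineq norm_ge_zero)
      also have "\<dots> \<le> 1 * norm (?ev f) * 1"
        unfolding norm_star by (intro mult_mono Z(1)) auto
      finally show "norm (apply_bcontfun f t) \<le> norm (?ev f)" by simp
    qed
    then show "norm (?ev f) = norm f" using norm_bounded[of f circle_one] by simp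
  qed
  moreover have "?ev ` ?G = {star (X1 q c) * X1 q c, star (X1 q c) * X2 q c,
      star (X2 q c) * X1 q c, star (X2 q c) * X2 q c}" (is "_ = ?H")
  proof -
    have "?G = {star (proj_coord q c 1) * proj_coord q c 1, star (proj_coord q c 1) * proj_coord q c 2,
      star (proj_coord q c 2) * proj_coord q c 1, star (proj_coord q c 2) * proj_coord q c 2}" by blast
    then show ?thesis
      by (simp only: image_insert image_empty apply_bcontfun_times apply_bcontfun_star proj_coord_at_one)
  qed
  moreover have "cstar_generated ?H = cstar_generated {?B, ?A}"
  proof (rule cstar_generated_eqI)
    have "star (X2 q c) * X1 q c = star ?B" by (simp add: star_mult star_star)
    then have "star (X2 q c) * X1 q c \<in> alg" using algD(5)[OF generators_in_alg(2)] by simp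
    moreover have "star (X2 q c) * X2 q c \<in> alg"
      unfolding X2_X2 by (intro algD one_in_alg generators_in_alg)
    ultimately show "?H \<subseteq> cstar_generated {?B, ?A}"
      using generators_in_alg unfolding alg_def by blast
    show "{?B, ?A} \<subseteq> cstar_generated ?H" using cstar_generated_superset[of ?H] by blast
  qed
  ultimately show ?thesis by (simp add: quantum_CP1_def)
qed

lemma isomorphic_toeplitz_pullback:
  assumes "symbol_map \<sigma>"
  shows "cstar_generated {star (X1 q c) * X2 q c, star (X1 q c) * X1 q c} \<cong>\<^sub>* toeplitz_pullback \<sigma>"
proof -
  obtain J K where "podles_pair J K c ((inverse q)\<^sup>2) (star (X1 q c) * X1 q c) (star (X1 q c) * X2 q c)"
    using podles_pair_exists by blast
  then interpret podles_pair J K c "(inverse q)\<^sup>2" "star (X1 q c) * X1 q c" "star (X1 q c) * X2 q c" .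
  show ?thesis using alg_isomorphic_pullback[OF assms] unfolding alg_def .
qed

end

theorem theorem3:
  fixes q c :: real
  assumes "1 < q" and "0 < c"
  shows "quantum_CP1 q c \<cong>\<^sub>* cstar_generated {star (X1 q c) * X2 q c, star (X1 q c) * X1 q c} \<and>
    (\<forall>\<sigma>. symbol_map \<sigma> \<longrightarrow> quantum_CP1 q c \<cong>\<^sub>* toeplitz_pullback \<sigma>)"
proof -
  interpret nonstandard_line q c using assms by unfold_locales
  show ?thesis
    using quantum_CP1_isomorphic isomorphic_toeplitz_pullback cstar_isomorphic_trans by blast
qed

end
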